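(* For every $n\ge 2$, the set $W_n$ is finite, the set of Lyndon atoms corresponding to $W_n$ is $N_n=\{f_0,f_1,\dots,f_{n-1}\}$, the Fibonacci algebra $F_n=K\langle x,y\rangle/(W_n)$ has Hilbert series $$\prod_{i=0}^{n-1}\frac{1}{1-t^{|f_i|}},$$ and the global dimension and the Gelfand-Kirillov dimension of $F_n$ are both equal to $n$.
   Context: $K$ is a field, $X=\{x,y\}$ with $x<y$, words are elements of the free monoid $X^*$, $X^+=X^*\setminus\{1\}$, $|w|$ is the length of $w$, $K\langle x,y\rangle$ is graded by length. Lexicographic order: $u<v$ iff $u$ is a proper left factor of $v$, or $u=axb$, $v=ayc$ with $a,b,c\in X^*$. A Lyndon word is a nonperiodic word $u\in X^+$ (not a proper power) such that $u=ab$ with $a,b\in X^+$ implies $u<ba$. The Fibonacci-Lyndon words are defined by $f_0=x$, $f_1=y$ and, for $k\ge1$, $f_{2k}=f_{2k-2}f_{2k-1}$, $f_{2k+1}=f_{2k}f_{2k-1}$ (concatenation). Let $U=\{f_{2k-2}f_{2k}\mid k\ge1\}\cup\{f_{2k+1}f_{2k-1}\mid k\ge 1\}$. For $n\ge2$ let $W_n$ be the set of all minimal elements of $U\cup\{f_n\}$ with respect to the subword (contiguous factor) relation. The Fibonacci algebra is $F_n=K\langle x,y\rangle/(W_n)$, where $(W_n)$ is the two-sided ideal generated by $W_n$. The set of Lyndon atoms corresponding to $W_n$ is the set of Lyndon words having no subword in $W_n$. The Gelfand-Kirillov dimension of a graded algebra $A=\bigoplus_i A_i$ generated in degree one is the infimum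 of the real $e$ such that $\sum_{i\le m}\dim_K A_i\le C m^e$ for some $C>0$ and all $m\ge1$. *)

theory Defs
  imports
    "HOL-Library.Poly_Mapping"
    "HOL-Library.Sublist"
    "HOL-Library.Extended_Nat"
    "HOL-Library.Extended_Real"
    "HOL-Computational_Algebra.Formal_Power_Series"
    "HOL-Algebra.Algebra"
    "HOL-Algebra.Algebraic_Closure_Type"
begin

section \<open>Words\<close>

datatype letter = LX | LY

text \<open>
  Lists form a monoid under concatenation. In additive notation (as the convolution product of
  \<^theory>\<open>HOL-Library.Poly_Mapping\<close> expects for exponents), this makes the type
  \<open>letter list \<Rightarrow>\<^sub>0 'k\<close> the monoid algebra of the free monoid on two letters, that is, the
  free associative algebra on \<open>x\<close> and \<open>y\<close>.
\<close>

instantiation list :: (type) monoid_add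
begin

definition zero_list :: "'a list" where "zero_list = []"

definition plus_list :: "'a list \<Rightarrow> 'a list \<Rightarrow> 'a list" where "plus_list u v = u @ v"

instance by standard (simp_all add: zero_list_def plus_list_def)

end

definition word_less :: "letter list \<Rightarrow> letter list \<Rightarrow> bool" where
  "word_less u v \<longleftrightarrow> (u, v) \<in> lexord {(LX, LY)}"

definition periodic :: "'a list \<Rightarrow> bool" where
  "periodic u \<longleftrightarrow> (\<exists>v k. k \<ge> 2 \<and> u = concat (replicate k v))"

definition lyndon :: "letter list \<Rightarrow> bool" where
  "lyndon u \<longleftrightarrow> u \<noteq> [] \<and> \<not> periodic u \<and>
     (\<forall>a b. a \<noteq> [] \<and> b \<noteq> [] \<and> u = a @ b \<longrightarrow> word_less u (b @ a))"

definition lyndon_atoms :: "letter list set \<Rightarrow> letter list set" where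
  "lyndon_atoms W = {u. lyndon u \<and> (\<forall>w\<in>W. \<not> sublist w u)}"

fun fib_lyndon :: "nat \<Rightarrow> letter list" where
  "fib_lyndon 0 = [LX]"
| "fib_lyndon (Suc 0) = [LY]"
| "fib_lyndon (Suc (Suc m)) =
     (if even m then fib_lyndon m @ fib_lyndon (Suc m) else fib_lyndon (Suc m) @ fib_lyndon m)"

definition fib_U :: "letter list set" where
  "fib_U = {fib_lyndon (2 * k - 2) @ fib_lyndon (2 * k) | k. k \<ge> 1} \<union>
           {fib_lyndon (2 * k + 1) @ fib_lyndon (2 * k - 1) | k. k \<ge> 1}"

definition fib_W :: "nat \<Rightarrow> letter list set" where
  "fib_W n = {w \<in> fib_U \<union> {fib_lyndon n}.
     \<forall>v \<in> fib_U \<union> {fib_lyndon n}. sublist v w \<longrightarrow> v = w}"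


section \<open>Monomial algebras\<close>

definition monomial_ideal :: "letter list set \<Rightarrow> (letter list \<Rightarrow>\<^sub>0 'k::field) set" where
  "monomial_ideal W = Idl\<^bsub>ring_of_type_algebra\<^esub> ((\<lambda>w. Poly_Mapping.single w 1) ` W)"

definition monomial_algebra :: "letter list set \<Rightarrow> (letter list \<Rightarrow>\<^sub>0 'k::field) set ring" where
  "monomial_algebra W = ring_of_type_algebra Quot (monomial_ideal W)"

text \<open>The image of the ground field and the images of the homogeneous components of the free
  algebra (graded by word length).\<close>

definition monomial_algebra_scalars ::
    "letter list set \<Rightarrow> (letter list \<Rightarrow>\<^sub>0 'k::field) set set" where
  "monomial_algebra_scalars W =
     {monomial_ideal W +>\<^bsub>ring_of_type_algebra\<^esub> Poly_Mapping.single [] c | c. True}"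

definition monomial_algebra_component ::
    "letter list set \<Rightarrow> nat \<Rightarrow> (letter list \<Rightarrow>\<^sub>0 'k::field) set set" where
  "monomial_algebra_component W i =
     {monomial_ideal W +>\<^bsub>ring_of_type_algebra\<^esub> p | p. \<forall>w \<in> Poly_Mapping.keys p. length w = i}"

abbreviation fib_algebra :: "nat \<Rightarrow> (letter list \<Rightarrow>\<^sub>0 'k::field) set ring" where
  "fib_algebra n \<equiv> monomial_algebra (fib_W n)"

abbreviation fib_scalars :: "nat \<Rightarrow> (letter list \<Rightarrow>\<^sub>0 'k::field) set set" where
  "fib_scalars n \<equiv> monomial_algebra_scalars (fib_W n)"

abbreviation fib_component :: "nat \<Rightarrow> nat \<Rightarrow> (letter list \<Rightarrow>\<^sub>0 'k::field) set set" where
  "fib_component n \<equiv> monomial_algebra_component (fib_W n)"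


section \<open>Hilbert series and Gelfand-Kirillov dimension\<close>

text \<open>Here \<open>A\<close> is a ring, \<open>K\<close> a subfield of it, and \<open>G i\<close> the homogeneous component of degree
  \<open>i\<close>, assumed finite-dimensional over \<open>K\<close>.\<close>

definition hilbert_series ::
    "('a, 'b) ring_scheme \<Rightarrow> 'a set \<Rightarrow> (nat \<Rightarrow> 'a set) \<Rightarrow> rat fps" where
  "hilbert_series A K G = Abs_fps (\<lambda>i. of_nat (ring.dim A K (G i)))"

definition gk_dimension ::
    "('a, 'b) ring_scheme \<Rightarrow> 'a set \<Rightarrow> (nat \<Rightarrow> 'a set) \<Rightarrow> ereal" where
  "gk_dimension A K G = Inf (ereal ` {e. \<exists>C>0. \<forall>m\<ge>1.
     real (\<Sum>i\<le>m. ring.dim A K (G i)) \<le> C * real m powr e})"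


section \<open>Modules over noncommutative rings and global dimension\<close>

text \<open>The locale \<^locale>\<open>module\<close> of the library requires a commutative ring of scalars, so only its
  record type is reused.\<close>

locale left_module = R?: ring R + M?: abelian_group M
  for R :: "('a, 'c) ring_scheme" and M :: "('a, 'b) module" +
  assumes smult_closed:
      "\<lbrakk>a \<in> carrier R; x \<in> carrier M\<rbrakk> \<Longrightarrow> a \<odot>\<^bsub>M\<^esub> x \<in> carrier M"
    and smult_l_distr:
      "\<lbrakk>a \<in> carrier R; b \<in> carrier R; x \<in> carrier M\<rbrakk> \<Longrightarrow>
         (a \<oplus>\<^bsub>R\<^esub> b) \<odot>\<^bsub>M\<^esub> x = (a \<odot>\<^bsub>M\<^esub> x) \<oplus>\<^bsub>M\<^esub> (b \<odot>\<^bsub>M\<^esub> x)"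
    and smult_r_distr:
      "\<lbrakk>a \<in> carrier R; x \<in> carrier M; y \<in> carrier M\<rbrakk> \<Longrightarrow>
         a \<odot>\<^bsub>M\<^esub> (x \<oplus>\<^bsub>M\<^esub> y) = (a \<odot>\<^bsub>M\<^esub> x) \<oplus>\<^bsub>M\<^esub> (a \<odot>\<^bsub>M\<^esub> y)"
    and smult_assoc:
      "\<lbrakk>a \<in> carrier R; b \<in> carrier R; x \<in> carrier M\<rbrakk> \<Longrightarrow>
         (a \<otimes>\<^bsub>R\<^esub> b) \<odot>\<^bsub>M\<^esub> x = a \<odot>\<^bsub>M\<^esub> (b \<odot>\<^bsub>M\<^esub> x)"
    and smult_one:
      "x \<in> carrier M \<Longrightarrow> \<one>\<^bsub>R\<^esub> \<odot>\<^bsub>M\<^esub> x = x"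

definition left_module_hom ::
    "('a, 'c) ring_scheme \<Rightarrow> ('a, 'u) module \<Rightarrow> ('a, 'v) module \<Rightarrow> ('u \<Rightarrow> 'v) set" where
  "left_module_hom R M N = {h \<in> carrier M \<rightarrow> carrier N.
     (\<forall>x\<in>carrier M. \<forall>y\<in>carrier M. h (x \<oplus>\<^bsub>M\<^esub> y) = h x \<oplus>\<^bsub>N\<^esub> h y) \<and>
     (\<forall>a\<in>carrier R. \<forall>x\<in>carrier M. h (a \<odot>\<^bsub>M\<^esub> x) = a \<odot>\<^bsub>N\<^esub> h x)}"

text \<open>
  The lifting property is tested on modules whose elements come from the same type \<open>'u\<close> as those
  of \<open>P\<close>. This is the usual notion as soon as the free module on the elements of \<open>P\<close> fits into
  \<open>'u\<close>, i.e.\ if \<open>'u\<close> is infinite and at least as large as \<open>R\<close>. The same condition makes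
  \<open>'u\<close> large enough for the projective resolutions below. See the type \<open>universe\<close>.
\<close>

definition projective_module :: "('a, 'c) ring_scheme \<Rightarrow> ('a, 'u) module \<Rightarrow> bool" where
  "projective_module R P \<longleftrightarrow> left_module R P \<and>
     (\<forall>(M :: ('a, 'u) module) (N :: ('a, 'u) module) g f.
        left_module R M \<and> left_module R N \<and>
        g \<in> left_module_hom R M N \<and> g ` carrier M = carrier N \<and> f \<in> left_module_hom R P N \<longrightarrow>
        (\<exists>h \<in> left_module_hom R P M. \<forall>x\<in>carrier P. g (h x) = f x))"

text \<open>\<open>0 \<rightarrow> P n \<rightarrow> \<dots> \<rightarrow> P 0 \<rightarrow> M \<rightarrow> 0\<close> is exact, where \<open>d i\<close> maps \<open>P i\<close> to \<open>T i\<close>,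
  that is, to \<open>M\<close> if \<open>i = 0\<close> and to \<open>P (i - 1)\<close> otherwise.\<close>

definition projective_resolution ::
    "('a, 'c) ring_scheme \<Rightarrow> ('a, 'u) module \<Rightarrow> nat \<Rightarrow>
     (nat \<Rightarrow> ('a, 'u) module) \<Rightarrow> (nat \<Rightarrow> 'u \<Rightarrow> 'u) \<Rightarrow> bool" where
  "projective_resolution R M n P d \<longleftrightarrow> (let T = case_nat M P in
     (\<forall>i\<le>n. projective_module R (P i) \<and> d i \<in> left_module_hom R (P i) (T i)) \<and>
     d 0 ` carrier (P 0) = carrier M \<and>
     (\<forall>i<n. d (Suc i) ` carrier (P (Suc i)) = a_kernel (P i) (T i) (d i)) \<and>
     inj_on (d n) (carrier (P n)))"

definition projective_dimension :: "('a, 'c) ring_scheme \<Rightarrow> ('a, 'u) module \<Rightarrow> enat" where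
  "projective_dimension R M = Inf {enat n | n. \<exists>P d. projective_resolution R M n P d}"

text \<open>
  A definition cannot quantify over all types, so the modules (and their resolutions) are taken
  in the type \<open>('a, 'u) universe\<close>. It is infinite and at least as large as both the type \<open>'a\<close> of
  the ring elements and the arbitrary type \<open>'u\<close>. Every module is thus isomorphic to one in such a
  type for suitable \<open>'u\<close>, and the notions of projective module and of projective dimension are the
  usual ones there. A statement with arbitrary \<open>'u\<close> covers modules of every size.
\<close>

type_synonym ('a, 'u) universe = "('a + 'u) list"

definition left_global_dimension :: "'u itself \<Rightarrow> ('a, 'c) ring_scheme \<Rightarrow> enat" where
  "left_global_dimension _ R =
     (SUP M \<in> {M :: ('a, ('a, 'u) universe) module. left_module R M}. projective_dimension R M)"

definition opposite_ring :: "('a, 'c) ring_scheme \<Rightarrow> ('a, 'c) ring_scheme" where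
  "opposite_ring R = R\<lparr>mult := \<lambda>a b. b \<otimes>\<^bsub>R\<^esub> a\<rparr>"

text \<open>Right modules over \<open>R\<close> are left modules over the opposite ring.\<close>

definition right_global_dimension :: "'u itself \<Rightarrow> ('a, 'c) ring_scheme \<Rightarrow> enat" where
  "right_global_dimension U R = left_global_dimension U (opposite_ring R)"

end

theory Submission
  imports Defs
begin

text \<open>
  The minimal relations of \<open>F\<^sub>n\<close> are Lyndon words, and so a word is nonzero in \<open>F\<^sub>n\<close> iff all factors
  of its Lyndon factorization are atoms, which turn out to be \<open>f\<^sub>0, \<dots>, f\<^sub>n\<^sub>-\<^sub>1\<close>. Sort them as
  \<open>a\<^sub>0 < \<dots> < a\<^sub>n\<^sub>-\<^sub>1\<close>. The nonincreasing products of atoms form a basis of \<open>F\<^sub>n\<close>, as for an enveloping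
  algebra; counting them yields the Hilbert series and the growth.

  Upper bound for the global dimension: the nonincreasing products of \<open>a\<^sub>0, \<dots>, a\<^sub>k\<^sub>-\<^sub>1\<close> span a
  subalgebra \<open>B\<^sub>k\<close> over which \<open>F\<^sub>n\<close> is a free right module. For every left module \<open>M\<close>, the induced
  module of \<open>M\<close> along \<open>B\<^sub>k\<^sub>+\<^sub>1\<close> is the cokernel of an injective map between two modules induced along \<open>B\<^sub>k\<close>,
  so that each step from \<open>B\<^sub>0 = K\<close> to \<open>B\<^sub>n = F\<^sub>n\<close> raises the projective dimension by at most one.

  Lower bound: all products \<open>a\<^sub>i a\<^sub>i\<^sub>+\<^sub>1\<close> are minimal relations, and they overlap in a chain of
  length \<open>n\<close>, starting and ending with a letter, which obstructs a shorter resolution of the trivial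
  module. Right modules are treated by reversing all words.
\<close>

section \<open>Lyndon words\<close>

text \<open>Why the induced modules fit together: let \<open>s\<close> be a nonempty product of
  atoms below \<open>a k\<close>. Then \<open>s @ a k\<close> is zero or again such a product,
  because the last factor of \<open>s\<close> merges with \<open>a k\<close> and stays below it.
  Hence the expression "t a_k \<otimes> m - t \<otimes> a_k m" vanishes when t is replaced by t s,
  and its natural source is the module induced from M with all nonempty words acting as zero. This
  twisted copy of M is the reason why each step is proved for all modules at once. The lower bound
  rests on the minimality of the relations: no proper suffix of an atom in the chain kills its
  successor, so the left ideal of the atom splits off the annihilator of the successor, and every
  relation costs one dimension. A formal obstacle shapes the algebra: projectivity and dimension
  refer to one fixed type of module elements, although direct sums and tensor products are built.
  Every module is therefore rewritten as a space of coefficient vectors with an action of words, and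
  each construction is carried back into the fixed type by an injection.\<close>

definition letter_less :: "letter list \<Rightarrow> letter list \<Rightarrow> bool" where
  "letter_less u v \<longleftrightarrow> (\<exists>p s t. u = p @ LX # s \<and> v = p @ LY # t)"

lemma word_less_iff: "word_less u v \<longleftrightarrow> strict_prefix u v \<or> letter_less u v"
  unfolding word_less_def lexord_def letter_less_def strict_prefix_def prefix_def
  by (auto simp: neq_Nil_conv)

text \<open>A difference at a letter survives arbitrary extensions on the right, which the prefix
  half of \<open>word_less\<close> does not. The arguments below therefore exclude or split off the
  prefix half before they extend words.\<close>

lemma letter_less_append: "letter_less u v \<Longrightarrow> letter_less (u @ s) (v @ t)"
  unfolding letter_less_def by fastforce

lemma word_less_irrefl [simp]: "\<not> word_less u u"
  by (simp add: word_less_def lexord_irreflexive)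

lemma word_less_trans: "word_less u v \<Longrightarrow> word_less v w \<Longrightarrow> word_less u w"
  unfolding word_less_def by (rule lexord_trans) (auto simp: trans_def)

lemma word_less_linear: "word_less u v \<or> u = v \<or> word_less v u"
  unfolding word_less_def by (rule lexord_linear) (metis letter.exhaust insertI1)

lemma word_less_asym: "word_less u v \<Longrightarrow> \<not> word_less v u"
  using word_less_trans word_less_irrefl by blast

lemma not_word_less_trans: "\<not> word_less u v \<Longrightarrow> \<not> word_less v w \<Longrightarrow> \<not> word_less u w"
  using word_less_linear word_less_trans by metis

lemma not_word_less_prefix: "prefix u v \<Longrightarrow> \<not> word_less v u"
  by (metis prefix_order.le_less word_less_asym word_less_iff word_less_irrefl)

lemma word_less_append_same [simp]: "word_less (u @ v) (u @ w) \<longleftrightarrow> word_less v w"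
proof (induction u)
  case (Cons c u)
  then show ?case by (cases c) (auto simp: word_less_def)
qed simp

lemma word_less_appendI: "w \<noteq> [] \<Longrightarrow> word_less u (u @ w)"
  by (auto simp: word_less_iff strict_prefix_def)

text \<open>The suffix criterion replaces rotations. If \<open>u = a @ b\<close> and
  \<open>b\<close> were below \<open>u\<close>, then either they differ at a letter, and the
  rotation \<open>b @ a\<close> is below \<open>u\<close> as well, or \<open>b\<close> is a prefix
  of \<open>u\<close>, and another rotation is too small. Conversely, a proper power has a
  nontrivial rotation equal to itself.\<close>

lemma lyndon_iff:
  "lyndon u \<longleftrightarrow> u \<noteq> [] \<and> (\<forall>a b. a \<noteq> [] \<and> b \<noteq> [] \<and> u = a @ b \<longrightarrow> word_less u b)"
  (is "_ \<longleftrightarrow> ?R")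
proof
  assume L: "lyndon u"
  show ?R
  proof (intro conjI allI impI)
    fix a b assume ab: "a \<noteq> [] \<and> b \<noteq> [] \<and> u = a @ b"
    have ba: "word_less u (b @ a)" using L ab by (auto simp: lyndon_def)
    show "word_less u b"
    proof (rule ccontr)
      assume "\<not> word_less u b"
      moreover have "u \<noteq> b" using ab by auto
      ultimately consider "strict_prefix b u" | "letter_less b u"
        using word_less_linear word_less_iff by metis
      then show False
      proof cases
        case 1
        then obtain c where c: "u = b @ c" "c \<noteq> []" by (auto simp: strict_prefix_def prefix_def)
        \<comment> \<open>Cancelling \<open>b\<close> compares \<open>c\<close> with
          \<open>a\<close>, which have equal length. The difference therefore sits at a letter and
          passes to \<open>c @ b\<close> and \<open>a @ b\<close>, against the minimality of
          \<open>u\<close> among its rotations.\<close>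
        have "word_less c a" using ba c by simp
        moreover have "length c = length a" using c ab by (metis add_left_cancel add.commute length_append)
        ultimately have "letter_less c a"
          unfolding word_less_iff by (auto dest: prefix_length_less)
        then have "word_less (c @ b) (a @ b)" by (simp add: word_less_iff letter_less_append)
        moreover have "word_less u (c @ b)" using L c ab by (auto simp: lyndon_def)
        ultimately show False using ab word_less_asym by auto
      next
        case 2
        then have "word_less (b @ a) u" using letter_less_append[of b u a "[]"] by (simp add: word_less_iff)
        then show False using ba word_less_asym by blast
      qed
    qed
  qed (use L in \<open>simp add: lyndon_def\<close>)
next
  assume R: ?R
  have rot: "word_less u (b @ a)" if "a \<noteq> []" "b \<noteq> []" "u = a @ b" for a b
  proof -
    have "word_less u b" using R that by auto
    then show ?thesis using that(1) word_less_appendI word_less_trans by blast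
  qed
  moreover have "\<not> periodic u"
  proof
    assume "periodic u"
    then obtain v k where k: "k \<ge> 2" "u = concat (replicate k v)" by (auto simp: periodic_def)
    then obtain j where j: "k = Suc (Suc j)" by (metis add_2_eq_Suc le_Suc_ex)
    let ?w = "concat (replicate (Suc j) v)"
    have "v \<noteq> []" using R k by auto
    have "u = v @ ?w" using k j by simp
    moreover have "?w @ v = v @ ?w"
    proof -
      have "concat (replicate m v) @ v = v @ concat (replicate m v)" for m by (induction m) auto
      then show ?thesis .
    qed
    ultimately show False using rot[of v ?w] \<open>v \<noteq> []\<close> by auto
  qed
  ultimately show "lyndon u" using R by (auto simp: lyndon_def)
qed

lemma lyndon_not_Nil: "lyndon u \<Longrightarrow> u \<noteq> []" by (simp add: lyndon_def)

lemma lyndon_less_suffix: "lyndon u \<Longrightarrow> u = a @ b \<Longrightarrow> a \<noteq> [] \<Longrightarrow> b \<noteq> [] \<Longrightarrow> word_less u b"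
  by (auto simp: lyndon_iff)

lemma lyndon_singleton [simp]: "lyndon [c]"
  by (auto simp: lyndon_iff Cons_eq_append_conv)

text \<open>The second claim carries the first: a suffix inside \<open>v\<close> is at least
  \<open>v\<close>, and one starting inside \<open>u\<close> extends a proper suffix of
  \<open>u\<close>, which is shorter than \<open>u\<close> and hence larger at a letter.\<close>

lemma
  assumes "lyndon u" "lyndon v" "word_less u v"
  shows lyndon_append: "lyndon (u @ v)" and lyndon_append_less: "word_less (u @ v) v"
proof -
  show less: "word_less (u @ v) v"
  proof (cases "letter_less u v")
    case True
    then show ?thesis using letter_less_append[of u v v "[]"] by (simp add: word_less_iff)
  next
    case False
    then obtain c where c: "v = u @ c" "c \<noteq> []"
      using assms(3) by (auto simp: word_less_iff strict_prefix_def prefix_def)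
    then have "word_less v c" using assms lyndon_less_suffix lyndon_not_Nil by blast
    then have "word_less (u @ v) (u @ c)" by simp
    then show ?thesis using c by simp
  qed
  have "word_less (u @ v) b" if h: "a \<noteq> []" "b \<noteq> []" "u @ v = a @ b" for a b
  proof (cases "length a \<ge> length u")
    case True
    then obtain a' where a': "a = u @ a'" "v = a' @ b"
      using h(3) by (metis append_eq_append_conv_if append_take_drop_id)
    show ?thesis
    proof (cases "a' = []")
      case False
      then have "word_less v b" using assms(2) a' h lyndon_less_suffix by blast
      then show ?thesis using less word_less_trans by blast
    qed (use a' less in simp)
  next
    case False
    then obtain s where s: "u = a @ s" "b = s @ v" "s \<noteq> []"
      using h(3) by (auto simp: append_eq_append_conv2)
    then have "word_less u s" using assms(1) h lyndon_less_suffix by blast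
    moreover have "\<not> strict_prefix u s" using s by (auto dest!: prefix_length_less)
    ultimately have "letter_less u s" by (simp add: word_less_iff)
    from letter_less_append[OF this, of v v] show ?thesis using s by (simp add: word_less_iff)
  qed
  then show "lyndon (u @ v)" using assms(1) by (auto simp: lyndon_iff)
qed

section \<open>Lyndon factorizations: existence, uniqueness, bounds on the factors\<close>

definition lyndon_list :: "letter list list \<Rightarrow> bool" where
  "lyndon_list ls \<longleftrightarrow> (\<forall>l\<in>set ls. lyndon l) \<and> sorted_wrt (\<lambda>u v. \<not> word_less u v) ls"

lemma lyndon_list_Nil [simp]: "lyndon_list []" by (simp add: lyndon_list_def)

lemma lyndon_list_Cons:
  "lyndon_list (l # ls) \<longleftrightarrow> lyndon l \<and> lyndon_list ls \<and> (\<forall>m\<in>set ls. \<not> word_less l m)"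
  by (auto simp: lyndon_list_def)

lemma lyndon_list_append:
  "lyndon_list (ls @ ms) \<longleftrightarrow> lyndon_list ls \<and> lyndon_list ms \<and>
     (\<forall>l\<in>set ls. \<forall>m\<in>set ms. \<not> word_less l m)"
  by (auto simp: lyndon_list_def sorted_wrt_append)

text \<open>Factorizations are computed by merging increasing neighbours, so a property that passes
  to such merges is inherited by all resulting factors.\<close>

definition merge_closed :: "(letter list \<Rightarrow> bool) \<Rightarrow> bool" where
  "merge_closed Q \<longleftrightarrow> (\<forall>u v. lyndon u \<longrightarrow> lyndon v \<longrightarrow> word_less u v \<longrightarrow> Q u \<longrightarrow> Q v \<longrightarrow> Q (u @ v))"

text \<open>The Chen-Fox-Lyndon theorem by insertion: \<open>l\<close> swallows the head of the list
  as long as it is smaller, each merge being Lyndon by \<open>lyndon_append\<close>.\<close>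

lemma lyndon_list_insert:
  assumes "merge_closed Q" "lyndon l" "Q l" "lyndon_list ms" "\<forall>m\<in>set ms. Q m"
  shows "\<exists>ls. lyndon_list ls \<and> (\<forall>m\<in>set ls. Q m) \<and> concat ls = l @ concat ms"
  using assms(2-)
proof (induction ms arbitrary: l)
  case Nil
  then show ?case by (intro exI[of _ "[l]"]) (simp add: lyndon_list_Cons)
next
  case (Cons m ms)
  show ?case
  proof (cases "word_less l m")
    case True
    have m: "lyndon m" "Q m" "lyndon_list ms" "\<forall>m\<in>set ms. Q m"
      using Cons.prems by (auto simp: lyndon_list_Cons)
    have "Q (l @ m)" using assms(1) Cons.prems(1,2) m(1,2) True by (auto simp: merge_closed_def)
    from Cons.IH[OF lyndon_append[OF Cons.prems(1) m(1) True] this m(3,4)]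
    show ?thesis by simp
  next
    case False
    then show ?thesis using Cons.prems not_word_less_trans
      by (intro exI[of _ "l # m # ms"]) (auto simp: lyndon_list_Cons)
  qed
qed

lemma lyndon_list_exists:
  assumes "merge_closed Q" "\<forall>l\<in>set ls. lyndon l \<and> Q l"
  shows "\<exists>ms. lyndon_list ms \<and> (\<forall>m\<in>set ms. Q m) \<and> concat ms = concat ls"
  using assms(2)
proof (induction ls)
  case Nil
  then show ?case by (intro exI[of _ "[]"]) simp
next
  case (Cons l ls)
  then obtain ms where "lyndon_list ms" "\<forall>m\<in>set ms. Q m" "concat ms = concat ls" by auto
  then show ?case using lyndon_list_insert[OF assms(1), of l ms] Cons.prems by auto
qed

lemma prefix_concat_split:
  assumes "prefix p (concat ms)" "p \<noteq> []"
  shows "\<exists>m\<in>set ms. \<exists>q r. q \<noteq> [] \<and> p = r @ q \<and> prefix q m"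
  using assms
proof (induction ms arbitrary: p)
  case (Cons m ms)
  show ?case
  proof (cases "prefix p m")
    case False
    then obtain p' where p': "p = m @ p'" "prefix p' (concat ms)"
      using Cons.prems by (auto simp: prefix_append)
    then have "p' \<noteq> []" using False by auto
    then obtain m' q r where h: "m' \<in> set ms" "q \<noteq> []" "p' = r @ q" "prefix q m'"
      using Cons.IH[OF p'(2)] by blast
    then have "p = (m @ r) @ q" using p' by simp
    then show ?thesis using h by (intro bexI[of _ m'] exI[of _ q] exI[of _ "m @ r"]) auto
  next
    case True
    then show ?thesis using Cons.prems
      by (intro bexI[of _ m] exI[of _ p] exI[of _ "[]"]) auto
  qed
qed simp

text \<open>If \<open>l = s @ p\<close> crossed from \<open>m\<close> into a later factor, \<open>p\<close> would end in a prefix \<open>q\<close> of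
  some \<open>m' \<le> m\<close>, and \<open>l < q \<le> m' \<le> m \<le> s \<le> l\<close>.\<close>

lemma lyndon_no_crossing:
  assumes "lyndon_list (m # ms)" "lyndon l" "l = s @ p" "s \<noteq> []" "p \<noteq> []"
    "suffix s m" "prefix p (concat ms)"
  shows False
proof -
  obtain m' q r where h: "m' \<in> set ms" "q \<noteq> []" "p = r @ q" "prefix q m'"
    using prefix_concat_split[OF assms(7,5)] by blast
  have "word_less l q" using lyndon_less_suffix[OF assms(2), of "s @ r" q] assms h by simp
  moreover have "\<not> word_less m' q" using h(4) by (rule not_word_less_prefix)
  moreover have "\<not> word_less m m'" using assms(1) h(1) by (simp add: lyndon_list_Cons)
  moreover have "\<not> word_less s m"
  proof -
    obtain a where "m = a @ s" using assms(6) by (auto simp: suffix_def)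
    then show ?thesis using lyndon_less_suffix[of m a s] assms(1,4) word_less_asym
      by (cases "a = []") (auto simp: lyndon_list_Cons)
  qed
  moreover have "\<not> word_less l s" using assms(3) by (intro not_word_less_prefix) simp
  ultimately show False using not_word_less_trans by blast
qed

text \<open>Avoiding a set of Lyndon words can thus be tested on the Lyndon factors one at a time;
  this is how the hypothesis that the relations are Lyndon enters.\<close>

lemma lyndon_sublist_concat:
  assumes "lyndon_list ms" "lyndon l" "sublist l (concat ms)"
  shows "\<exists>m\<in>set ms. sublist l m"
  using assms
proof (induction ms)
  case Nil
  then show ?case by (simp add: lyndon_not_Nil)
next
  case (Cons m ms)
  have ms: "lyndon_list ms" using Cons.prems by (simp add: lyndon_list_Cons)
  from Cons.prems(3) consider "sublist l m" | "sublist l (concat ms)"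
    | s p where "l = s @ p" "suffix s m" "prefix p (concat ms)"
    by (auto simp: sublist_append)
  then show ?case
  proof cases
    case 3
    show ?thesis
    proof (cases "s = [] \<or> p = []")
      case True
      then show ?thesis using 3 Cons.IH[OF ms Cons.prems(2)]
        by (metis append_Nil append_Nil2 list.set_intros prefix_imp_sublist suffix_imp_sublist)
    next
      case False
      then show ?thesis using lyndon_no_crossing[OF Cons.prems(1,2) 3(1)] 3 by blast
    qed
  qed (use Cons.IH[OF ms Cons.prems(2)] in auto)
qed

lemma lyndon_list_unique:
  "lyndon_list ls \<Longrightarrow> lyndon_list ms \<Longrightarrow> concat ls = concat ms \<Longrightarrow> ls = ms"
proof (induction ls arbitrary: ms)
  case Nil
  then show ?case by (cases ms) (auto simp: lyndon_list_Cons lyndon_not_Nil)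
next
  case (Cons l ls)
  then obtain m ms' where ms: "ms = m # ms'"
    by (cases ms) (auto simp: lyndon_list_Cons lyndon_not_Nil)
  \<comment> \<open>If the first factors differed in length, the longer one would cross from the
    shorter into its successors.\<close>
  have long: False if h: "lyndon_list (m # ms)" "lyndon l" "l @ x = m @ concat ms" "length l > length m"
    for l m x ms
  proof -
    obtain p where p: "l = m @ p" "p \<noteq> []" "p @ x = concat ms"
      using h(3,4) by (auto simp: append_eq_append_conv2)
    have "m \<noteq> []" using h(1) by (simp add: lyndon_list_Cons lyndon_not_Nil)
    moreover have "prefix p (concat ms)" using p(3) by (metis prefixI)
    ultimately show False using lyndon_no_crossing[OF h(1,2) p(1) _ p(2)] by simp
  qed
  have eq: "l @ concat ls = m @ concat ms'" using Cons.prems ms by simp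
  have "length l = length m"
    using long[of m ms' l "concat ls"] long[of l ls m "concat ms'"] Cons.prems ms eq
    by (metis linorder_neqE_nat lyndon_list_Cons)
  then have "l = m" "concat ls = concat ms'" using eq by auto
  then show ?case using Cons ms by (auto simp: lyndon_list_Cons)
qed

definition lyndon_fact :: "letter list \<Rightarrow> letter list list" where
  "lyndon_fact w = (THE ls. lyndon_list ls \<and> concat ls = w)"

lemma lyndon_fact_eqI: "lyndon_list ls \<Longrightarrow> lyndon_fact (concat ls) = ls"
  unfolding lyndon_fact_def by (rule the_equality) (auto dest: lyndon_list_unique)

lemma
  shows lyndon_list_fact: "lyndon_list (lyndon_fact w)"
    and concat_lyndon_fact: "concat (lyndon_fact w) = w"
proof -
  obtain ls where "lyndon_list ls" "concat ls = concat (map (\<lambda>c. [c]) w)"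
    using lyndon_list_exists[of "\<lambda>_. True" "map (\<lambda>c. [c]) w"] by (auto simp: merge_closed_def)
  moreover have "concat (map (\<lambda>c. [c]) w) = w" by (induction w) auto
  ultimately show "lyndon_list (lyndon_fact w)" "concat (lyndon_fact w) = w"
    using lyndon_fact_eqI by auto
qed

lemma lyndon_fact_Nil [simp]: "lyndon_fact [] = []"
  using lyndon_fact_eqI[of "[]"] by simp

lemma lyndon_fact_class:
  assumes "merge_closed Q" "\<forall>l\<in>set ls. lyndon l \<and> Q l"
  shows "\<forall>l\<in>set (lyndon_fact (concat ls)). Q l"
  using lyndon_list_exists[OF assms] lyndon_fact_eqI by metis

lemma lyndon_fact_append_class:
  assumes "merge_closed Q" "\<forall>l\<in>set (lyndon_fact v). Q l" "\<forall>l\<in>set (lyndon_fact w). Q l"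
  shows "\<forall>l\<in>set (lyndon_fact (v @ w)). Q l"
proof -
  have "\<forall>l\<in>set (lyndon_fact v @ lyndon_fact w). lyndon l \<and> Q l"
    using assms(2,3) lyndon_list_fact by (auto simp: lyndon_list_def)
  from lyndon_fact_class[OF assms(1) this] show ?thesis by (simp add: concat_lyndon_fact)
qed

lemma merge_closed_less: "merge_closed (\<lambda>l. word_less l c)"
  unfolding merge_closed_def using lyndon_append_less word_less_trans by blast

lemma merge_closed_greater: "merge_closed (\<lambda>l. word_less c l)"
  unfolding merge_closed_def using word_less_appendI word_less_trans lyndon_not_Nil by metis

text \<open>Nonemptiness of \<open>s\<close> matters: its last factor \<open>l\<close> absorbs
  \<open>u\<close>, and the merge stays below \<open>u\<close> because \<open>l @ u\<close> does.
  The bare word \<open>u\<close> would not be below itself.\<close>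

lemma lyndon_fact_snoc_less:
  assumes "lyndon u" "\<forall>l\<in>set (lyndon_fact s). word_less l u" "s \<noteq> []"
  shows "\<forall>l\<in>set (lyndon_fact (s @ u)). word_less l u"
proof -
  have ne: "lyndon_fact s \<noteq> []" using assms(3) concat_lyndon_fact[of s] by auto
  then obtain ls l where ls: "lyndon_fact s = ls @ [l]" by (metis rev_exhaust)
  have l: "lyndon l" "word_less l u" using lyndon_list_fact[of s] assms(2) ls by (auto simp: lyndon_list_def)
  have "\<forall>m\<in>set (ls @ [l @ u]). lyndon m \<and> word_less m u"
    using lyndon_list_fact[of s] assms(2) ls lyndon_append[OF l(1) assms(1) l(2)]
      lyndon_append_less[OF l(1) assms(1) l(2)] by (auto simp: lyndon_list_def)
  moreover have "concat (ls @ [l @ u]) = s @ u" using concat_lyndon_fact[of s] ls by auto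
  ultimately show ?thesis using lyndon_fact_class[OF merge_closed_less] by metis
qed

text \<open>The mirror image: \<open>u\<close> absorbs the first factor, and the merge exceeds its
  proper prefix \<open>u\<close>.\<close>

lemma lyndon_fact_cons_greater:
  assumes "lyndon u" "\<forall>l\<in>set (lyndon_fact s). word_less u l" "s \<noteq> []"
  shows "\<forall>l\<in>set (lyndon_fact (u @ s)). word_less u l"
proof -
  have ne: "lyndon_fact s \<noteq> []" using assms(3) concat_lyndon_fact[of s] by auto
  then obtain ls l where ls: "lyndon_fact s = l # ls" by (metis neq_Nil_conv)
  have l: "lyndon l" "word_less u l" using lyndon_list_fact[of s] assms(2) ls by (auto simp: lyndon_list_def)
  have "\<forall>m\<in>set ((u @ l) # ls). lyndon m \<and> word_less u m"
    using lyndon_list_fact[of s] assms(2) ls lyndon_append[OF assms(1) l]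
      word_less_appendI[OF lyndon_not_Nil[OF l(1)], of u] by (auto simp: lyndon_list_def)
  moreover have "concat ((u @ l) # ls) = u @ s" using concat_lyndon_fact[of s] ls by auto
  ultimately show ?thesis using lyndon_fact_class[OF merge_closed_greater] by metis
qed

text \<open>\<open>b\<close> grows by absorbing factors until one is left, which becomes
  \<open>m\<close>. Absorption cannot stop early: if \<open>b\<close> were not below the next
  factor, the word would have two Lyndon factorizations, one of them with a single factor.\<close>

lemma lyndon_split_aux:
  assumes "lyndon b" "lyndon_list ms" "ms \<noteq> []" "lyndon (b @ concat ms)"
  shows "\<exists>l m. b @ concat ms = l @ m \<and> lyndon l \<and> lyndon m \<and> word_less l m"
  using assms
proof (induction ms arbitrary: b)
  case (Cons m ms)
  have m: "lyndon m" "lyndon_list ms" using Cons.prems by (auto simp: lyndon_list_Cons)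
  show ?case
  proof (cases "word_less b m")
    case True
    show ?thesis
    proof (cases "ms = []")
      case False
      then show ?thesis using Cons.IH[OF lyndon_append[OF Cons.prems(1) m(1) True] m(2)] Cons.prems by simp
    qed (use True m Cons.prems in auto)
  next
    case False
    then have "lyndon_list (b # m # ms)"
      using Cons.prems not_word_less_trans by (auto simp: lyndon_list_Cons)
    moreover have "lyndon_list [b @ concat (m # ms)]" using Cons.prems by (simp add: lyndon_list_Cons)
    ultimately have "b # m # ms = [b @ concat (m # ms)]" by (rule lyndon_list_unique) simp
    then show ?thesis by simp
  qed
qed simp

lemma lyndon_split:
  assumes "lyndon u" "length u \<noteq> 1"
  obtains l m where "u = l @ m" "lyndon l" "lyndon m" "word_less l m"
proof -
  obtain c v where c: "u = c # v" using lyndon_not_Nil[OF assms(1)] by (cases u) auto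
  then have "v \<noteq> []" using assms(2) by auto
  then have "lyndon_fact v \<noteq> []" using concat_lyndon_fact[of v] by auto
  then show thesis
    using lyndon_split_aux[of "[c]" "lyndon_fact v"] lyndon_list_fact concat_lyndon_fact assms(1) c that
    by auto
qed


section \<open>Words avoiding a set of Lyndon words\<close>

definition normal_words :: "letter list set \<Rightarrow> letter list set" where
  "normal_words W = {w. \<forall>v\<in>W. \<not> sublist v w}"

lemma normal_words_sublist: "w \<in> normal_words W \<Longrightarrow> sublist v w \<Longrightarrow> v \<in> normal_words W"
  by (auto simp: normal_words_def dest: sublist_order.order_trans)

lemma lyndon_atoms_eq: "lyndon_atoms W = {l \<in> normal_words W. lyndon l}"
  by (auto simp: lyndon_atoms_def normal_words_def)

section \<open>Products of atoms as normal forms\<close>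

locale lyndon_monomial =
  fixes W :: "letter list set" and a :: "nat \<Rightarrow> letter list" and n :: nat
  assumes W_lyndon: "w \<in> W \<Longrightarrow> lyndon w"
    and atoms: "lyndon_atoms W = a ` {..<n}"
    and a_less: "i < j \<Longrightarrow> j < n \<Longrightarrow> word_less (a i) (a j)"
begin

abbreviation N where "N \<equiv> normal_words W"

text \<open>Poincare-Birkhoff-Witt monomials in the atoms from \<open>a i\<close> up to, but
  excluding, \<open>a j\<close>. \<open>PR 0 k\<close> spans a subalgebra, and \<open>PR k n\<close>
  is a basis of the algebra as a right module over it.\<close>

definition PR :: "nat \<Rightarrow> nat \<Rightarrow> letter list set" where
  "PR i j = {w \<in> N. set (lyndon_fact w) \<subseteq> a ` {i..<j}}"

lemma a_atom: "i < n \<Longrightarrow> a i \<in> N \<and> lyndon (a i)"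
  using atoms by (auto simp: lyndon_atoms_eq)

lemma a_less_iff: "i < n \<Longrightarrow> j < n \<Longrightarrow> word_less (a i) (a j) \<longleftrightarrow> i < j"
  using a_less word_less_asym word_less_irrefl by (metis linorder_neqE_nat)

lemma a_inj: "i < n \<Longrightarrow> j < n \<Longrightarrow> a i = a j \<longleftrightarrow> i = j"
  using a_less_iff word_less_irrefl by (metis linorder_neqE_nat)

lemma normal_iff: "w \<in> N \<longleftrightarrow> set (lyndon_fact w) \<subseteq> a ` {..<n}"
proof
  assume w: "w \<in> N"
  have "l \<in> lyndon_atoms W" if "l \<in> set (lyndon_fact w)" for l
  proof -
    have "sublist l (concat (lyndon_fact w))" using that by (metis concat.simps(2) concat_append
          split_list sublist_appendI)
    then show ?thesis using w that lyndon_list_fact normal_words_sublist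
      by (auto simp: lyndon_atoms_eq lyndon_list_def concat_lyndon_fact)
  qed
  then show "set (lyndon_fact w) \<subseteq> a ` {..<n}" using atoms by auto
next
  assume s: "set (lyndon_fact w) \<subseteq> a ` {..<n}"
  have False if v: "v \<in> W" "sublist v w" for v
  proof -
    obtain m where "m \<in> set (lyndon_fact w)" "sublist v m"
      using lyndon_sublist_concat[OF lyndon_list_fact[of w] W_lyndon[OF v(1)]] v(2)
      by (auto simp: concat_lyndon_fact)
    then show False using s a_atom v(1) by (auto simp: normal_words_def)
  qed
  then show "w \<in> N" by (auto simp: normal_words_def)
qed

lemma PR_iff: "j \<le> n \<Longrightarrow> w \<in> PR i j \<longleftrightarrow> set (lyndon_fact w) \<subseteq> a ` {i..<j}"
  unfolding PR_def using normal_iff by fastforce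

lemma PR_all: "PR 0 n = N"
  unfolding PR_def using normal_iff by (auto simp: atLeast0LessThan)

lemma PR_empty: "PR i i = {[]}"
proof -
  have "w = []" if "lyndon_fact w = []" for w using concat_lyndon_fact[of w] that by simp
  moreover have "[] \<in> N" unfolding normal_iff by simp
  ultimately show ?thesis by (auto simp: PR_def)
qed

lemma Nil_in_PR: "[] \<in> PR i j"
proof -
  have "[] \<in> N" unfolding normal_iff by simp
  then show ?thesis by (simp add: PR_def)
qed

lemma PR_mono: "i' \<le> i \<Longrightarrow> j \<le> j' \<Longrightarrow> PR i j \<subseteq> PR i' j'"
  unfolding PR_def by fastforce

text \<open>Factorizations are nonincreasing, so large atoms followed by small ones need no merging;
  this fixes the side on which the algebra is free over the smaller atoms.\<close>

lemma lyndon_fact_PR_append: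
  assumes "t \<in> PR k n" "s \<in> PR 0 k" "k \<le> n"
  shows "lyndon_fact (t @ s) = lyndon_fact t @ lyndon_fact s"
proof -
  have "lyndon_list (lyndon_fact t @ lyndon_fact s)"
  proof -
    have "\<not> word_less l m" if lm: "l \<in> set (lyndon_fact t)" "m \<in> set (lyndon_fact s)" for l m
    proof -
      have "l \<in> a ` {k..<n}" "m \<in> a ` {0..<k}" using lm assms by (auto simp: PR_def)
      then obtain i j where "l = a i" "m = a j" "k \<le> i" "i < n" "j < k" by auto
      then show ?thesis using a_less_iff assms(3) by auto
    qed
    then show ?thesis by (auto simp: lyndon_list_append lyndon_list_fact)
  qed
  from lyndon_fact_eqI[OF this] show ?thesis by (simp add: concat_lyndon_fact)
qed

lemma PR_append:
  assumes "t \<in> PR k n" "s \<in> PR 0 k" "k \<le> n"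
  shows "t @ s \<in> N"
  unfolding normal_iff lyndon_fact_PR_append[OF assms] using assms by (fastforce simp: PR_def)

lemma PR_split:
  assumes "w \<in> N" "k \<le> n"
  obtains t s where "t \<in> PR k n" "s \<in> PR 0 k" "w = t @ s"
proof -
  let ?B = "\<lambda>l. l \<in> a ` {k..<n}"
  let ?ls = "lyndon_fact w"
  have f: "set ?ls \<subseteq> a ` {..<n}" using assms normal_iff by blast
  have ll: "lyndon_list (takeWhile ?B ?ls)" "lyndon_list (dropWhile ?B ?ls)"
    using lyndon_list_fact[of w] lyndon_list_append by (metis takeWhile_dropWhile_id)+
  let ?t = "concat (takeWhile ?B ?ls)" and ?s = "concat (dropWhile ?B ?ls)"
  have "set (takeWhile ?B ?ls) \<subseteq> a ` {k..<n}" using set_takeWhileD by fast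
  then have t: "?t \<in> PR k n" using ll lyndon_fact_eqI by (subst PR_iff) auto
  \<comment> \<open>The first factor outside the upper block is small, and everything after it is at
    most as large.\<close>
  have "set (dropWhile ?B ?ls) \<subseteq> a ` {0..<k}"
  proof
    fix l assume l: "l \<in> set (dropWhile ?B ?ls)"
    then have "dropWhile ?B ?ls \<noteq> []" by (metis empty_iff empty_set)
    then obtain m ms where m: "dropWhile ?B ?ls = m # ms" by (metis neq_Nil_conv)
    have mk: "\<not> ?B m" using hd_dropWhile[of ?B ?ls] m by auto
    have inn: "m \<in> set ?ls" "l \<in> set ?ls" using m l by (metis list.set_intros(1) set_dropWhileD, metis set_dropWhileD)
    then obtain i j where ij: "m = a i" "l = a j" "i < n" "j < n" using f by blast
    have "\<not> word_less m l \<or> l = m" using ll(2) l m by (auto simp: lyndon_list_Cons)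
    then have "j \<le> i" using ij a_less_iff[of i j] a_inj[of j i] by auto
    moreover have "i < k" using mk ij by (metis atLeastLessThan_iff image_eqI leI)
    ultimately show "l \<in> a ` {0..<k}" using ij by auto
  qed
  then have s: "?s \<in> PR 0 k" using ll lyndon_fact_eqI assms(2) by (subst PR_iff) auto
  have "w = ?t @ ?s" by (metis concat_append concat_lyndon_fact takeWhile_dropWhile_id)
  then show thesis using that t s by blast
qed

lemma PR_split_unique:
  assumes "t \<in> PR k n" "s \<in> PR 0 k" "t' \<in> PR k n" "s' \<in> PR 0 k" "k \<le> n" "t @ s = t' @ s'"
  shows "t = t'" "s = s'"
proof -
  have eq: "lyndon_fact t @ lyndon_fact s = lyndon_fact t' @ lyndon_fact s'"
    using assms lyndon_fact_PR_append by metis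
  have sep: "l \<notin> a ` {0..<k}" if "l \<in> a ` {k..<n}" for l
    using that assms(5) a_inj by (auto simp: image_iff)
  have "filter (\<lambda>l. l \<in> a ` {k..<n}) (lyndon_fact t @ lyndon_fact s) = lyndon_fact t"
    if "t \<in> PR k n" "s \<in> PR 0 k" for t s
  proof -
    have "filter (\<lambda>l. l \<in> a ` {k..<n}) (lyndon_fact t) = lyndon_fact t"
      using that by (auto simp: PR_def filter_id_conv)
    moreover have "filter (\<lambda>l. l \<in> a ` {k..<n}) (lyndon_fact s) = []"
      using that sep by (force simp: PR_def filter_empty_conv)
    ultimately show ?thesis by simp
  qed
  then have "lyndon_fact t = lyndon_fact t'" using assms eq by metis
  then show "t = t'" by (metis concat_lyndon_fact)
  then show "s = s'" using assms by simp
qed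

text \<open>The premise \<open>k < n\<close> accommodates \<open>k = n\<close>, where no atom bounds
  the factors from above.\<close>

lemma merge_closed_lo: "merge_closed (\<lambda>l. k < n \<longrightarrow> word_less l (a k))"
  using merge_closed_less[of "a k"] by (auto simp: merge_closed_def)

lemma PR_lo_iff:
  assumes "w \<in> N" "k \<le> n"
  shows "w \<in> PR 0 k \<longleftrightarrow> (\<forall>l\<in>set (lyndon_fact w). k < n \<longrightarrow> word_less l (a k))"
proof -
  have "set (lyndon_fact w) \<subseteq> a ` {..<n}" using assms normal_iff by blast
  then show ?thesis unfolding PR_def using assms a_less_iff a_inj
    by (auto simp: subset_iff image_iff Ball_def) (metis atLeastLessThan_iff lessThan_iff less_le_trans le_eq_less_or_eq zero_le)+
qed

lemma PR_hi_iff: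
  assumes "w \<in> N" "k < n"
  shows "w \<in> PR (Suc k) n \<longleftrightarrow> (\<forall>l\<in>set (lyndon_fact w). word_less (a k) l)"
proof -
  have "set (lyndon_fact w) \<subseteq> a ` {..<n}" using assms normal_iff by blast
  then show ?thesis unfolding PR_def using assms a_less_iff a_inj
    by (auto simp: subset_iff image_iff Ball_def) (metis atLeastLessThan_iff lessThan_iff Suc_le_eq)+
qed

text \<open>Lying below \<open>a k\<close> passes to merges, so the smaller atoms span a subalgebra.
  For an arbitrary set of atoms this may fail, since merging can create new ones.\<close>

lemma PR_lo_append:
  assumes "v \<in> PR 0 k" "w \<in> PR 0 k" "v @ w \<in> N" "k \<le> n"
  shows "v @ w \<in> PR 0 k"
proof -
  have vw: "v \<in> N" "w \<in> N" using assms by (auto simp: PR_def)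
  show ?thesis
    using assms lyndon_fact_append_class[OF merge_closed_lo[of k], of v w]
    unfolding PR_lo_iff[OF vw(1) assms(4)] PR_lo_iff[OF vw(2) assms(4)] PR_lo_iff[OF assms(3,4)] by blast
qed

lemma PR_hi_append:
  assumes "v \<in> PR k n" "w \<in> PR k n" "v @ w \<in> N" "k \<le> n"
  shows "v @ w \<in> PR k n"
proof (cases k)
  case 0
  then show ?thesis using assms PR_all by simp
next
  case (Suc j)
  then have j: "j < n" using assms by simp
  have vw: "v \<in> N" "w \<in> N" using assms by (auto simp: PR_def)
  show ?thesis
    using assms lyndon_fact_append_class[OF merge_closed_greater[of "a j"], of v w] unfolding Suc
      PR_hi_iff[OF vw(1) j] PR_hi_iff[OF vw(2) j] PR_hi_iff[OF assms(3) j] by blast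
qed

text \<open>The key to the exact sequences for the global dimension: right multiplication by
  \<open>a k\<close> sends the augmentation ideal of the subalgebra of smaller atoms into that
  subalgebra.\<close>

lemma PR_lo_snoc:
  assumes "s \<in> PR 0 k" "s \<noteq> []" "s @ a k \<in> N" "k < n"
  shows "s @ a k \<in> PR 0 k"
proof -
  have "s \<in> N" using assms by (simp add: PR_def)
  then show ?thesis
    using assms PR_lo_iff[of s k] PR_lo_iff[of "s @ a k" k] lyndon_fact_snoc_less[of "a k" s] a_atom by auto
qed

text \<open>The counterpart for right modules, to be read after the reversal of all words.\<close>

lemma PR_hi_cons:
  assumes "s \<in> PR (Suc k) n" "s \<noteq> []" "a k @ s \<in> N" "k < n"
  shows "a k @ s \<in> PR (Suc k) n"
proof -
  have "s \<in> N" using assms by (simp add: PR_def)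
  then show ?thesis
    using assms PR_hi_iff[of s k] PR_hi_iff[of "a k @ s" k] lyndon_fact_cons_greater[of "a k" s] a_atom by auto
qed

lemma lyndon_fact_power: "k < n \<Longrightarrow> lyndon_fact (concat (replicate i (a k))) = replicate i (a k)"
  by (rule lyndon_fact_eqI) (auto simp: lyndon_list_def a_atom sorted_wrt_iff_nth_less)

lemma power_in_PR: "k < n \<Longrightarrow> concat (replicate i (a k)) \<in> PR k (Suc k)"
  by (subst PR_iff) (auto simp: lyndon_fact_power)

lemma power_inj: "k < n \<Longrightarrow> concat (replicate i (a k)) = concat (replicate j (a k)) \<longleftrightarrow> i = j"
  by (metis length_replicate lyndon_fact_power)

lemma PR_single: "k < n \<Longrightarrow> PR k (Suc k) = {concat (replicate i (a k)) | i. True}"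
proof (intro equalityI subsetI)
  fix w assume k: "k < n" and "w \<in> PR k (Suc k)"
  then have "set (lyndon_fact w) \<subseteq> {a k}" by (auto simp: PR_def)
  then have "lyndon_fact w = replicate (length (lyndon_fact w)) (a k)"
    by (metis replicate_length_same singletonD subsetD)
  then have "w = concat (replicate (length (lyndon_fact w)) (a k))" by (metis concat_lyndon_fact)
  then show "w \<in> {concat (replicate i (a k)) | i. True}" by blast
qed (use power_in_PR in auto)

lemma PR_append_mid:
  assumes "t \<in> PR j m" "s \<in> PR i j" "i \<le> j" "j \<le> m" "m \<le> n"
  shows "t @ s \<in> PR i m"
proof -
  have t: "t \<in> PR j n" and s: "s \<in> PR 0 j" using assms PR_mono by blast+
  have "lyndon_fact (t @ s) = lyndon_fact t @ lyndon_fact s"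
    using t s assms lyndon_fact_PR_append by simp
  then show ?thesis using PR_append[OF t s] assms by (fastforce simp: PR_def)
qed

lemma PR_split_mid:
  assumes "w \<in> PR i m" "i \<le> j" "j \<le> m" "m \<le> n"
  obtains t s where "t \<in> PR j m" "s \<in> PR i j" "w = t @ s"
proof -
  obtain t s where ts: "t \<in> PR j n" "s \<in> PR 0 j" "w = t @ s"
    using PR_split[of w j] assms by (auto simp: PR_def)
  have f: "lyndon_fact w = lyndon_fact t @ lyndon_fact s" using ts assms lyndon_fact_PR_append by simp
  have "l \<in> a ` {p..<q} \<Longrightarrow> l \<in> a ` {i..<m} \<Longrightarrow> q \<le> n \<Longrightarrow> l \<in> a ` ({p..<q} \<inter> {i..<m})" for l p q
    using assms a_inj by (auto simp: image_iff)
  moreover have "{j..<n} \<inter> {i..<m} \<subseteq> {j..<m}" "{0..<j} \<inter> {i..<m} \<subseteq> {i..<j}" by auto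
  moreover have "set (lyndon_fact t) \<subseteq> a ` {i..<m}" "set (lyndon_fact s) \<subseteq> a ` {i..<m}"
    using assms(1) f by (auto simp: PR_def)
  moreover have "set (lyndon_fact t) \<subseteq> a ` {j..<n}" "set (lyndon_fact s) \<subseteq> a ` {0..<j}" "j \<le> n"
    using ts assms by (auto simp: PR_def)
  ultimately have "set (lyndon_fact t) \<subseteq> a ` {j..<m}" "set (lyndon_fact s) \<subseteq> a ` {i..<j}"
    by (meson image_mono subset_iff order_refl)+
  then show thesis using that ts by (auto simp: PR_def)
qed

end


section \<open>Fibonacci-Lyndon words\<close>

definition tau_letter :: "letter \<Rightarrow> letter list" where
  "tau_letter c = (case c of LX \<Rightarrow> [LY] | LY \<Rightarrow> [LX, LY])"

text \<open>An antimorphism, so that it maps each Fibonacci-Lyndon word to the next one.\<close>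

definition tau :: "letter list \<Rightarrow> letter list" where
  "tau w = concat (map tau_letter (rev w))"

lemma tau_append [simp]: "tau (v @ w) = tau w @ tau v" by (simp add: tau_def)
lemma tau_Nil [simp]: "tau [] = []" by (simp add: tau_def)
lemma tau_single [simp]: "tau [LX] = [LY]" "tau [LY] = [LX, LY]" by (simp_all add: tau_def tau_letter_def)

lemma fib_lyndon_Suc: "fib_lyndon (Suc k) = tau (fib_lyndon k)"
proof (induction k rule: fib_lyndon.induct)
  case (3 m)
  have "fib_lyndon (Suc (Suc (Suc m))) = (if even m then fib_lyndon (Suc (Suc m)) @ fib_lyndon (Suc m)
      else fib_lyndon (Suc m) @ fib_lyndon (Suc (Suc m)))"
    unfolding fib_lyndon.simps(3)[of "Suc m"] by simp
  also have "\<dots> = tau (fib_lyndon (Suc (Suc m)))"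
  proof -
    have "tau (fib_lyndon (Suc (Suc m))) = (if even m then tau (fib_lyndon (Suc m)) @ tau (fib_lyndon m)
        else tau (fib_lyndon m) @ tau (fib_lyndon (Suc m)))"
      unfolding fib_lyndon.simps(3)[of m] by simp
    moreover have "fib_lyndon (Suc m) = tau (fib_lyndon m)"
      "fib_lyndon (Suc (Suc m)) = tau (fib_lyndon (Suc m))"
      using 3 by (cases "even m", simp_all only: simp_thms if_True if_False)+
    ultimately show ?thesis by (simp only:)
  qed
  finally show ?case .
qed auto

text \<open>The blocks \<open>[LY]\<close> and \<open>[LX, LY]\<close> differ in their first letter,
  so an image can be decoded from its left end, which corresponds to the right end of the original
  word.\<close>

lemma tau_prefix_imp_suffix: "prefix (tau v) (tau w) \<Longrightarrow> suffix v w"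
proof (induction v arbitrary: w rule: rev_induct)
  case (snoc c v)
  show ?case
  proof (cases w rule: rev_cases)
    case Nil
    then show ?thesis using snoc by (cases c) auto
  next
    case (snoc w' d)
    then show ?thesis using snoc.prems snoc.IH[of w'] by (cases c; cases d) auto
  qed
qed simp

text \<open>If \<open>v\<close> ends in \<open>LY\<close>, its image starts with \<open>LX\<close>,
  which occurs in images only at the start of a block. Every occurrence is therefore aligned with
  the blocks. Without alignment the claim fails: \<open>[LY]\<close>, the image of
  \<open>[LX]\<close>, occurs inside the block \<open>[LX, LY]\<close>.\<close>

lemma tau_sublist_imp_sublist:
  "sublist (tau v) (tau w) \<Longrightarrow> v \<noteq> [] \<Longrightarrow> last v = LY \<Longrightarrow> sublist v w"
proof (induction w rule: rev_induct)
  case Nil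
  then show ?case by (cases v rule: rev_cases) auto
next
  case (snoc d w)
  obtain v' where v': "v = v' @ [LY]" using snoc.prems by (metis append_butlast_last_id)
  then have v: "tau v = LX # LY # tau v'" by simp
  have "prefix (tau v) (tau (w @ [d])) \<or> sublist (tau v) (tau w)"
    using snoc.prems(1) unfolding v by (cases d) (auto simp: sublist_Cons_right)
  then show ?case
  proof
    assume "prefix (tau v) (tau (w @ [d]))"
    then show ?thesis using tau_prefix_imp_suffix suffix_imp_sublist by blast
  next
    assume "sublist (tau v) (tau w)"
    then show ?thesis using snoc sublist_append by blast
  qed
qed

lemma no_xx_tau: "\<not> sublist [LX, LX] (tau w)"
proof (induction w rule: rev_induct)
  case (snoc d w)
  then show ?case by (cases d) (auto simp: sublist_Cons_right)
qed simp

section \<open>The minimal relations of the Fibonacci algebra\<close>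

definition fib_rel :: "nat \<Rightarrow> letter list" where
  "fib_rel j = (if even j then fib_lyndon (j - 2) @ fib_lyndon j else fib_lyndon j @ fib_lyndon (j - 2))"

text \<open>The reason for indexing both families of \<open>fib_U\<close> by one parameter:
  \<open>tau\<close> becomes the shift of \<open>j\<close>, and questions about relations descend to
  the first one, \<open>[LX, LX, LY]\<close>.\<close>

lemma fib_rel_Suc: "j \<ge> 2 \<Longrightarrow> fib_rel (Suc j) = tau (fib_rel j)"
  unfolding fib_rel_def using fib_lyndon_Suc[of "j - 2"] fib_lyndon_Suc[of j]
    Suc_diff_le[of 2 j]
  by (auto simp del: fib_lyndon.simps diff_Suc_Suc)

lemma fib_U_eq: "fib_U = fib_rel ` {2..}"
proof -
  have "fib_U = (\<lambda>k. fib_rel (2 * k)) ` {1..} \<union> (\<lambda>k. fib_rel (2 * k + 1)) ` {1..}"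
    unfolding fib_U_def fib_rel_def by (auto simp: image_iff Bex_def)
  also have "\<dots> = fib_rel ` {2..}"
  proof (intro equalityI subsetI)
    fix w assume "w \<in> fib_rel ` {2..}"
    then obtain j where j: "w = fib_rel j" "j \<ge> 2" by auto
    show "w \<in> (\<lambda>k. fib_rel (2 * k)) ` {1..} \<union> (\<lambda>k. fib_rel (2 * k + 1)) ` {1..}"
    proof (cases "even j")
      case True
      then obtain k where "j = 2 * k" by blast
      then show ?thesis using j by auto
    next
      case False
      then obtain k where "j = 2 * k + 1" by (blast elim: oddE)
      then show ?thesis using j by auto
    qed
  qed auto
  finally show ?thesis .
qed

lemma fib_lyndon_Suc_Suc_even: "fib_lyndon (2 * m + 2) = fib_lyndon (2 * m) @ fib_lyndon (2 * m + 1)"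
  by simp

lemma fib_lyndon_Suc_Suc_odd: "fib_lyndon (2 * m + 3) = fib_lyndon (2 * m + 2) @ fib_lyndon (2 * m + 1)"
  by (simp add: numeral_3_eq_3)

text \<open>The even and the odd word of a level are treated together, because a pair e < o produces
  the next pair e o and e o o by two merges.\<close>

lemma lyndon_fib_aux:
  "lyndon (fib_lyndon (2 * m)) \<and> lyndon (fib_lyndon (2 * m + 1)) \<and>
   word_less (fib_lyndon (2 * m)) (fib_lyndon (2 * m + 1))"
proof (induction m)
  case 0
  show ?case by (simp add: word_less_def)
next
  case (Suc m)
  let ?e = "fib_lyndon (2 * m)" and ?o = "fib_lyndon (2 * m + 1)"
  have e: "fib_lyndon (2 * Suc m) = ?e @ ?o" using fib_lyndon_Suc_Suc_even[of m] by simp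
  have o: "fib_lyndon (2 * Suc m + 1) = (?e @ ?o) @ ?o"
    using fib_lyndon_Suc_Suc_odd[of m] e by (simp add: numeral_3_eq_3)
  have 1: "lyndon (?e @ ?o)" "word_less (?e @ ?o) ?o" using Suc lyndon_append lyndon_append_less by blast+
  then have "lyndon ((?e @ ?o) @ ?o)" using Suc lyndon_append by blast
  then show ?case unfolding e o using 1 Suc word_less_appendI lyndon_not_Nil by blast
qed

lemma lyndon_fib: "lyndon (fib_lyndon k)"
  using lyndon_fib_aux[of "k div 2"] by (cases "even k") auto

lemma fib_lyndon_not_Nil [simp]: "fib_lyndon k \<noteq> []"
  using lyndon_fib lyndon_not_Nil by blast

lemma prefix_fib_even: "i \<le> j \<Longrightarrow> prefix (fib_lyndon (2 * i)) (fib_lyndon (2 * j))"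
  by (induction rule: dec_induct) (auto intro: prefix_order.trans)

lemma suffix_fib_odd: "i \<le> j \<Longrightarrow> suffix (fib_lyndon (2 * i + 1)) (fib_lyndon (2 * j + 1))"
proof (induction rule: dec_induct)
  case (step j)
  then show ?case using fib_lyndon_Suc_Suc_odd[of j]
    by (auto simp: numeral_3_eq_3 intro: suffix_appendI simp del: fib_lyndon.simps)
qed simp

lemma fib_less_even: "i < j \<Longrightarrow> word_less (fib_lyndon (2 * i)) (fib_lyndon (2 * j))"
proof (induction rule: strict_inc_induct)
  case (base i)
  then show ?case using word_less_appendI[of "fib_lyndon (2 * i + 1)" "fib_lyndon (2 * i)"] by simp
next
  case (step i)
  then show ?case using word_less_appendI[of "fib_lyndon (2 * i + 1)" "fib_lyndon (2 * i)"]
    by (metis fib_lyndon_Suc_Suc_even fib_lyndon_not_Nil mult_Suc_right add.commute word_less_trans)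
qed

lemma fib_less_odd: "i < j \<Longrightarrow> word_less (fib_lyndon (2 * j + 1)) (fib_lyndon (2 * i + 1))"
proof -
  have step: "word_less (fib_lyndon (2 * i + 3)) (fib_lyndon (2 * i + 1))" for i
  proof -
    have "word_less (fib_lyndon (2 * i + 2)) (fib_lyndon (2 * i + 1))"
      using lyndon_fib_aux[of i] lyndon_append_less by (metis fib_lyndon_Suc_Suc_even)
    then show ?thesis unfolding fib_lyndon_Suc_Suc_odd using lyndon_append_less lyndon_fib by blast
  qed
  show "i < j \<Longrightarrow> word_less (fib_lyndon (2 * j + 1)) (fib_lyndon (2 * i + 1))"
  proof (induction rule: strict_inc_induct)
    case (base i)
    then show ?case using step[of i] by (simp add: numeral_3_eq_3)
  next
    case (step i)
    have "2 * Suc i + 1 = 2 * i + 3" by simp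
    then show ?case using step \<open>\<And>i. word_less (fib_lyndon (2 * i + 3)) (fib_lyndon (2 * i + 1))\<close> word_less_trans
      by metis
  qed
qed

lemma fib_less_even_odd: "word_less (fib_lyndon (2 * i)) (fib_lyndon (2 * j + 1))"
proof -
  consider "i < j" | "i = j" | "j < i" by linarith
  then show ?thesis
  proof cases
    case 1
    then show ?thesis using fib_less_even lyndon_fib_aux word_less_trans by blast
  next
    case 3
    then show ?thesis using fib_less_odd lyndon_fib_aux word_less_trans by blast
  qed (use lyndon_fib_aux in auto)
qed

lemma length_fib_Suc_Suc [simp]:
  "length (fib_lyndon (Suc (Suc k))) = length (fib_lyndon (Suc k)) + length (fib_lyndon k)"
  by simp

declare fib_lyndon.simps(3) [simp del]

lemma length_fib_less: "1 \<le> i \<Longrightarrow> i < j \<Longrightarrow> length (fib_lyndon i) < length (fib_lyndon j)"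
proof -
  assume "1 \<le> i" and ij: "i < j"
  have "length (fib_lyndon (Suc k)) < length (fib_lyndon (Suc (Suc k)))" for k by simp
  then have "strict_mono (\<lambda>k. length (fib_lyndon (Suc k)))" by (simp add: strict_mono_Suc_iff)
  from strict_monoD[OF this, of "i - 1" "j - 1"] show ?thesis using ij \<open>1 \<le> i\<close> by simp
qed

lemma length_fib_le: "i \<le> j \<Longrightarrow> length (fib_lyndon i) \<le> length (fib_lyndon j)"
proof -
  assume ij: "i \<le> j"
  have "length (fib_lyndon k) \<le> length (fib_lyndon (Suc k))" for k by (cases k) auto
  then show ?thesis using ij lift_Suc_mono_le[of "\<lambda>k. length (fib_lyndon k)"] by blast
qed

lemma length_fib_rel: "length (fib_rel j) = length (fib_lyndon j) + length (fib_lyndon (j - 2))"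
  by (simp add: fib_rel_def)

lemma length_fib_rel_less: "2 \<le> i \<Longrightarrow> i < j \<Longrightarrow> length (fib_rel i) < length (fib_rel j)"
  using length_fib_less[of i j] length_fib_le[of "i - 2" "j - 2"]
  by (simp add: length_fib_rel diff_le_mono add_less_le_mono)

lemma last_fib: "k \<ge> 1 \<Longrightarrow> last (fib_lyndon k) = LY"
  by (induction k rule: fib_lyndon.induct) (auto simp: fib_lyndon.simps(3) elim: oddE)

lemma last_fib_rel: "j \<ge> 2 \<Longrightarrow> last (fib_rel j) = LY"
  by (auto simp: fib_rel_def last_fib elim!: oddE)

lemma fib_rel_not_Nil: "fib_rel j \<noteq> []" by (simp add: fib_rel_def)

lemma fib_rel_2: "fib_rel 2 = [LX, LX, LY]"
  by (simp add: fib_rel_def numeral_2_eq_2 fib_lyndon.simps(3))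

lemma fib_rel_2_not_sublist: "\<not> sublist (fib_rel 2) (tau w)"
proof
  assume "sublist (fib_rel 2) (tau w)"
  moreover have "sublist [LX, LX] (fib_rel 2)" unfolding fib_rel_2 by (auto simp: sublist_def)
  ultimately show False using no_xx_tau sublist_order.order_trans by blast
qed

text \<open>Descent along \<open>tau\<close>: an inclusion can be desubstituted until the shorter
  relation is \<open>[LX, LX, LY]\<close>, and the square of \<open>LX\<close> never occurs in an
  image of \<open>tau\<close>.\<close>

lemma fib_rel_not_sublist_rel: "2 \<le> i \<Longrightarrow> i < j \<Longrightarrow> \<not> sublist (fib_rel i) (fib_rel j)"
proof (induction i arbitrary: j rule: dec_induct)
  case base
  then have "fib_rel j = tau (fib_rel (j - 1))" using fib_rel_Suc[of "j - 1"] by simp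
  then show ?case using fib_rel_2_not_sublist by simp
next
  case (step i)
  then have "fib_rel j = tau (fib_rel (j - 1))" "fib_rel (Suc i) = tau (fib_rel i)"
    using fib_rel_Suc[of "j - 1"] fib_rel_Suc[of i] by auto
  moreover have "\<not> sublist (fib_rel i) (fib_rel (j - 1))" using step by simp
  ultimately show ?case using tau_sublist_imp_sublist last_fib_rel fib_rel_not_Nil step by metis
qed

text \<open>The same descent; it may also end on the other side, at the letter
  \<open>fib_lyndon 0\<close>, which is too short.\<close>

lemma fib_rel_not_sublist_fib: "2 \<le> i \<Longrightarrow> \<not> sublist (fib_rel i) (fib_lyndon m)"
proof (induction i arbitrary: m rule: dec_induct)
  case base
  show ?case
  proof (cases m)
    case 0
    then show ?thesis by (auto simp: fib_rel_2 sublist_Cons_right)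
  qed (use fib_rel_2_not_sublist fib_lyndon_Suc in auto)
next
  case (step i)
  show ?case
  proof (cases m)
    case 0
    show ?thesis using length_fib_less[of 1 "Suc i"] step sublist_length_le[of "fib_rel (Suc i)" "fib_lyndon m"] 0
      by (auto simp: length_fib_rel)
  next
    case (Suc k)
    then show ?thesis
      using step fib_rel_Suc[of i] fib_lyndon_Suc[of k] tau_sublist_imp_sublist last_fib_rel fib_rel_not_Nil by metis
  qed
qed

lemma sublist_fib: "1 \<le> i \<Longrightarrow> i \<le> j \<Longrightarrow> sublist (fib_lyndon i) (fib_lyndon j)"
proof -
  assume "1 \<le> i" "i \<le> j"
  have "sublist (fib_lyndon (Suc k)) (fib_lyndon (Suc (Suc k)))" for k
    by (simp add: fib_lyndon.simps(3))
  from \<open>i \<le> j\<close> show ?thesis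
  proof (induction rule: dec_induct)
    case (step m)
    then obtain k where "m = Suc k" using \<open>1 \<le> i\<close> by (metis Suc_le_D le_trans One_nat_def)
    then show ?case using step \<open>sublist (fib_lyndon (Suc k)) (fib_lyndon (Suc (Suc k)))\<close> sublist_order.order_trans
      by blast
  qed simp
qed

lemma sublist_length_eq: "sublist u v \<Longrightarrow> length u = length v \<Longrightarrow> u = v"
  by (auto simp: sublist_def)

text \<open>A comparison of lengths. It is inconclusive only for \<open>n = 3\<close>, because the
  first two Fibonacci-Lyndon words have equal length; there \<open>[LX, LY, LY]\<close> and
  \<open>[LX, LX, LY]\<close> are compared directly.\<close>

lemma fib_not_sublist_rel:
  assumes "2 \<le> j" "j < n"
  shows "\<not> sublist (fib_lyndon n) (fib_rel j)"
proof
  assume s: "sublist (fib_lyndon n) (fib_rel j)"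
  obtain k where k: "n = Suc (Suc (Suc k))" using assms by (auto intro: that[of "n - 3"])
  have len: "length (fib_lyndon n) \<le> length (fib_rel j)" using s by (rule sublist_length_le)
  show False
  proof (cases k)
    case 0
    then have "j = 2" using assms k by simp
    moreover have "fib_lyndon n = [LX, LY, LY]" using k 0 by (simp add: fib_lyndon.simps(3))
    ultimately show False using sublist_length_eq[OF s] fib_rel_2 by simp
  next
    case (Suc l)
    have "length (fib_lyndon j) \<le> length (fib_lyndon (Suc (Suc k)))" using assms k by (intro length_fib_le) simp
    moreover have "length (fib_lyndon (j - 2)) \<le> length (fib_lyndon k)" using assms k by (intro length_fib_le) simp
    moreover have "length (fib_lyndon k) < length (fib_lyndon (Suc k))" using Suc length_fib_less by simp
    ultimately show False using len k by (simp add: length_fib_rel)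
  qed
qed

lemma fib_W_eq:
  assumes "n \<ge> 2" shows "fib_W n = insert (fib_lyndon n) (fib_rel ` {2..<n})"
proof (intro equalityI subsetI)
  fix w assume w: "w \<in> fib_W n"
  then consider j where "j \<ge> 2" "w = fib_rel j" | "w = fib_lyndon n"
    by (auto simp: fib_W_def fib_U_eq)
  then show "w \<in> insert (fib_lyndon n) (fib_rel ` {2..<n})"
  proof cases
    case 1
    \<comment> \<open>From \<open>j = n\<close> on, a member of \<open>fib_U\<close> contains
      \<open>fib_lyndon n\<close>, so minimality leaves only that word itself.\<close>
    have "w = fib_lyndon n" if "j \<ge> n"
    proof -
      have "sublist (fib_lyndon n) (fib_lyndon j)" using sublist_fib assms that by simp
      then have "sublist (fib_lyndon n) w" unfolding 1 fib_rel_def by (auto simp: sublist_append)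
      then show ?thesis using w unfolding fib_W_def by (auto dest: bspec)
    qed
    then show ?thesis using 1 by (cases "j < n") auto
  qed simp
next
  fix w assume "w \<in> insert (fib_lyndon n) (fib_rel ` {2..<n})"
  then consider j where "2 \<le> j" "j < n" "w = fib_rel j" | "w = fib_lyndon n" by auto
  then show "w \<in> fib_W n"
  proof cases
    case 1
    have "fib_rel i = fib_rel j" if "2 \<le> i" "sublist (fib_rel i) (fib_rel j)" for i
    proof (cases i j rule: linorder_cases)
      case less
      then show ?thesis using that fib_rel_not_sublist_rel by blast
    next
      case greater
      then show ?thesis using that length_fib_rel_less[of j i] 1 sublist_length_le[OF that(2)] by simp
    qed simp
    then show ?thesis using 1 fib_not_sublist_rel[of j n] by (auto simp: fib_W_def fib_U_eq)
  next
    case 2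
    then show ?thesis using fib_rel_not_sublist_fib by (auto simp: fib_W_def fib_U_eq)
  qed
qed

lemma lyndon_fib_rel: "j \<ge> 2 \<Longrightarrow> lyndon (fib_rel j)"
proof (cases "even j")
  case True
  assume "j \<ge> 2"
  then obtain k where k: "j = 2 * k + 2" using True by (auto elim!: evenE intro: that[of "j div 2 - 1"])
  then show ?thesis using fib_less_even[of k "Suc k"] lyndon_append lyndon_fib by (simp add: fib_rel_def)
next
  case False
  assume "j \<ge> 2"
  then obtain k where k: "j = 2 * k + 3" using False by (auto elim!: oddE intro: that[of "j div 2 - 1"])
  then show ?thesis using fib_less_odd[of k "Suc k"] lyndon_append lyndon_fib
    by (simp add: fib_rel_def numeral_3_eq_3)
qed

lemma lyndon_fib_W: "n \<ge> 2 \<Longrightarrow> w \<in> fib_W n \<Longrightarrow> lyndon w"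
  using fib_W_eq lyndon_fib lyndon_fib_rel by auto

section \<open>The Lyndon atoms of the Fibonacci algebra\<close>

lemma even_prefix_rel:
  assumes "i < j" shows "sublist (fib_rel (2 * i + 2)) (fib_lyndon (2 * i) @ fib_lyndon (2 * j) @ w)"
proof -
  obtain v where "fib_lyndon (2 * j) = fib_lyndon (2 * i + 2) @ v"
    using prefix_fib_even[of "Suc i" j] assms by (auto simp: prefix_def)
  then show ?thesis
    unfolding sublist_def by (intro exI[of _ "[]"] exI[of _ "v @ w"]) (simp add: fib_rel_def)
qed

lemma odd_suffix_rel:
  assumes "i < j" shows "sublist (fib_rel (2 * i + 3)) (w @ fib_lyndon (2 * j + 1) @ fib_lyndon (2 * i + 1))"
proof -
  obtain v where "fib_lyndon (2 * j + 1) = v @ fib_lyndon (2 * i + 3)"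
    using suffix_fib_odd[of "Suc i" j] assms by (auto simp: suffix_def numeral_3_eq_3)
  then show ?thesis
    unfolding sublist_def by (intro exI[of _ "w @ v"] exI[of _ "[]"]) (simp add: fib_rel_def)
qed

text \<open>The even words form a chain of prefixes and the odd words a chain of suffixes, so an
  increasing product of words that are not neighbours contains a relation. The remaining products
  are those of the Fibonacci recursion; they give the next word, and \<open>fib_lyndon n\<close> is
  excluded by normality.\<close>

lemma fib_lyndon_merge:
  assumes "n \<ge> 2" "i < n" "j < n" "word_less (fib_lyndon i) (fib_lyndon j)"
    and N: "fib_lyndon i @ fib_lyndon j \<in> normal_words (fib_W n)"
  shows "\<exists>k<n. fib_lyndon i @ fib_lyndon j = fib_lyndon k"
proof -
  have no: "\<not> sublist (fib_rel k) (fib_lyndon i @ fib_lyndon j)" if "2 \<le> k" "k < n" for k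
    using N that fib_W_eq[OF assms(1)] by (auto simp: normal_words_def)
  have noW: "fib_lyndon n \<noteq> fib_lyndon i @ fib_lyndon j"
    using N fib_W_eq[OF assms(1)] by (auto simp: normal_words_def)
  have par: "\<exists>m. k = 2 * m \<or> k = 2 * m + 1" for k :: nat by presburger
  obtain p where p: "i = 2 * p \<or> i = 2 * p + 1" using par by blast
  obtain q where q: "j = 2 * q \<or> j = 2 * q + 1" using par by blast
  consider "i = 2 * p" "j = 2 * q" | "i = 2 * p" "j = 2 * q + 1"
    | "i = 2 * p + 1" "j = 2 * q" | "i = 2 * p + 1" "j = 2 * q + 1" using p q by blast
  then show ?thesis
  proof cases
    case 1
    have "p < q"
    proof (rule ccontr)
      assume "\<not> p < q"
      then have "q < p \<or> p = q" by auto
      then show False using assms(4) 1 fib_less_even word_less_asym by auto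
    qed
    then show ?thesis using no[of "2 * p + 2"] even_prefix_rel[of p q "[]"] 1 assms(3) by simp
  next
    case 2
    consider "p < q" | "p = q" | "p = q + 1" | "p > q + 1" by linarith
    then show ?thesis
    proof cases
      case 1
      obtain m where m: "q = Suc m" using 1 by (cases q) auto
      \<comment> \<open>The odd word of larger index starts with an even word, which brings back the
        situation of two even words.\<close>
      have "fib_lyndon j = fib_lyndon (2 * q) @ fib_lyndon (2 * m + 1)"
        using fib_lyndon_Suc_Suc_odd[of m] m 2 by (simp add: numeral_3_eq_3)
      then show ?thesis using no[of "2 * p + 2"] even_prefix_rel[OF 1] 2 1 assms(3) by simp
    next
      case h: 2
      then have e: "fib_lyndon i @ fib_lyndon j = fib_lyndon (2 * p + 2)"
        using 2 fib_lyndon_Suc_Suc_even[of p] by simp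
      have "2 * p + 2 \<noteq> n" using e noW by auto
      then have "2 * p + 2 < n" using assms(3) 2 h by simp
      then show ?thesis using e by blast
    next
      case h: 3
      then have e: "fib_lyndon i @ fib_lyndon j = fib_lyndon (2 * q + 3)"
        using 2 fib_lyndon_Suc_Suc_odd[of q] by simp
      have "2 * q + 3 \<noteq> n" using e noW by auto
      then have "2 * q + 3 < n" using assms(2) 2 h by simp
      then show ?thesis using e by blast
    next
      case h: 4
      obtain m where m: "p = Suc m" using h by (cases p) auto
      have "fib_lyndon i = fib_lyndon (2 * m) @ fib_lyndon (2 * m + 1)"
        using fib_lyndon_Suc_Suc_even[of m] m 2 by simp
      then show ?thesis
        using no[of "2 * q + 3"] odd_suffix_rel[of q m "fib_lyndon (2 * m)"] 2 h m assms(2) by simp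
    qed
  next
    case 3
    then show ?thesis using fib_less_even_odd word_less_asym assms(4) by blast
  next
    case 4
    have "q < p"
    proof (rule ccontr)
      assume "\<not> q < p"
      then have "p < q \<or> p = q" by auto
      then show False using assms(4) 4 fib_less_odd word_less_asym by auto
    qed
    then show ?thesis using no[of "2 * q + 3"] odd_suffix_rel[of q p "[]"] 4 assms(2) by simp
  qed
qed

lemma lyndon_normal_imp_fib:
  assumes "n \<ge> 2" "lyndon u" "u \<in> normal_words (fib_W n)"
  shows "\<exists>i<n. u = fib_lyndon i"
  using assms(2,3)
proof (induction "length u" arbitrary: u rule: less_induct)
  case less
  show ?case
  proof (cases "length u = 1")
    case True
    then obtain c where "u = [c]" by (auto simp: length_Suc_conv)
    then show ?thesis using assms(1)
      by (cases c) (auto intro: exI[of _ 0] exI[of _ "Suc 0"])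
  next
    case False
    then obtain l m where u: "u = l @ m" "lyndon l" "lyndon m" "word_less l m"
      using lyndon_split[OF less.prems(1)] by blast
    have "l \<in> normal_words (fib_W n)" "m \<in> normal_words (fib_W n)"
      using less.prems(2) u(1) normal_words_sublist by (auto simp: sublist_append)
    moreover have "length l < length u" "length m < length u" using u lyndon_not_Nil by auto
    ultimately obtain i j where "i < n" "j < n" "l = fib_lyndon i" "m = fib_lyndon j"
      using less.hyps u by blast
    then show ?thesis using fib_lyndon_merge[OF assms(1), of i j] less.prems u by simp
  qed
qed

theorem lyndon_atoms_fib_W:
  assumes "n \<ge> 2" shows "lyndon_atoms (fib_W n) = fib_lyndon ` {..<n}"
proof -
  have "fib_lyndon i \<in> normal_words (fib_W n)" if "i < n" for i
  proof -
    have "\<not> sublist (fib_lyndon n) (fib_lyndon i)"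
    proof
      assume "sublist (fib_lyndon n) (fib_lyndon i)"
      then have "length (fib_lyndon n) \<le> length (fib_lyndon i)" by (rule sublist_length_le)
      moreover have "length (fib_lyndon i) < length (fib_lyndon n)"
        using that assms length_fib_less[of i n] length_fib_less[of 1 n] by (cases i) auto
      ultimately show False by simp
    qed
    then show ?thesis using fib_W_eq[OF assms] fib_rel_not_sublist_fib by (auto simp: normal_words_def)
  qed
  then show ?thesis using lyndon_normal_imp_fib[OF assms] lyndon_fib by (auto simp: lyndon_atoms_eq)
qed

text \<open>The first \<open>n\<close> Fibonacci-Lyndon words in lexicographic order:
  \<open>f\<^sub>0 < f\<^sub>2 < f\<^sub>4 < \<dots> < f\<^sub>5 < f\<^sub>3 < f\<^sub>1\<close>.\<close>

definition fib_index :: "nat \<Rightarrow> nat \<Rightarrow> nat" where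
  "fib_index n i = (if 2 * i < n then 2 * i else 2 * (n - 1 - i) + 1)"

lemma fib_index_less: "i < n \<Longrightarrow> fib_index n i < n"
  by (auto simp: fib_index_def)

lemma fib_index_word_less:
  assumes "i < j" "j < n"
  shows "word_less (fib_lyndon (fib_index n i)) (fib_lyndon (fib_index n j))"
  using assms fib_less_even[of i j] fib_less_even_odd[of i "n - 1 - j"] fib_less_odd[of "n - 1 - j" "n - 1 - i"]
  by (auto simp: fib_index_def)

lemma fib_index_image: "fib_index n ` {..<n} = {..<n}"
proof -
  have "inj_on (fib_index n) {..<n}"
    by (rule inj_onI) (metis fib_index_word_less lessThan_iff linorder_neqE_nat word_less_irrefl)
  moreover have "fib_index n ` {..<n} \<subseteq> {..<n}" using fib_index_less by auto
  ultimately show ?thesis by (simp add: endo_inj_surj)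
qed

lemma fib_index_bij: "bij_betw (fib_index n) {..<n} {..<n}"
  using fib_index_image by (simp add: bij_betw_def eq_card_imp_inj_on)

text \<open>Neighbours within the ascending half of even indices, or within the descending half of
  odd ones, multiply to a member of \<open>fib_U\<close>. In the middle the words of the two largest
  indices \<open>n - 2\<close> and \<open>n - 1\<close> meet, in the order that produces
  \<open>fib_lyndon n\<close>.\<close>

lemma fib_index_relation:
  assumes "Suc i < n"
  shows "fib_lyndon (fib_index n i) @ fib_lyndon (fib_index n (Suc i)) \<in> fib_W n"
proof -
  have n: "n \<ge> 2" using assms by simp
  consider "2 * Suc i < n" | "2 * i \<ge> n" | "2 * i < n" "2 * Suc i \<ge> n" by linarith
  then show ?thesis
  proof cases
    case 1
    then have "fib_lyndon (fib_index n i) @ fib_lyndon (fib_index n (Suc i)) = fib_rel (2 * i + 2)"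
      by (simp add: fib_index_def fib_rel_def)
    then show ?thesis using 1 by (auto simp: fib_W_eq[OF n])
  next
    case 2
    obtain m where m: "n - 1 - i = Suc m" using assms by (auto intro: that[of "n - 1 - i - 1"])
    have m': "n - 1 - Suc i = m" using m by simp
    have "fib_lyndon (fib_index n i) @ fib_lyndon (fib_index n (Suc i)) = fib_rel (2 * m + 3)"
      using 2 m m' by (simp add: fib_index_def fib_rel_def numeral_3_eq_3)
    moreover have "2 * m + 3 < n" using 2 m by linarith
    ultimately show ?thesis by (auto simp: fib_W_eq[OF n])
  next
    case 3
    then consider "n = 2 * i + 2" | m where "i = Suc m" "n = 2 * m + 3"
      using assms by (cases i) fastforce+
    then have "fib_lyndon (fib_index n i) @ fib_lyndon (fib_index n (Suc i)) = fib_lyndon n"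
    proof cases
      case 1
      then show ?thesis using fib_lyndon_Suc_Suc_even[of i] by (simp add: fib_index_def)
    next
      case (2 m)
      then have "n - 1 - Suc i = m" by simp
      then show ?thesis using 2 fib_lyndon_Suc_Suc_odd[of m] by (simp add: fib_index_def)
    qed
    then show ?thesis by (simp add: fib_W_eq[OF n])
  qed
qed


section \<open>Modules and projective dimension\<close>

lemma left_module_homI:
  assumes "\<And>x. x \<in> carrier M \<Longrightarrow> h x \<in> carrier N"
    and "\<And>x y. x \<in> carrier M \<Longrightarrow> y \<in> carrier M \<Longrightarrow> h (x \<oplus>\<^bsub>M\<^esub> y) = h x \<oplus>\<^bsub>N\<^esub> h y"
    and "\<And>a x. a \<in> carrier R \<Longrightarrow> x \<in> carrier M \<Longrightarrow> h (a \<odot>\<^bsub>M\<^esub> x) = a \<odot>\<^bsub>N\<^esub> h x"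
  shows "h \<in> left_module_hom R M N"
  using assms by (auto simp: left_module_hom_def)

lemma
  assumes "h \<in> left_module_hom R M N"
  shows left_module_hom_closed: "x \<in> carrier M \<Longrightarrow> h x \<in> carrier N"
    and left_module_hom_add:
      "x \<in> carrier M \<Longrightarrow> y \<in> carrier M \<Longrightarrow> h (x \<oplus>\<^bsub>M\<^esub> y) = h x \<oplus>\<^bsub>N\<^esub> h y"
    and left_module_hom_smult:
      "a \<in> carrier R \<Longrightarrow> x \<in> carrier M \<Longrightarrow> h (a \<odot>\<^bsub>M\<^esub> x) = a \<odot>\<^bsub>N\<^esub> h x"
  using assms by (auto simp: left_module_hom_def)

lemma left_moduleI:
  assumes "ring R"
    and "\<zero>\<^bsub>M\<^esub> \<in> carrier M"
    and "\<And>x y. x \<in> carrier M \<Longrightarrow> y \<in> carrier M \<Longrightarrow> x \<oplus>\<^bsub>M\<^esub> y \<in> carrier M"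
    and "\<And>x y z. x \<in> carrier M \<Longrightarrow> y \<in> carrier M \<Longrightarrow> z \<in> carrier M \<Longrightarrow>
      (x \<oplus>\<^bsub>M\<^esub> y) \<oplus>\<^bsub>M\<^esub> z = x \<oplus>\<^bsub>M\<^esub> (y \<oplus>\<^bsub>M\<^esub> z)"
    and "\<And>x y. x \<in> carrier M \<Longrightarrow> y \<in> carrier M \<Longrightarrow> x \<oplus>\<^bsub>M\<^esub> y = y \<oplus>\<^bsub>M\<^esub> x"
    and "\<And>x. x \<in> carrier M \<Longrightarrow> \<zero>\<^bsub>M\<^esub> \<oplus>\<^bsub>M\<^esub> x = x"
    and "\<And>x. x \<in> carrier M \<Longrightarrow> \<exists>y \<in> carrier M. y \<oplus>\<^bsub>M\<^esub> x = \<zero>\<^bsub>M\<^esub>"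
    and "\<And>a x. a \<in> carrier R \<Longrightarrow> x \<in> carrier M \<Longrightarrow> a \<odot>\<^bsub>M\<^esub> x \<in> carrier M"
    and "\<And>a b x. a \<in> carrier R \<Longrightarrow> b \<in> carrier R \<Longrightarrow> x \<in> carrier M \<Longrightarrow>
      (a \<oplus>\<^bsub>R\<^esub> b) \<odot>\<^bsub>M\<^esub> x = (a \<odot>\<^bsub>M\<^esub> x) \<oplus>\<^bsub>M\<^esub> (b \<odot>\<^bsub>M\<^esub> x)"
    and "\<And>a x y. a \<in> carrier R \<Longrightarrow> x \<in> carrier M \<Longrightarrow> y \<in> carrier M \<Longrightarrow>
      a \<odot>\<^bsub>M\<^esub> (x \<oplus>\<^bsub>M\<^esub> y) = (a \<odot>\<^bsub>M\<^esub> x) \<oplus>\<^bsub>M\<^esub> (a \<odot>\<^bsub>M\<^esub> y)"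
    and "\<And>a b x. a \<in> carrier R \<Longrightarrow> b \<in> carrier R \<Longrightarrow> x \<in> carrier M \<Longrightarrow>
      (a \<otimes>\<^bsub>R\<^esub> b) \<odot>\<^bsub>M\<^esub> x = a \<odot>\<^bsub>M\<^esub> (b \<odot>\<^bsub>M\<^esub> x)"
    and "\<And>x. x \<in> carrier M \<Longrightarrow> \<one>\<^bsub>R\<^esub> \<odot>\<^bsub>M\<^esub> x = x"
  shows "left_module R M"
proof -
  interpret R: ring R by fact
  interpret M: abelian_group M by (rule abelian_groupI) (use assms in auto)
  show ?thesis by unfold_locales (use assms in auto)
qed

lemma (in left_module) smult_zero: "a \<in> carrier R \<Longrightarrow> a \<odot>\<^bsub>M\<^esub> \<zero>\<^bsub>M\<^esub> = \<zero>\<^bsub>M\<^esub>"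
  by (metis M.add.l_cancel_one' M.l_zero M.zero_closed smult_closed smult_r_distr)

lemma (in left_module) zero_smult: "x \<in> carrier M \<Longrightarrow> \<zero>\<^bsub>R\<^esub> \<odot>\<^bsub>M\<^esub> x = \<zero>\<^bsub>M\<^esub>"
  by (metis M.add.l_cancel_one' R.l_zero R.zero_closed smult_closed smult_l_distr)

lemma (in left_module) minus_smult:
  assumes "x \<in> carrier M" shows "(\<ominus>\<^bsub>R\<^esub> \<one>\<^bsub>R\<^esub>) \<odot>\<^bsub>M\<^esub> x = \<ominus>\<^bsub>M\<^esub> x"
proof -
  have "((\<ominus>\<^bsub>R\<^esub> \<one>\<^bsub>R\<^esub>) \<odot>\<^bsub>M\<^esub> x) \<oplus>\<^bsub>M\<^esub> x = ((\<ominus>\<^bsub>R\<^esub> \<one>\<^bsub>R\<^esub>) \<oplus>\<^bsub>R\<^esub> \<one>\<^bsub>R\<^esub>) \<odot>\<^bsub>M\<^esub> x"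
    using assms by (simp add: smult_l_distr smult_one)
  also have "\<dots> = \<zero>\<^bsub>M\<^esub>" using assms by (simp add: R.l_neg zero_smult)
  finally show ?thesis using assms by (simp add: M.minus_equality smult_closed)
qed

lemma left_module_hom_zero:
  assumes "h \<in> left_module_hom R M N" "left_module R M" "left_module R N"
  shows "h \<zero>\<^bsub>M\<^esub> = \<zero>\<^bsub>N\<^esub>"
proof -
  interpret M: left_module R M by fact
  interpret N: left_module R N by fact
  have "h \<zero>\<^bsub>M\<^esub> = h (\<zero>\<^bsub>R\<^esub> \<odot>\<^bsub>M\<^esub> \<zero>\<^bsub>M\<^esub>)" by (simp add: M.zero_smult)
  also have "\<dots> = \<zero>\<^bsub>N\<^esub>"
    using assms(1) by (simp add: left_module_hom_smult N.zero_smult left_module_hom_closed)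
  finally show ?thesis .
qed

lemma left_module_hom_minus:
  assumes "h \<in> left_module_hom R M N" "left_module R M" "left_module R N" "x \<in> carrier M"
  shows "h (\<ominus>\<^bsub>M\<^esub> x) = \<ominus>\<^bsub>N\<^esub> h x"
proof -
  interpret M: left_module R M by fact
  interpret N: left_module R N by fact
  show ?thesis
    using assms by (simp flip: M.minus_smult N.minus_smult
        add: left_module_hom_smult left_module_hom_closed)
qed

lemma left_module_hom_diff:
  assumes "h \<in> left_module_hom R M N" "left_module R M" "left_module R N"
    "x \<in> carrier M" "y \<in> carrier M"
  shows "h (x \<ominus>\<^bsub>M\<^esub> y) = h x \<ominus>\<^bsub>N\<^esub> h y"
proof -
  interpret M: left_module R M by fact
  interpret N: left_module R N by fact
  show ?thesis
    using assms by (simp add: a_minus_def left_module_hom_minus left_module_hom_add)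
qed

lemma left_module_hom_comp:
  assumes "f \<in> left_module_hom R M N" "g \<in> left_module_hom R N P"
  shows "(\<lambda>x. g (f x)) \<in> left_module_hom R M P"
  using assms by (auto simp: left_module_hom_def Pi_iff)

lemma left_module_hom_id: "(\<lambda>x. x) \<in> left_module_hom R M M"
  by (auto simp: left_module_hom_def)

lemma left_module_hom_plus:
  assumes "f \<in> left_module_hom R M N" "g \<in> left_module_hom R M N" "left_module R M" "left_module R N"
  shows "(\<lambda>x. f x \<oplus>\<^bsub>N\<^esub> g x) \<in> left_module_hom R M N"
proof -
  interpret M: left_module R M by fact
  interpret N: left_module R N by fact
  note [simp] = left_module_hom_closed[OF assms(1)] left_module_hom_closed[OF assms(2)]
    left_module_hom_add[OF assms(1)] left_module_hom_add[OF assms(2)]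
    left_module_hom_smult[OF assms(1)] left_module_hom_smult[OF assms(2)]
  show ?thesis
    by (rule left_module_homI) (simp_all add: N.smult_r_distr N.M.a_ac)
qed

lemma left_module_hom_uminus:
  assumes "f \<in> left_module_hom R M N" "left_module R M" "left_module R N"
  shows "(\<lambda>x. \<ominus>\<^bsub>N\<^esub> f x) \<in> left_module_hom R M N"
proof -
  interpret M: left_module R M by fact
  interpret N: left_module R N by fact
  note [simp] = left_module_hom_closed[OF assms(1)] left_module_hom_add[OF assms(1)]
    left_module_hom_smult[OF assms(1)]
  have "a \<odot>\<^bsub>N\<^esub> (\<ominus>\<^bsub>N\<^esub> y) = \<ominus>\<^bsub>N\<^esub> (a \<odot>\<^bsub>N\<^esub> y)" if "a \<in> carrier R" "y \<in> carrier N" for a y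
  proof -
    have "(a \<odot>\<^bsub>N\<^esub> (\<ominus>\<^bsub>N\<^esub> y)) \<oplus>\<^bsub>N\<^esub> (a \<odot>\<^bsub>N\<^esub> y) = \<zero>\<^bsub>N\<^esub>"
      using that by (simp flip: N.smult_r_distr add: N.M.l_neg N.smult_zero)
    then show ?thesis using that by (metis N.M.a_inv_closed N.M.minus_equality N.smult_closed)
  qed
  then show ?thesis
    by (intro left_module_homI) (simp_all add: N.M.minus_add)
qed

lemma left_module_hom_minus_fun:
  assumes "f \<in> left_module_hom R M N" "g \<in> left_module_hom R M N" "left_module R M" "left_module R N"
  shows "(\<lambda>x. f x \<ominus>\<^bsub>N\<^esub> g x) \<in> left_module_hom R M N"
  unfolding a_minus_def using assms by (intro left_module_hom_plus left_module_hom_uminus)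

lemma left_module_restrict:
  assumes "left_module R M" "S \<subseteq> carrier M" "\<zero>\<^bsub>M\<^esub> \<in> S"
    and "\<And>x y. x \<in> S \<Longrightarrow> y \<in> S \<Longrightarrow> x \<oplus>\<^bsub>M\<^esub> y \<in> S"
    and "\<And>a x. a \<in> carrier R \<Longrightarrow> x \<in> S \<Longrightarrow> a \<odot>\<^bsub>M\<^esub> x \<in> S"
  shows "left_module R (M\<lparr>carrier := S\<rparr>)"
proof -
  interpret M: left_module R M by fact
  show ?thesis
  proof (rule left_moduleI)
    fix x assume "x \<in> carrier (M\<lparr>carrier := S\<rparr>)"
    then have x: "x \<in> S" "x \<in> carrier M" using assms(2) by auto
    have "\<ominus>\<^bsub>M\<^esub> x \<in> S"
      using x assms(5)[of "\<ominus>\<^bsub>R\<^esub> \<one>\<^bsub>R\<^esub>" x] by (simp add: M.minus_smult)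
    then show "\<exists>y\<in>carrier (M\<lparr>carrier := S\<rparr>). y \<oplus>\<^bsub>M\<lparr>carrier := S\<rparr>\<^esub> x = \<zero>\<^bsub>M\<lparr>carrier := S\<rparr>\<^esub>"
      using x M.M.l_neg by (intro bexI[of _ "\<ominus>\<^bsub>M\<^esub> x"]) auto
  qed (use assms(2-) M.R.ring_axioms in \<open>auto simp: subset_iff M.M.a_assoc M.smult_l_distr M.smult_r_distr
      M.smult_assoc M.smult_one intro: M.M.a_comm\<close>)
qed

definition ker_module :: "('a, 'u) module \<Rightarrow> ('a, 'v) module \<Rightarrow> ('u \<Rightarrow> 'v) \<Rightarrow> ('a, 'u) module" where
  "ker_module M N f = M\<lparr>carrier := a_kernel M N f\<rparr>"

lemma carrier_ker_module: "carrier (ker_module M N f) = {x \<in> carrier M. f x = \<zero>\<^bsub>N\<^esub>}"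
  by (simp add: ker_module_def a_kernel_def')

lemma ker_module_simps [simp]:
  "\<zero>\<^bsub>ker_module M N f\<^esub> = \<zero>\<^bsub>M\<^esub>" "x \<oplus>\<^bsub>ker_module M N f\<^esub> y = x \<oplus>\<^bsub>M\<^esub> y"
  "a \<odot>\<^bsub>ker_module M N f\<^esub> x = a \<odot>\<^bsub>M\<^esub> x"
  by (simp_all add: ker_module_def)

lemma left_module_ker:
  assumes "left_module R M" "left_module R N" "f \<in> left_module_hom R M N"
  shows "left_module R (ker_module M N f)"
proof -
  interpret M: left_module R M by fact
  interpret N: left_module R N by fact
  have "carrier (ker_module M N f) = a_kernel M N f" by (simp add: ker_module_def)
  then have "a_kernel M N f = {x \<in> carrier M. f x = \<zero>\<^bsub>N\<^esub>}" by (simp add: carrier_ker_module)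
  then show ?thesis unfolding ker_module_def
    using left_module_hom_zero[OF assms(3,1,2)] left_module_hom_add[OF assms(3)]
      left_module_hom_smult[OF assms(3)]
    by (intro left_module_restrict[OF assms(1)]) (auto simp: M.smult_closed N.smult_zero)
qed

lemma ker_module_incl: "(\<lambda>x. x) \<in> left_module_hom R (ker_module M N f) M"
  by (rule left_module_homI) (auto simp: carrier_ker_module)

lemma left_module_hom_into_ker:
  assumes "h \<in> left_module_hom R L M" "\<And>x. x \<in> carrier L \<Longrightarrow> f (h x) = \<zero>\<^bsub>N\<^esub>"
  shows "h \<in> left_module_hom R L (ker_module M N f)"
  using assms by (auto simp: left_module_hom_def carrier_ker_module)

lemma left_module_hom_inv:
  assumes "f \<in> left_module_hom R M N" "bij_betw f (carrier M) (carrier N)" "left_module R M"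
  shows "inv_into (carrier M) f \<in> left_module_hom R N M"
proof -
  interpret M: left_module R M by fact
  let ?g = "inv_into (carrier M) f"
  have gc: "?g y \<in> carrier M" if "y \<in> carrier N" for y
    using that assms(2) by (metis bij_betw_def inv_into_into)
  have fg: "f (?g y) = y" if "y \<in> carrier N" for y
    using that assms(2) by (simp add: bij_betw_inv_into_right)
  have gf: "?g (f x) = x" if "x \<in> carrier M" for x
    using that assms(2) by (simp add: bij_betw_inv_into_left)
  show ?thesis
  proof (rule left_module_homI)
    fix x y assume "x \<in> carrier N" "y \<in> carrier N"
    then show "?g (x \<oplus>\<^bsub>N\<^esub> y) = ?g x \<oplus>\<^bsub>M\<^esub> ?g y"
      using left_module_hom_add[OF assms(1), of "?g x" "?g y"] gf[of "?g x \<oplus>\<^bsub>M\<^esub> ?g y"] by (simp add: gc fg)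
  next
    fix a y assume "a \<in> carrier R" "y \<in> carrier N"
    then show "?g (a \<odot>\<^bsub>N\<^esub> y) = a \<odot>\<^bsub>M\<^esub> ?g y"
      using left_module_hom_smult[OF assms(1), of a "?g y"] gf[of "a \<odot>\<^bsub>M\<^esub> ?g y"]
      by (simp add: gc fg M.smult_closed)
  qed (rule gc)
qed

lemma projective_moduleI:
  fixes P :: "('a, 'u) module"
  assumes "left_module R P"
    and "\<And>(M :: ('a, 'u) module) (N :: ('a, 'u) module) g f. left_module R M \<Longrightarrow> left_module R N \<Longrightarrow>
      g \<in> left_module_hom R M N \<Longrightarrow> g ` carrier M = carrier N \<Longrightarrow> f \<in> left_module_hom R P N \<Longrightarrow>
      \<exists>h \<in> left_module_hom R P M. \<forall>x\<in>carrier P. g (h x) = f x"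
  shows "projective_module R P"
  using assms unfolding projective_module_def by blast

lemma projective_moduleD: "projective_module R P \<Longrightarrow> left_module R P"
  by (simp add: projective_module_def)

lemma projective_module_lift:
  fixes P :: "('a, 'u) module" and M N :: "('a, 'u) module"
  assumes P: "projective_module R P" and M: "left_module R M" "left_module R N"
    "g \<in> left_module_hom R M N" "g ` carrier M = carrier N" "f \<in> left_module_hom R P N"
  obtains h where "h \<in> left_module_hom R P M" "\<And>x. x \<in> carrier P \<Longrightarrow> g (h x) = f x"
proof -
  have "\<exists>h\<in>left_module_hom R P M. \<forall>x\<in>carrier P. g (h x) = f x"
    by (rule conjunct2[OF P[unfolded projective_module_def], rule_format, of M N g f]) (intro conjI M)
  then show thesis using that by blast
qed

text \<open>The two pairs of maps exhibit \<open>M\<close> as a direct summand of \<open>N \<oplus> Q\<close>.\<close>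

lemma projective_module_retract:
  fixes M N Q :: "('a, 'u) module"
  assumes "left_module R M" "projective_module R N" "projective_module R Q"
    and i1: "i1 \<in> left_module_hom R M N" and p1: "p1 \<in> left_module_hom R N M"
    and i2: "i2 \<in> left_module_hom R M Q" and p2: "p2 \<in> left_module_hom R Q M"
    and id: "\<And>x. x \<in> carrier M \<Longrightarrow> p1 (i1 x) \<oplus>\<^bsub>M\<^esub> p2 (i2 x) = x"
  shows "projective_module R M"
proof (rule projective_moduleI)
  fix V Y :: "('a, 'u) module" and g f
  assume XY: "left_module R V" "left_module R Y" "g \<in> left_module_hom R V Y"
    "g ` carrier V = carrier Y" and f: "f \<in> left_module_hom R M Y"
  obtain h1 where h1: "h1 \<in> left_module_hom R N V" "\<And>x. x \<in> carrier N \<Longrightarrow> g (h1 x) = f (p1 x)"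
    using projective_module_lift[OF assms(2) XY left_module_hom_comp[OF p1 f]] by blast
  obtain h2 where h2: "h2 \<in> left_module_hom R Q V" "\<And>x. x \<in> carrier Q \<Longrightarrow> g (h2 x) = f (p2 x)"
    using projective_module_lift[OF assms(3) XY left_module_hom_comp[OF p2 f]] by blast
  let ?h = "\<lambda>x. h1 (i1 x) \<oplus>\<^bsub>V\<^esub> h2 (i2 x)"
  have "?h \<in> left_module_hom R M V"
    by (intro left_module_hom_plus left_module_hom_comp[OF i1 h1(1)]
        left_module_hom_comp[OF i2 h2(1)] assms XY)
  moreover have "g (?h x) = f x" if x: "x \<in> carrier M" for x
  proof -
    have c: "i1 x \<in> carrier N" "i2 x \<in> carrier Q"
      using x i1 i2 by (auto intro: left_module_hom_closed)
    have "g (?h x) = f (p1 (i1 x)) \<oplus>\<^bsub>Y\<^esub> f (p2 (i2 x))"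
      using c h1 h2 by (simp add: left_module_hom_add[OF XY(3)] left_module_hom_closed)
    also have "\<dots> = f x"
      using c p1 p2 by (simp add: left_module_hom_closed id x flip: left_module_hom_add[OF f])
    finally show ?thesis .
  qed
  ultimately show "\<exists>h \<in> left_module_hom R M V. \<forall>x\<in>carrier M. g (h x) = f x" by (intro bexI[of _ ?h] ballI)
qed (fact assms)

text \<open>Projectivity and dimension are tested in one fixed type of elements. An injective
  pairing on that type keeps direct sums inside it; \<open>fs\<close> and \<open>sn\<close> recover
  the components.\<close>

locale pairing =
  fixes pr :: "'v \<Rightarrow> 'v \<Rightarrow> 'v" and fs sn :: "'v \<Rightarrow> 'v"
  assumes fs_pr [simp]: "fs (pr x y) = x" and sn_pr [simp]: "sn (pr x y) = y"
begin

definition dsum :: "('a, 'v) module \<Rightarrow> ('a, 'v) module \<Rightarrow> ('a, 'v) module" where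
  "dsum M N = \<lparr>carrier = {pr x y | x y. x \<in> carrier M \<and> y \<in> carrier N},
     monoid.mult = (\<lambda>u v. u), one = pr \<zero>\<^bsub>M\<^esub> \<zero>\<^bsub>N\<^esub>, ring.zero = pr \<zero>\<^bsub>M\<^esub> \<zero>\<^bsub>N\<^esub>,
     ring.add = (\<lambda>u v. pr (fs u \<oplus>\<^bsub>M\<^esub> fs v) (sn u \<oplus>\<^bsub>N\<^esub> sn v)),
     module.smult = (\<lambda>a u. pr (a \<odot>\<^bsub>M\<^esub> fs u) (a \<odot>\<^bsub>N\<^esub> sn u))\<rparr>"

lemma dsum_simps [simp]:
  "carrier (dsum M N) = {pr x y | x y. x \<in> carrier M \<and> y \<in> carrier N}"
  "\<zero>\<^bsub>dsum M N\<^esub> = pr \<zero>\<^bsub>M\<^esub> \<zero>\<^bsub>N\<^esub>"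
  "u \<oplus>\<^bsub>dsum M N\<^esub> v = pr (fs u \<oplus>\<^bsub>M\<^esub> fs v) (sn u \<oplus>\<^bsub>N\<^esub> sn v)"
  "a \<odot>\<^bsub>dsum M N\<^esub> u = pr (a \<odot>\<^bsub>M\<^esub> fs u) (a \<odot>\<^bsub>N\<^esub> sn u)"
  by (simp_all add: dsum_def)

lemma pr_in_dsum: "pr x y \<in> carrier (dsum M N) \<longleftrightarrow> x \<in> carrier M \<and> y \<in> carrier N"
proof
  assume "pr x y \<in> carrier (dsum M N)"
  then obtain a b where h: "pr x y = pr a b" "a \<in> carrier M" "b \<in> carrier N" by auto
  have "x = a" "y = b" using arg_cong[OF h(1), of fs] arg_cong[OF h(1), of sn] by simp_all
  then show "x \<in> carrier M \<and> y \<in> carrier N" using h by simp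
qed auto

lemma left_module_dsum:
  assumes "left_module R M" "left_module R N"
  shows "left_module R (dsum M N)"
proof -
  interpret M: left_module R M by fact
  interpret N: left_module R N by fact
  have E: "\<exists>a\<in>carrier M. \<exists>b\<in>carrier N. u = pr a b" if "u \<in> carrier (dsum M N)" for u
    using that by auto
  note I = pr_in_dsum[of _ _ M N]
  show ?thesis
  proof (rule left_moduleI)
    show "ring R" by (rule M.R.ring_axioms)
    show "\<zero>\<^bsub>dsum M N\<^esub> \<in> carrier (dsum M N)" unfolding dsum_simps(2) I by simp
  next
    fix u assume "u \<in> carrier (dsum M N)"
    then obtain a b where u: "a \<in> carrier M" "b \<in> carrier N" "u = pr a b" using E by blast
    have "pr (\<ominus>\<^bsub>M\<^esub> a) (\<ominus>\<^bsub>N\<^esub> b) \<oplus>\<^bsub>dsum M N\<^esub> u = \<zero>\<^bsub>dsum M N\<^esub>"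
      using u by (simp add: M.M.l_neg N.M.l_neg)
    moreover have "pr (\<ominus>\<^bsub>M\<^esub> a) (\<ominus>\<^bsub>N\<^esub> b) \<in> carrier (dsum M N)" unfolding I using u by simp
    ultimately show "\<exists>y\<in>carrier (dsum M N). y \<oplus>\<^bsub>dsum M N\<^esub> u = \<zero>\<^bsub>dsum M N\<^esub>" by blast
    show "\<zero>\<^bsub>dsum M N\<^esub> \<oplus>\<^bsub>dsum M N\<^esub> u = u" "\<one>\<^bsub>R\<^esub> \<odot>\<^bsub>dsum M N\<^esub> u = u"
      using u by (simp_all add: M.smult_one N.smult_one)
    fix c assume c: "c \<in> carrier R"
    have "c \<odot>\<^bsub>dsum M N\<^esub> u = pr (c \<odot>\<^bsub>M\<^esub> a) (c \<odot>\<^bsub>N\<^esub> b)" using u by simp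
    then show "c \<odot>\<^bsub>dsum M N\<^esub> u \<in> carrier (dsum M N)"
      using I u c M.smult_closed N.smult_closed by simp
    fix d assume "d \<in> carrier R"
    with c u show "(c \<oplus>\<^bsub>R\<^esub> d) \<odot>\<^bsub>dsum M N\<^esub> u = (c \<odot>\<^bsub>dsum M N\<^esub> u) \<oplus>\<^bsub>dsum M N\<^esub> (d \<odot>\<^bsub>dsum M N\<^esub> u)"
      "(c \<otimes>\<^bsub>R\<^esub> d) \<odot>\<^bsub>dsum M N\<^esub> u = c \<odot>\<^bsub>dsum M N\<^esub> (d \<odot>\<^bsub>dsum M N\<^esub> u)"
      by (simp_all add: M.smult_l_distr N.smult_l_distr M.smult_assoc N.smult_assoc)
  next
    fix u v assume "u \<in> carrier (dsum M N)" "v \<in> carrier (dsum M N)"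
    then obtain a b a' b' where u: "a \<in> carrier M" "b \<in> carrier N" "u = pr a b"
      and v: "a' \<in> carrier M" "b' \<in> carrier N" "v = pr a' b'" using E by meson
    have uv: "u \<oplus>\<^bsub>dsum M N\<^esub> v = pr (a \<oplus>\<^bsub>M\<^esub> a') (b \<oplus>\<^bsub>N\<^esub> b')" using u v by simp
    then show "u \<oplus>\<^bsub>dsum M N\<^esub> v \<in> carrier (dsum M N)" using I u v by simp
    show "u \<oplus>\<^bsub>dsum M N\<^esub> v = v \<oplus>\<^bsub>dsum M N\<^esub> u"
      using u v M.M.a_comm[of a a'] N.M.a_comm[of b b'] by simp
    show "c \<odot>\<^bsub>dsum M N\<^esub> (u \<oplus>\<^bsub>dsum M N\<^esub> v) = (c \<odot>\<^bsub>dsum M N\<^esub> u) \<oplus>\<^bsub>dsum M N\<^esub> (c \<odot>\<^bsub>dsum M N\<^esub> v)"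
      if "c \<in> carrier R" for c
      using u v that by (simp add: M.smult_r_distr N.smult_r_distr)
    fix w assume "w \<in> carrier (dsum M N)"
    then obtain a'' b'' where w: "a'' \<in> carrier M" "b'' \<in> carrier N" "w = pr a'' b''" using E by meson
    show "u \<oplus>\<^bsub>dsum M N\<^esub> v \<oplus>\<^bsub>dsum M N\<^esub> w = u \<oplus>\<^bsub>dsum M N\<^esub> (v \<oplus>\<^bsub>dsum M N\<^esub> w)"
      using u v w by (simp add: M.M.a_assoc N.M.a_assoc)
  qed
qed

lemma
  shows dsum_fst_hom: "fs \<in> left_module_hom R (dsum M N) M"
    and dsum_snd_hom: "sn \<in> left_module_hom R (dsum M N) N"
  by (auto intro!: left_module_homI)

lemma
  assumes "left_module R M" "left_module R N"
  shows dsum_inl_hom: "(\<lambda>x. pr x \<zero>\<^bsub>N\<^esub>) \<in> left_module_hom R M (dsum M N)"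
    and dsum_inr_hom: "(\<lambda>y. pr \<zero>\<^bsub>M\<^esub> y) \<in> left_module_hom R N (dsum M N)"
proof -
  interpret M: left_module R M by fact
  interpret N: left_module R N by fact
  show "(\<lambda>x. pr x \<zero>\<^bsub>N\<^esub>) \<in> left_module_hom R M (dsum M N)"
    "(\<lambda>y. pr \<zero>\<^bsub>M\<^esub> y) \<in> left_module_hom R N (dsum M N)"
    by (rule left_module_homI; auto simp: M.smult_zero N.smult_zero)+
qed

lemma projective_module_dsum:
  assumes "projective_module R M" "projective_module R N"
  shows "projective_module R (dsum M N)"
proof -
  note l = assms[THEN projective_moduleD]
  interpret M: left_module R M by (fact l)
  interpret N: left_module R N by (fact l)
  show ?thesis
    by (rule projective_module_retract[OF left_module_dsum[OF l] assms
          dsum_fst_hom dsum_inl_hom[OF l] dsum_snd_hom dsum_inr_hom[OF l]]) auto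
qed

end

text \<open>A recursive form of having a projective resolution of length \<open>k\<close>, which
  spares inductions the indexed families of modules and maps. It asks for one suitable projective
  surjection; \<open>pd_le_kernel\<close> shows that any other serves as well.\<close>

fun pd_le :: "('a, 'c) ring_scheme \<Rightarrow> nat \<Rightarrow> ('a, 'u) module \<Rightarrow> bool" where
  "pd_le R 0 M \<longleftrightarrow> projective_module R M"
| "pd_le R (Suc k) M \<longleftrightarrow> left_module R M \<and>
     (\<exists>(P :: ('a, 'u) module) f. projective_module R P \<and> f \<in> left_module_hom R P M \<and>
        f ` carrier P = carrier M \<and> pd_le R k (ker_module P M f))"

declare pd_le.simps(2) [simp del]

lemma pd_le_left_module: "pd_le R k M \<Longrightarrow> left_module R M"
  by (cases k) (auto simp: pd_le.simps(2) dest: projective_moduleD)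

lemma pd_le_Suc:
  fixes M :: "('a, 'u) module"
  shows "pd_le R k M \<Longrightarrow> pd_le R (Suc k) M"
proof (induction k arbitrary: M)
  case 0
  then have p: "projective_module R M" by simp
  then interpret M: left_module R M by (rule projective_moduleD)
  \<comment> \<open>The identity of \<open>M\<close> is a projective surjection; its kernel is the
    zero module, a summand of anything projective.\<close>
  have k: "carrier (ker_module M M (\<lambda>x. x)) = {\<zero>\<^bsub>M\<^esub>}" by (auto simp: carrier_ker_module)
  have "projective_module R (ker_module M M (\<lambda>x. x))"
  proof (rule projective_module_retract[OF _ p p])
    let ?Z = "ker_module M M (\<lambda>x. x)"
    show "left_module R ?Z"
      by (rule left_module_ker[OF M.left_module_axioms M.left_module_axioms left_module_hom_id])
    show "(\<lambda>x. x) \<in> left_module_hom R ?Z M" by (rule ker_module_incl)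
    show "(\<lambda>x. x) \<in> left_module_hom R ?Z M" by (rule ker_module_incl)
    show "(\<lambda>x. \<zero>\<^bsub>M\<^esub>) \<in> left_module_hom R M ?Z"
      by (rule left_module_homI) (auto simp: k M.smult_zero)
    show "(\<lambda>x. \<zero>\<^bsub>M\<^esub>) \<in> left_module_hom R M ?Z"
      by (rule left_module_homI) (auto simp: k M.smult_zero)
    show "\<zero>\<^bsub>M\<^esub> \<oplus>\<^bsub>?Z\<^esub> \<zero>\<^bsub>M\<^esub> = x" if "x \<in> carrier ?Z" for x using that k by simp
  qed
  then show ?case unfolding pd_le.simps using p M.left_module_axioms left_module_hom_id[of R M]
    by (intro conjI exI[of _ M] exI[of _ "\<lambda>x. x"]) simp_all
next
  case (Suc k)
  then obtain P :: "('a, 'u) module" and f where "left_module R M" "projective_module R P" "f \<in> left_module_hom R P M"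
    "f ` carrier P = carrier M" "pd_le R (Suc k) (ker_module P M f)"
    unfolding pd_le.simps(2)[of R k M] using Suc.IH by blast
  then show ?case unfolding pd_le.simps(2)[of R "Suc k" M] by blast
qed

lemma pd_le_mono:
  assumes "pd_le R k M" "k \<le> l" shows "pd_le R l M"
  using assms(2)
proof (induction rule: dec_induct)
  case base
  show ?case by (fact assms)
next
  case (step m)
  from step.IH show ?case by (rule pd_le_Suc)
qed

lemma pd_le_iso:
  fixes M N :: "('a, 'u) module"
  assumes "pd_le R k M" "f \<in> left_module_hom R M N" "bij_betw f (carrier M) (carrier N)" "left_module R N"
  shows "pd_le R k N"
proof (cases k)
  case 0
  let ?g = "inv_into (carrier M) f"
  have M: "projective_module R M" using assms(1) unfolding 0 pd_le.simps .
  have g: "?g \<in> left_module_hom R N M"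
    by (rule left_module_hom_inv[OF assms(2,3) projective_moduleD[OF M]])
  interpret N: left_module R N by fact
  interpret M: left_module R M using M by (rule projective_moduleD)
  have "projective_module R N"
  proof (rule projective_module_retract[OF assms(4) M M g assms(2)])
    show "(\<lambda>x. \<zero>\<^bsub>M\<^esub>) \<in> left_module_hom R N M" "(\<lambda>x. \<zero>\<^bsub>N\<^esub>) \<in> left_module_hom R M N"
      by (auto intro!: left_module_homI simp: M.smult_zero N.smult_zero)
    show "f (?g x) \<oplus>\<^bsub>N\<^esub> \<zero>\<^bsub>N\<^esub> = x" if "x \<in> carrier N" for x
      using that assms(3) by (simp add: bij_betw_inv_into_right)
  qed
  then show ?thesis unfolding 0 pd_le.simps .
next
  case (Suc l)
  then obtain P :: "('a, 'u) module" and h where P: "projective_module R P" "h \<in> left_module_hom R P M"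
    "h ` carrier P = carrier M" "pd_le R l (ker_module P M h)" "left_module R M"
    using assms(1) unfolding Suc pd_le.simps by blast
  have "(\<lambda>x. f (h x)) ` carrier P = carrier N"
    using P(3) assms(3) by (simp add: bij_betw_def flip: image_image)
  moreover have "ker_module P N (\<lambda>x. f (h x)) = ker_module P M h"
  proof -
    have "f (h x) = \<zero>\<^bsub>N\<^esub> \<longleftrightarrow> h x = \<zero>\<^bsub>M\<^esub>" if "x \<in> carrier P" for x
    proof -
      interpret M: left_module R M by (fact P)
      have "f \<zero>\<^bsub>M\<^esub> = \<zero>\<^bsub>N\<^esub>" using assms P by (blast intro: left_module_hom_zero)
      moreover have "h x \<in> carrier M" using that P by (blast intro: left_module_hom_closed)
      ultimately show ?thesis using assms(3) M.M.zero_closed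
        by (metis bij_betw_inv_into_left)
    qed
    then have "{x \<in> carrier P. f (h x) = \<zero>\<^bsub>N\<^esub>} = {x \<in> carrier P. h x = \<zero>\<^bsub>M\<^esub>}" by auto
    then show ?thesis by (simp add: ker_module_def a_kernel_def')
  qed
  ultimately show ?thesis
    unfolding Suc pd_le.simps using P(1,4) assms(4) left_module_hom_comp[OF P(2) assms(2)]
    by (intro conjI exI[of _ P] exI[of _ "\<lambda>x. f (h x)"]) simp_all
qed

section \<open>Dimension shifting: summands, kernels, extensions, cokernels\<close>

context pairing
begin

text \<open>\<open>M\<close> is a direct summand of \<open>N\<close> \<oplus> \<open>Q\<close>. The
  projective \<open>Q\<close> makes the claim inductive: the kernel of the surjection constructed
  onto \<open>M\<close> is a summand of the kernel for \<open>N\<close> plus a projective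
  module.\<close>

theorem pd_le_retract:
  fixes M N Q :: "('a, 'v) module"
  assumes "pd_le R k N" "left_module R M" "projective_module R Q"
    and "i1 \<in> left_module_hom R M N" "p1 \<in> left_module_hom R N M"
    and "i2 \<in> left_module_hom R M Q" "p2 \<in> left_module_hom R Q M"
    and "\<And>x. x \<in> carrier M \<Longrightarrow> p1 (i1 x) \<oplus>\<^bsub>M\<^esub> p2 (i2 x) = x"
  shows "pd_le R k M"
  using assms
proof (induction k arbitrary: M N Q i1 p1 i2 p2)
  case 0
  have "projective_module R N" using "0.prems"(1) by simp
  then have "projective_module R M"
    by (rule projective_module_retract[OF "0.prems"(2) _ "0.prems"(3-8)])
  then show ?case by simp
next
  case (Suc k)
  note id = Suc.prems(8)
  obtain P :: "('a, 'v) module" and f where P: "projective_module R P" and f: "f \<in> left_module_hom R P N"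
    and fs: "f ` carrier P = carrier N" and L: "pd_le R k (ker_module P N f)" and N: "left_module R N"
    using Suc.prems(1) unfolding pd_le.simps by blast
  let ?P' = "dsum P Q" and ?L = "ker_module P N f"
  let ?e = "\<lambda>u. p1 (f (fs u)) \<oplus>\<^bsub>M\<^esub> p2 (sn u)"
  have P': "projective_module R ?P'" using P Suc.prems(3) by (rule projective_module_dsum)
  interpret M: left_module R M by (fact Suc.prems(2))
  interpret N: left_module R N by (fact N)
  interpret Q: left_module R Q using Suc.prems(3) by (rule projective_moduleD)
  interpret P: left_module R P using P by (rule projective_moduleD)
  interpret P': left_module R ?P' using P' by (rule projective_moduleD)
  have e: "?e \<in> left_module_hom R ?P' M"
    by (intro left_module_hom_plus left_module_hom_comp[OF dsum_snd_hom Suc.prems(7)]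
        left_module_hom_comp[OF left_module_hom_comp[OF dsum_fst_hom f] Suc.prems(5)]
        P'.left_module_axioms M.left_module_axioms)
  let ?f' = "\<lambda>u. pr (f (fs u)) (sn u)"
  note N' = left_module_dsum[OF N Q.left_module_axioms]
  have f': "?f' \<in> left_module_hom R ?P' (dsum N Q)"
  proof (rule left_module_homI)
    fix u assume "u \<in> carrier ?P'"
    then obtain a b where u: "u = pr a b" "a \<in> carrier P" "b \<in> carrier Q" by auto
    then show "?f' u \<in> carrier (dsum N Q)"
      unfolding pr_in_dsum using left_module_hom_closed[OF f] by simp
    show "?f' (c \<odot>\<^bsub>?P'\<^esub> u) = c \<odot>\<^bsub>dsum N Q\<^esub> ?f' u" if "c \<in> carrier R" for c
      using u that by (simp add: left_module_hom_smult[OF f])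
    fix v assume "v \<in> carrier ?P'"
    then obtain a' b' where "v = pr a' b'" "a' \<in> carrier P" "b' \<in> carrier Q" by auto
    with u show "?f' (u \<oplus>\<^bsub>?P'\<^esub> v) = ?f' u \<oplus>\<^bsub>dsum N Q\<^esub> ?f' v"
      by (simp add: left_module_hom_add[OF f])
  qed
  have f's: "?f' ` carrier ?P' = carrier (dsum N Q)"
    unfolding dsum_simps fs[symmetric] by (force simp: image_iff)
  let ?i = "\<lambda>x. pr (i1 x) (i2 x)"
  have i: "?i \<in> left_module_hom R M (dsum N Q)"
    using Suc.prems(4,6) by (intro left_module_homI)
      (simp_all del: dsum_simps(1) add: pr_in_dsum left_module_hom_add left_module_hom_smult left_module_hom_closed)
  \<comment> \<open>\<open>a\<close> lifts the idempotent of \<open>N\<close> \<oplus>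
    \<open>Q\<close> with image \<open>M\<close>. It preserves the value of \<open>?e\<close> and
    sends the kernel of \<open>?e\<close> into \<open>?L\<close>. Writing u as the sum of
    \<open>a u\<close> and u - \<open>a u\<close> then exhibits that kernel as a summand of
    \<open>?L\<close> \<oplus> \<open>?P'\<close>.\<close>
  obtain a where a: "a \<in> left_module_hom R ?P' ?P'" "\<And>u. u \<in> carrier ?P' \<Longrightarrow> ?f' (a u) = ?i (?e u)"
    using projective_module_lift[OF P' P'.left_module_axioms N' f' f's left_module_hom_comp[OF e i]]
    by blast
  let ?K = "ker_module ?P' M ?e"
  have K: "left_module R ?K" by (rule left_module_ker[OF P'.left_module_axioms M.left_module_axioms e])
  have ea: "?e (a u) = ?e u" if u: "u \<in> carrier ?P'" for u
  proof -
    have au: "?f' (a u) = ?i (?e u)" by (rule a(2)[OF u])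
    then have "f (fs (a u)) = i1 (?e u)" "sn (a u) = i2 (?e u)"
      by (metis fs_pr, metis sn_pr)
    then have "?e (a u) = p1 (i1 (?e u)) \<oplus>\<^bsub>M\<^esub> p2 (i2 (?e u))" by simp
    also have "\<dots> = ?e u" using left_module_hom_closed[OF e u] by (rule id)
    finally show ?thesis .
  qed
  have es: "?e ` carrier ?P' = carrier M"
  proof (intro equalityI subsetI)
    fix x assume x: "x \<in> carrier M"
    then have "i1 x \<in> f ` carrier P" "i2 x \<in> carrier Q"
      using Suc.prems(4,6) unfolding fs by (auto intro: left_module_hom_closed)
    then obtain z where z: "z \<in> carrier P" "f z = i1 x" by (metis imageE)
    show "x \<in> ?e ` carrier ?P'"
      using z \<open>i2 x \<in> carrier Q\<close> id[OF x] by (intro image_eqI[of _ _ "pr z (i2 x)"]) auto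
  qed (use left_module_hom_closed[OF e] in blast)
  let ?b = "\<lambda>u. u \<ominus>\<^bsub>?P'\<^esub> a u"
  have b: "?b \<in> left_module_hom R ?P' ?K"
  proof (rule left_module_hom_into_ker)
    show "?b \<in> left_module_hom R ?P' ?P'"
      by (intro left_module_hom_minus_fun left_module_hom_id a P'.left_module_axioms)
    show "?e (?b u) = \<zero>\<^bsub>M\<^esub>" if u: "u \<in> carrier ?P'" for u
    proof -
      have "?e (?b u) = ?e u \<ominus>\<^bsub>M\<^esub> ?e (a u)"
        using left_module_hom_diff[OF e P'.left_module_axioms M.left_module_axioms u
            left_module_hom_closed[OF a(1) u]] .
      then show ?thesis using ea[OF u] left_module_hom_closed[OF e u]
        by (simp add: a_minus_def M.M.r_neg)
    qed
  qed
  have aK: "fs (a u) \<in> carrier ?L \<and> a u = pr (fs (a u)) \<zero>\<^bsub>Q\<^esub>" if u: "u \<in> carrier ?K" for u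
  proof -
    have u': "u \<in> carrier ?P'" "?e u = \<zero>\<^bsub>M\<^esub>" using u unfolding carrier_ker_module by auto
    have "?f' (a u) = ?i \<zero>\<^bsub>M\<^esub>" using a(2)[OF u'(1)] u'(2) by simp
    moreover have "i1 \<zero>\<^bsub>M\<^esub> = \<zero>\<^bsub>N\<^esub>" "i2 \<zero>\<^bsub>M\<^esub> = \<zero>\<^bsub>Q\<^esub>"
      using left_module_hom_zero[OF Suc.prems(4) M.left_module_axioms N]
        left_module_hom_zero[OF Suc.prems(6) M.left_module_axioms Q.left_module_axioms] by auto
    ultimately have 1: "f (fs (a u)) = \<zero>\<^bsub>N\<^esub>" "sn (a u) = \<zero>\<^bsub>Q\<^esub>" by (metis fs_pr, metis sn_pr)
    have "a u \<in> carrier ?P'" using a(1) u'(1) by (rule left_module_hom_closed)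
    then obtain y z where "a u = pr y z" "y \<in> carrier P" "z \<in> carrier Q" by auto
    then show ?thesis using 1 by (auto simp: carrier_ker_module)
  qed
  have "pd_le R k ?K"
  proof (rule Suc.IH[OF L K P'])
    show "(\<lambda>u. fs (a u)) \<in> left_module_hom R ?K ?L"
    proof (rule left_module_hom_into_ker)
      show "(\<lambda>u. fs (a u)) \<in> left_module_hom R ?K P"
        by (rule left_module_hom_comp[OF left_module_hom_comp[OF ker_module_incl a(1)] dsum_fst_hom])
      show "f (fs (a u)) = \<zero>\<^bsub>N\<^esub>" if "u \<in> carrier ?K" for u
        using aK[OF that] by (simp add: carrier_ker_module)
    qed
    show "(\<lambda>x. pr x \<zero>\<^bsub>Q\<^esub>) \<in> left_module_hom R ?L ?K"
    proof (rule left_module_hom_into_ker)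
      show "(\<lambda>x. pr x \<zero>\<^bsub>Q\<^esub>) \<in> left_module_hom R ?L ?P'"
        by (rule left_module_hom_comp[OF ker_module_incl
              dsum_inl_hom[OF P.left_module_axioms Q.left_module_axioms]])
      show "?e (pr x \<zero>\<^bsub>Q\<^esub>) = \<zero>\<^bsub>M\<^esub>" if "x \<in> carrier ?L" for x
        using that left_module_hom_zero[OF Suc.prems(5) N M.left_module_axioms]
          left_module_hom_zero[OF Suc.prems(7) Q.left_module_axioms M.left_module_axioms]
        by (simp add: carrier_ker_module)
    qed
    show "(\<lambda>u. u) \<in> left_module_hom R ?K ?P'" by (rule ker_module_incl)
    show "?b \<in> left_module_hom R ?P' ?K" by (rule b)
    show "pr (fs (a u)) \<zero>\<^bsub>Q\<^esub> \<oplus>\<^bsub>?K\<^esub> ?b u = u" if u: "u \<in> carrier ?K" for u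
    proof -
      have u': "u \<in> carrier ?P'" using u unfolding carrier_ker_module by auto
      have au: "a u \<in> carrier ?P'" using a(1) u' by (rule left_module_hom_closed)
      have "a u \<oplus>\<^bsub>?P'\<^esub> (u \<ominus>\<^bsub>?P'\<^esub> a u) = u"
        unfolding a_minus_def P'.M.a_lcomm[OF au u' P'.M.a_inv_closed[OF au]] P'.M.r_neg[OF au]
        by (rule P'.M.r_zero[OF u'])
      then show ?thesis using aK[OF u] by (metis ker_module_simps(2))
    qed
  qed
  then show ?case unfolding pd_le.simps using P' e es M.left_module_axioms by blast
qed

text \<open>In place of Schanuel's lemma. Lifting the two surjections against each other gives
  \<open>a\<close> and \<open>b\<close>; writing x as the sum of \<open>b (a x)\<close> and the rest
  makes the kernel a summand of the known kernel plus \<open>Q\<close>.\<close>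

theorem pd_le_kernel:
  fixes M Q :: "('a, 'v) module"
  assumes "pd_le R (Suc k) M" and Q: "projective_module R Q"
    and g: "g \<in> left_module_hom R Q M" "g ` carrier Q = carrier M"
  shows "pd_le R k (ker_module Q M g)"
proof -
  obtain P :: "('a, 'v) module" and f where P: "projective_module R P" and f: "f \<in> left_module_hom R P M" "f ` carrier P = carrier M"
    and L: "pd_le R k (ker_module P M f)" and M: "left_module R M"
    using assms(1) unfolding pd_le.simps by blast
  interpret M: left_module R M by (fact M)
  interpret Q: left_module R Q using Q by (rule projective_moduleD)
  interpret P: left_module R P using P by (rule projective_moduleD)
  note lm = M.left_module_axioms Q.left_module_axioms P.left_module_axioms
  obtain a where a: "a \<in> left_module_hom R Q P" "\<And>x. x \<in> carrier Q \<Longrightarrow> f (a x) = g x"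
    using projective_module_lift[OF Q lm(3,1) f g(1)] by blast
  obtain b where b: "b \<in> left_module_hom R P Q" "\<And>x. x \<in> carrier P \<Longrightarrow> g (b x) = f x"
    using projective_module_lift[OF P lm(2,1) g f(1)] by blast
  let ?K = "ker_module Q M g" and ?L = "ker_module P M f"
  let ?c = "\<lambda>x. x \<ominus>\<^bsub>Q\<^esub> b (a x)"
  note ba = left_module_hom_comp[OF a(1) b(1)]
  have c: "?c \<in> left_module_hom R Q ?K"
  proof (rule left_module_hom_into_ker)
    show "?c \<in> left_module_hom R Q Q"
      by (intro left_module_hom_minus_fun left_module_hom_id ba lm)
    show "g (?c x) = \<zero>\<^bsub>M\<^esub>" if x: "x \<in> carrier Q" for x
      using left_module_hom_diff[OF g(1) lm(2,1) x left_module_hom_closed[OF ba x]]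
        left_module_hom_closed[OF a(1) x] a(2)[OF x] b(2) left_module_hom_closed[OF g(1) x]
      by (simp add: a_minus_def M.M.r_neg)
  qed
  show ?thesis
  proof (rule pd_le_retract[OF L left_module_ker[OF lm(2,1) g(1)] Q _ _ ker_module_incl c])
    show "a \<in> left_module_hom R ?K ?L"
      using a by (intro left_module_hom_into_ker left_module_hom_comp[OF ker_module_incl])
        (auto simp: carrier_ker_module)
    show "b \<in> left_module_hom R ?L ?K"
      using b by (intro left_module_hom_into_ker left_module_hom_comp[OF ker_module_incl])
        (auto simp: carrier_ker_module)
    show "b (a x) \<oplus>\<^bsub>?K\<^esub> ?c x = x" if "x \<in> carrier ?K" for x
    proof -
      have x: "x \<in> carrier Q" using that by (simp add: carrier_ker_module)
      have y: "b (a x) \<in> carrier Q" by (rule left_module_hom_closed[OF ba x])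
      show ?thesis using M.R.ring_axioms x y Q.M.a_lcomm[OF y x Q.M.a_inv_closed[OF y]]
        by (simp add: a_minus_def Q.M.r_neg)
    qed
  qed
qed

corollary pd_le_summand:
  fixes M N :: "('a, 'v) module"
  assumes "pd_le R k N" "left_module R M"
    and i: "i \<in> left_module_hom R M N" and p: "p \<in> left_module_hom R N M"
    and id: "\<And>x. x \<in> carrier M \<Longrightarrow> p (i x) = x"
  shows "pd_le R k M"
proof -
  interpret M: left_module R M by fact
  \<comment> \<open>The zero module serves as the projective summand in
    \<open>pd_le_retract\<close>.\<close>
  let ?Z = "M\<lparr>carrier := {\<zero>\<^bsub>M\<^esub>}\<rparr>"
  have Z: "left_module R ?Z"
    by (rule left_module_restrict[OF assms(2)]) (auto simp: M.smult_zero)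
  have PZ: "projective_module R ?Z"
  proof (rule projective_moduleI[OF Z])
    fix V Y :: "('a, 'v) module" and g f
    assume h: "left_module R V" "left_module R Y" "g \<in> left_module_hom R V Y" "f \<in> left_module_hom R ?Z Y"
    interpret V: left_module R V by (fact h)
    have "(\<lambda>_. \<zero>\<^bsub>V\<^esub>) \<in> left_module_hom R ?Z V"
      by (rule left_module_homI) (auto simp: V.smult_zero)
    then show "\<exists>h\<in>left_module_hom R ?Z V. \<forall>x\<in>carrier ?Z. g (h x) = f x"
      using left_module_hom_zero[OF h(3,1,2)] left_module_hom_zero[OF h(4) Z h(2)] by force
  qed
  show ?thesis
  proof (rule pd_le_retract[OF assms(1,2) PZ i p])
    show "(\<lambda>x. \<zero>\<^bsub>M\<^esub>) \<in> left_module_hom R M ?Z" "(\<lambda>x. \<zero>\<^bsub>M\<^esub>) \<in> left_module_hom R ?Z M"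
      by (auto intro!: left_module_homI simp: M.smult_zero)
    show "p (i x) \<oplus>\<^bsub>M\<^esub> \<zero>\<^bsub>M\<^esub> = x" if "x \<in> carrier M" for x using that id by simp
  qed
qed

text \<open>The horseshoe lemma: projective surjections onto the ends combine, via a lift of
  \<open>q\<close> to \<open>B\<close>, to one onto the middle, and the kernels again form a short
  exact sequence.\<close>

lemma pd_le_extension:
  fixes A B C :: "('a, 'v) module"
  assumes "pd_le R k A" "pd_le R k C" "left_module R B"
    and "i \<in> left_module_hom R A B" "inj_on i (carrier A)"
    and "g \<in> left_module_hom R B C" "g ` carrier B = carrier C"
    and "i ` carrier A = {x \<in> carrier B. g x = \<zero>\<^bsub>C\<^esub>}"
  shows "pd_le R k B"
  using assms
proof (induction k arbitrary: A B C i g)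
  case 0
  note i = "0.prems"(4,5) and g = "0.prems"(6,7) and ex = "0.prems"(8)
  have A: "projective_module R A" and C: "projective_module R C" using "0.prems"(1,2) by auto
  interpret A: left_module R A using A by (rule projective_moduleD)
  interpret C: left_module R C using C by (rule projective_moduleD)
  interpret B: left_module R B by (fact "0.prems"(3))
  note lm = A.left_module_axioms B.left_module_axioms C.left_module_axioms
  obtain s where s: "s \<in> left_module_hom R C B" "\<And>x. x \<in> carrier C \<Longrightarrow> g (s x) = x"
    using projective_module_lift[OF C lm(2,3) g left_module_hom_id] by blast
  let ?K = "ker_module B C g"
  let ?c = "\<lambda>x. x \<ominus>\<^bsub>B\<^esub> s (g x)"
  note sg = left_module_hom_comp[OF g(1) s(1)]
  have c: "?c \<in> left_module_hom R B ?K"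
  proof (rule left_module_hom_into_ker)
    show "?c \<in> left_module_hom R B B"
      by (intro left_module_hom_minus_fun left_module_hom_id sg lm)
    show "g (?c x) = \<zero>\<^bsub>C\<^esub>" if x: "x \<in> carrier B" for x
      using left_module_hom_diff[OF g(1) lm(2,3) x left_module_hom_closed[OF sg x]]
        left_module_hom_closed[OF g(1) x] s(2)
      by (simp add: a_minus_def C.M.r_neg)
  qed
  have iK: "i \<in> left_module_hom R A ?K"
    using i ex by (intro left_module_hom_into_ker) auto
  have bij: "bij_betw i (carrier A) (carrier ?K)"
    using i ex by (simp add: bij_betw_def carrier_ker_module)
  note j = left_module_hom_inv[OF iK bij lm(1)]
  have "projective_module R B"
  proof (rule projective_module_retract[OF lm(2) A C left_module_hom_comp[OF c j] i(1) g(1) s(1)])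
    fix x assume x: "x \<in> carrier B"
    note y = left_module_hom_closed[OF sg x]
    have "i (inv_into (carrier A) i (?c x)) = ?c x"
      using bij left_module_hom_closed[OF c x] by (metis bij_betw_inv_into_right)
    moreover have "?c x \<oplus>\<^bsub>B\<^esub> s (g x) = x"
      using x y by (simp add: a_minus_def B.M.a_assoc B.M.l_neg)
    ultimately show "i (inv_into (carrier A) i (?c x)) \<oplus>\<^bsub>B\<^esub> s (g x) = x" by simp
  qed
  then show ?case by simp
next
  case (Suc k)
  note i = Suc.prems(4,5) and g = Suc.prems(6,7) and ex = Suc.prems(8)
  obtain P :: "('a, 'v) module" and p where P: "projective_module R P" and p: "p \<in> left_module_hom R P A" "p ` carrier P = carrier A"
    and KP: "pd_le R k (ker_module P A p)" and A: "left_module R A"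
    using Suc.prems(1) unfolding pd_le.simps by blast
  obtain Q :: "('a, 'v) module" and q where Q: "projective_module R Q" and q: "q \<in> left_module_hom R Q C" "q ` carrier Q = carrier C"
    and KQ: "pd_le R k (ker_module Q C q)" and C: "left_module R C"
    using Suc.prems(2) unfolding pd_le.simps by blast
  interpret A: left_module R A by (fact A)
  interpret C: left_module R C by (fact C)
  interpret B: left_module R B by (fact Suc.prems(3))
  interpret P: left_module R P using P by (rule projective_moduleD)
  interpret Q: left_module R Q using Q by (rule projective_moduleD)
  note lm = A.left_module_axioms B.left_module_axioms C.left_module_axioms
    P.left_module_axioms Q.left_module_axioms
  obtain h where h: "h \<in> left_module_hom R Q B" "\<And>x. x \<in> carrier Q \<Longrightarrow> g (h x) = q x"
    using projective_module_lift[OF Q lm(2,3) g q(1)] by blast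
  let ?P = "dsum P Q"
  have PP: "projective_module R ?P" using P Q by (rule projective_module_dsum)
  interpret PP: left_module R ?P using PP by (rule projective_moduleD)
  let ?e = "\<lambda>u. i (p (fs u)) \<oplus>\<^bsub>B\<^esub> h (sn u)"
  have e: "?e \<in> left_module_hom R ?P B"
    by (intro left_module_hom_plus left_module_hom_comp[OF dsum_snd_hom h(1)]
        left_module_hom_comp[OF left_module_hom_comp[OF dsum_fst_hom p(1)] i(1)]
        PP.left_module_axioms lm)
  have gi: "g (i x) = \<zero>\<^bsub>C\<^esub>" if "x \<in> carrier A" for x using ex that by auto
  have ge: "g (?e u) = q (sn u)" if u: "u \<in> carrier ?P" for u
  proof -
    have "fs u \<in> carrier P" "sn u \<in> carrier Q" using u by auto
    then show ?thesis
      using left_module_hom_closed[OF p(1)] left_module_hom_closed[OF i(1)] left_module_hom_closed[OF h(1)]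
        left_module_hom_closed[OF q(1)]
      by (simp add: left_module_hom_add[OF g(1)] gi h)
  qed
  have es: "?e ` carrier ?P = carrier B"
  proof (intro equalityI subsetI)
    fix x assume x: "x \<in> carrier B"
    then have gx: "g x \<in> carrier C" by (rule left_module_hom_closed[OF g(1)])
    then obtain z where z: "z \<in> carrier Q" "q z = g x" using q(2) by (metis imageE)
    note hz = left_module_hom_closed[OF h(1) z(1)]
    have "g (x \<ominus>\<^bsub>B\<^esub> h z) = \<zero>\<^bsub>C\<^esub>"
      using left_module_hom_diff[OF g(1) lm(2,3) x hz] h(2)[OF z(1)] z gx
      by (simp add: a_minus_def C.M.r_neg)
    then have "x \<ominus>\<^bsub>B\<^esub> h z \<in> i ` carrier A" unfolding ex using x hz by simp
    then obtain w where w: "w \<in> carrier P" "i (p w) = x \<ominus>\<^bsub>B\<^esub> h z" using p(2) by (metis imageE)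
    have "?e (pr w z) = x" using w x hz by (simp add: a_minus_def B.M.a_assoc B.M.l_neg)
    then show "x \<in> ?e ` carrier ?P" using w z by (intro image_eqI[of _ _ "pr w z"]) auto
  qed (use left_module_hom_closed[OF e] in blast)
  let ?K = "ker_module ?P B ?e" and ?KP = "ker_module P A p" and ?KQ = "ker_module Q C q"
  have K: "left_module R ?K" by (rule left_module_ker[OF PP.left_module_axioms lm(2) e])
  have h0: "h \<zero>\<^bsub>Q\<^esub> = \<zero>\<^bsub>B\<^esub>" and i0: "i \<zero>\<^bsub>A\<^esub> = \<zero>\<^bsub>B\<^esub>"
    using left_module_hom_zero h(1) i(1) lm by blast+
  have i00: "x = \<zero>\<^bsub>A\<^esub>" if "x \<in> carrier A" "i x = \<zero>\<^bsub>B\<^esub>" for x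
    using i(2) that i0 by (metis A.M.zero_closed inj_onD)
  have "pd_le R k ?K"
  proof (rule Suc.IH[OF KP KQ K])
    let ?j = "\<lambda>x. pr x \<zero>\<^bsub>Q\<^esub>"
    show "?j \<in> left_module_hom R ?KP ?K"
    proof (rule left_module_hom_into_ker)
      show "?j \<in> left_module_hom R ?KP ?P"
        by (rule left_module_hom_comp[OF ker_module_incl dsum_inl_hom[OF lm(4,5)]])
      show "?e (pr x \<zero>\<^bsub>Q\<^esub>) = \<zero>\<^bsub>B\<^esub>" if "x \<in> carrier ?KP" for x
        using that h0 i0 by (simp add: carrier_ker_module)
    qed
    show "inj_on ?j (carrier ?KP)" by (rule inj_onI) (metis fs_pr)
    show sn: "sn \<in> left_module_hom R ?K ?KQ"
    proof (rule left_module_hom_into_ker)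
      show "sn \<in> left_module_hom R ?K Q"
        by (rule left_module_hom_comp[OF ker_module_incl dsum_snd_hom])
      show "q (sn u) = \<zero>\<^bsub>C\<^esub>" if u: "u \<in> carrier ?K" for u
        using u ge[of u] left_module_hom_zero[OF g(1) lm(2,3)] by (simp add: carrier_ker_module)
    qed
    show "sn ` carrier ?K = carrier ?KQ"
    proof (intro equalityI subsetI)
      fix z assume "z \<in> carrier ?KQ"
      then have z: "z \<in> carrier Q" "q z = \<zero>\<^bsub>C\<^esub>" by (auto simp: carrier_ker_module)
      note hz = left_module_hom_closed[OF h(1) z(1)]
      have "g (\<ominus>\<^bsub>B\<^esub> h z) = \<zero>\<^bsub>C\<^esub>"
        using left_module_hom_minus[OF g(1) lm(2,3) hz] h(2)[OF z(1)] z(2) by simp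
      then have "\<ominus>\<^bsub>B\<^esub> h z \<in> i ` carrier A" unfolding ex using hz by simp
      then obtain w where w: "w \<in> carrier P" "i (p w) = \<ominus>\<^bsub>B\<^esub> h z" using p(2) by (metis imageE)
      then have "pr w z \<in> carrier ?K"
        using z hz by (simp add: carrier_ker_module pr_in_dsum B.M.l_neg del: dsum_simps(1))
      then show "z \<in> sn ` carrier ?K" by (intro image_eqI[of _ _ "pr w z"]) auto
    qed (use left_module_hom_closed[OF sn] in blast)
    show "?j ` carrier ?KP = {x \<in> carrier ?K. sn x = \<zero>\<^bsub>?KQ\<^esub>}"
    proof (intro equalityI subsetI)
      fix u assume "u \<in> ?j ` carrier ?KP"
      then show "u \<in> {x \<in> carrier ?K. sn x = \<zero>\<^bsub>?KQ\<^esub>}"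
        using h0 i0 by (auto simp: carrier_ker_module)
    next
      fix u assume "u \<in> {x \<in> carrier ?K. sn x = \<zero>\<^bsub>?KQ\<^esub>}"
      then obtain w where w: "u = pr w \<zero>\<^bsub>Q\<^esub>" "w \<in> carrier P" "i (p w) \<oplus>\<^bsub>B\<^esub> \<zero>\<^bsub>B\<^esub> = \<zero>\<^bsub>B\<^esub>"
        using h0 by (auto simp: carrier_ker_module)
      then have "p w = \<zero>\<^bsub>A\<^esub>"
        using left_module_hom_closed[OF p(1) w(2)] left_module_hom_closed[OF i(1)] by (intro i00) auto
      then show "u \<in> ?j ` carrier ?KP" using w by (auto simp: carrier_ker_module)
    qed
  qed
  then show ?case unfolding pd_le.simps using PP e es lm by blast
qed

text \<open>Compose a projective surjection onto \<open>B\<close> with \<open>g\<close>. The kernel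
  of the composite is an extension of the kernel of \<open>g\<close>, a copy of \<open>A\<close>, by
  the kernel of the surjection, and both have dimension at most \<open>k\<close>.\<close>

theorem pd_le_cokernel:
  fixes A B C :: "('a, 'v) module"
  assumes "pd_le R k A" "pd_le R k B" "left_module R C"
    and i: "i \<in> left_module_hom R A B" "inj_on i (carrier A)"
    and g: "g \<in> left_module_hom R B C" "g ` carrier B = carrier C"
    and ex: "i ` carrier A = {x \<in> carrier B. g x = \<zero>\<^bsub>C\<^esub>}"
  shows "pd_le R (Suc k) C"
proof -
  have A: "left_module R A" and B: "left_module R B"
    using assms pd_le_left_module by blast+
  interpret A: left_module R A by fact
  interpret B: left_module R B by fact
  interpret C: left_module R C by fact
  show ?thesis
  proof (cases k)
    case 0
    have iK: "i \<in> left_module_hom R A (ker_module B C g)"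
      using i ex by (intro left_module_hom_into_ker) auto
    have "bij_betw i (carrier A) (carrier (ker_module B C g))"
      using i ex by (simp add: bij_betw_def carrier_ker_module)
    then have "pd_le R 0 (ker_module B C g)"
      using pd_le_iso[OF _ iK] assms(1) 0 left_module_ker[OF B assms(3) g(1)] by blast
    then show ?thesis using 0 assms(2,3) g unfolding pd_le.simps(2) by auto
  next
    case (Suc l)
    then obtain P :: "('a, 'v) module" and p where P: "projective_module R P" and p: "p \<in> left_module_hom R P B" "p ` carrier P = carrier B"
      and L: "pd_le R l (ker_module P B p)"
      using assms(2) unfolding Suc pd_le.simps by blast
    interpret P: left_module R P using P by (rule projective_moduleD)
    note gp = left_module_hom_comp[OF p(1) g(1)]
    let ?L = "ker_module P B p" and ?L' = "ker_module P C (\<lambda>x. g (p x))"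
    have L': "left_module R ?L'" by (rule left_module_ker[OF P.left_module_axioms assms(3) gp])
    have gps: "(\<lambda>x. g (p x)) ` carrier P = carrier C" using p(2) g(2) by (simp flip: image_image)
    let ?K = "ker_module B C g"
    have iK: "i \<in> left_module_hom R A ?K"
      using i ex by (intro left_module_hom_into_ker) auto
    have "bij_betw i (carrier A) (carrier ?K)"
      using i ex by (simp add: bij_betw_def carrier_ker_module)
    then have K: "pd_le R k ?K"
      using pd_le_iso[OF assms(1) iK] left_module_ker[OF B assms(3) g(1)] by blast
    have g0: "g \<zero>\<^bsub>B\<^esub> = \<zero>\<^bsub>C\<^esub>" by (rule left_module_hom_zero[OF g(1) B assms(3)])
    have "pd_le R k ?L"
      using L pd_le_mono[of R l ?L k] Suc by simp
    then have "pd_le R k ?L'"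
    proof (rule pd_le_extension[OF _ K L'])
      show "(\<lambda>x. x) \<in> left_module_hom R ?L ?L'"
        by (intro left_module_hom_into_ker ker_module_incl) (simp add: carrier_ker_module g0)
      show "p \<in> left_module_hom R ?L' ?K"
        by (intro left_module_hom_into_ker left_module_hom_comp[OF ker_module_incl p(1)])
          (simp add: carrier_ker_module)
      show "p ` carrier ?L' = carrier ?K"
        unfolding carrier_ker_module p(2)[symmetric] by auto
      show "(\<lambda>x. x) ` carrier ?L = {x \<in> carrier ?L'. p x = \<zero>\<^bsub>?K\<^esub>}"
        by (auto simp: carrier_ker_module g0)
    qed auto
    then show ?thesis unfolding pd_le.simps using P gp gps assms(3) by blast
  qed
qed

end

section \<open>Comparison with projective resolutions\<close>

lemma projective_resolution_imp_pd_le: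
  "projective_resolution R M n P d \<Longrightarrow> left_module R M \<Longrightarrow> pd_le R n M"
proof (induction n arbitrary: M P d)
  case 0
  then have "projective_module R (P 0)" "d 0 \<in> left_module_hom R (P 0) M"
    "bij_betw (d 0) (carrier (P 0)) (carrier M)"
    by (auto simp: projective_resolution_def bij_betw_def)
  then show ?case using pd_le_iso[of R 0 "P 0" "d 0" M] 0 by simp
next
  case (Suc n)
  let ?P = "\<lambda>i. P (Suc i)" and ?d = "\<lambda>i. d (Suc i)" and ?K = "ker_module (P 0) M (d 0)"
  note r = Suc.prems(1)[unfolded projective_resolution_def Let_def]
  have P: "projective_module R (P i)" "d i \<in> left_module_hom R (P i) (case_nat M P i)" if "i \<le> Suc n" for i
    using r that by auto
  have ex: "d (Suc i) ` carrier (P (Suc i)) = a_kernel (P i) (case_nat M P i) (d i)" if "i < Suc n" for i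
    using r that by auto
  have P0: "projective_module R (P 0)" "d 0 \<in> left_module_hom R (P 0) M" using P[of 0] by auto
  have K: "left_module R ?K"
    using P0 Suc.prems(2) by (auto intro: left_module_ker projective_moduleD)
  have d1: "d 1 ` carrier (P 1) = carrier ?K" using ex[of 0] by (simp add: ker_module_def)
  have "projective_resolution R ?K n ?P ?d"
    unfolding projective_resolution_def Let_def
  proof (intro conjI allI impI)
    fix i assume i: "i \<le> n"
    show "projective_module R (P (Suc i))" using P i by simp
    show "d (Suc i) \<in> left_module_hom R (P (Suc i)) (case_nat ?K ?P i)"
    proof (cases i)
      case 0
      have "d 1 \<in> left_module_hom R (P 1) (P 0)" using P(2)[of 1] by simp
      then show ?thesis using 0 d1 by (auto simp: left_module_hom_def)
    qed (use P(2)[of "Suc i"] i in auto)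
  next
    fix i assume i: "i < n"
    \<comment> \<open>Restricting the target of \<open>d 1\<close> to the kernel of
      \<open>d 0\<close> keeps its zero, and hence the kernel of \<open>d 1\<close>.\<close>
    have "a_kernel (P 1) ?K (d 1) = a_kernel (P 1) (P 0) (d 1)" by (simp add: a_kernel_def')
    then show "d (Suc (Suc i)) ` carrier (P (Suc (Suc i))) = a_kernel (P (Suc i)) (case_nat ?K ?P i) (d (Suc i))"
      using ex[of "Suc i"] i by (cases i) auto
  next
    show "d (Suc 0) ` carrier (P (Suc 0)) = carrier ?K" using d1 by simp
  qed (use r in simp)
  then have "pd_le R n ?K" using K by (rule Suc.IH)
  moreover have "d 0 ` carrier (P 0) = carrier M" using r by simp
  ultimately show ?case unfolding pd_le.simps using P0 Suc.prems(2) by blast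
qed

lemma pd_le_imp_projective_resolution:
  fixes M :: "('a, 'v) module"
  shows "pd_le R n M \<Longrightarrow> \<exists>P d. projective_resolution R M n P d"
proof (induction n arbitrary: M)
  case 0
  then show ?case
    by (auto simp: projective_resolution_def left_module_hom_id
        intro!: exI[of _ "\<lambda>_. M"] exI[of _ "\<lambda>_ x. x"])
next
  case (Suc n)
  then obtain Q :: "('a, 'v) module" and f where Q: "projective_module R Q" "f \<in> left_module_hom R Q M"
    "f ` carrier Q = carrier M" "pd_le R n (ker_module Q M f)"
    unfolding pd_le.simps by blast
  let ?K = "ker_module Q M f"
  obtain P d where r: "projective_resolution R ?K n P d" using Suc.IH[OF Q(4)] by blast
  note r = r[unfolded projective_resolution_def Let_def]
  have "projective_resolution R M (Suc n) (case_nat Q P) (case_nat f d)"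
    unfolding projective_resolution_def Let_def
  proof (intro conjI allI impI)
    fix i assume i: "i \<le> Suc n"
    show "projective_module R (case_nat Q P i)" using r Q i by (cases i) auto
    show "case_nat f d i \<in> left_module_hom R (case_nat Q P i) (case_nat M (case_nat Q P) i)"
    proof (cases i)
      case (Suc j)
      show ?thesis
      proof (cases j)
        case 0
        have "d 0 \<in> left_module_hom R (P 0) ?K" using r by auto
        then show ?thesis using Suc 0 left_module_hom_comp[OF _ ker_module_incl] by auto
      qed (use r Suc i in auto)
    qed (use Q in auto)
  next
    fix i assume i: "i < Suc n"
    have "a_kernel (P 0) ?K (d 0) = a_kernel (P 0) Q (d 0)" by (simp add: a_kernel_def')
    then show "case_nat f d (Suc i) ` carrier (case_nat Q P (Suc i)) =
        a_kernel (case_nat Q P i) (case_nat M (case_nat Q P) i) (case_nat f d i)"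
      using r i by (cases i; cases "i - 1") (auto simp: ker_module_def)
  qed (use r Q in auto)
  then show ?case by blast
qed

lemma projective_resolution_iff_pd_le:
  "left_module R M \<Longrightarrow> (\<exists>P d. projective_resolution R M n P d) \<longleftrightarrow> pd_le R n M"
  using projective_resolution_imp_pd_le pd_le_imp_projective_resolution by blast

lemma left_global_dimension_eqI:
  fixes R :: "('a, 'c) ring_scheme" and M :: "('a, ('a, 'u) universe) module"
  assumes "\<And>N :: ('a, ('a, 'u) universe) module. left_module R N \<Longrightarrow> pd_le R n N"
    and "left_module R M" "\<And>m. m < n \<Longrightarrow> \<not> pd_le R m M"
  shows "left_global_dimension TYPE('u) R = enat n"
proof -
  have pd: "projective_dimension R N = Inf {enat m | m. pd_le R m N}" if "left_module R N"
    for N :: "('a, ('a, 'u) universe) module"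
    unfolding projective_dimension_def using projective_resolution_iff_pd_le[OF that] by simp
  show ?thesis unfolding left_global_dimension_def
  proof (rule antisym)
    show "(SUP M\<in>{M :: ('a, ('a, 'u) universe) module. left_module R M}. projective_dimension R M) \<le> enat n"
      using assms(1) by (intro SUP_least) (auto simp: pd intro!: Inf_lower)
    have "enat n \<le> projective_dimension R M"
      unfolding pd[OF assms(2)] using assms(3) by (intro Inf_greatest) (auto simp: not_less[symmetric])
    then show "enat n \<le> (SUP M\<in>{M :: ('a, ('a, 'u) universe) module. left_module R M}. projective_dimension R M)"
      using assms(2) by (intro SUP_upper2[of M]) auto
  qed
qed


section \<open>Modules given by word actions\<close>

abbreviation keys :: "('i \<Rightarrow>\<^sub>0 'q::zero) \<Rightarrow> 'i set" where
  "keys \<equiv> Poly_Mapping.keys"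

abbreviation lookup :: "('i \<Rightarrow>\<^sub>0 'q::zero) \<Rightarrow> 'i \<Rightarrow> 'q" where
  "lookup \<equiv> Poly_Mapping.lookup"

lemma poly_mapping_sum_single:
  fixes p :: "'i \<Rightarrow>\<^sub>0 'q::comm_monoid_add"
  shows "(\<Sum>t\<in>keys p. Poly_Mapping.single t (lookup p t)) = p"
  by (rule poly_mapping_eqI)
    (simp add: lookup_sum lookup_single when_def not_in_keys_iff_lookup_eq_zero sum.delta)

text \<open>The single terms are only those of the given \<open>p\<close>, so knowledge about its
  support and coefficients is available for them.\<close>

lemma poly_mapping_add_induct [case_names zero single add]:
  fixes p :: "'i \<Rightarrow>\<^sub>0 'q::comm_monoid_add"
  assumes "P 0" and s: "\<And>t. t \<in> keys p \<Longrightarrow> P (Poly_Mapping.single t (lookup p t))"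
    and add: "\<And>p q. P p \<Longrightarrow> P q \<Longrightarrow> P (p + q)"
  shows "P p"
proof -
  have "P (\<Sum>t\<in>S. Poly_Mapping.single t (lookup p t))" if "finite S" "S \<subseteq> keys p" for S
    using that by (induction S rule: finite_induct) (auto intro: assms)
  from this[of "keys p"] show ?thesis by (simp add: poly_mapping_sum_single)
qed

text \<open>Coefficients are elements of arbitrary abelian groups here; linearity over the field is
  encoded in the word actions instead.\<close>

definition additive_map :: "('q::ab_group_add \<Rightarrow> 'r::ab_group_add) \<Rightarrow> bool" where
  "additive_map h \<longleftrightarrow> (\<forall>a b. h (a + b) = h a + h b)"

lemma additive_map_add: "additive_map h \<Longrightarrow> h (a + b) = h a + h b"
  by (simp add: additive_map_def)

lemma additive_map_zero: "additive_map h \<Longrightarrow> h 0 = 0"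
  using additive_map_add[of h 0 0] by simp

lemma additive_map_minus: "additive_map h \<Longrightarrow> h (- a) = - h a"
  using additive_map_add[of h a "- a"] additive_map_zero[of h] by (simp add: minus_unique)

lemma additive_map_diff: "additive_map h \<Longrightarrow> h (a - b) = h a - h b"
  using additive_map_add[of h a "- b"] additive_map_minus[of h b] by simp

lemma additive_map_comp: "additive_map f \<Longrightarrow> additive_map g \<Longrightarrow> additive_map (\<lambda>x. f (g x))"
  by (simp add: additive_map_def)

lemma additive_map_id: "additive_map (\<lambda>x. x)" by (simp add: additive_map_def)

text \<open>The additive extension of a family of maps prescribed on single terms, which is how
  actions and maps of induced modules are defined below.\<close>

definition pm_sum :: "('i \<Rightarrow> 'q::ab_group_add \<Rightarrow> 'r::ab_group_add) \<Rightarrow> ('i \<Rightarrow>\<^sub>0 'q) \<Rightarrow> 'r" where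
  "pm_sum h p = (\<Sum>t\<in>keys p. h t (lookup p t))"

lemma pm_sum_additive:
  assumes "\<And>t. additive_map (h t)" shows "additive_map (pm_sum h)"
proof -
  have "pm_sum h (p + q) = pm_sum h p + pm_sum h q" for p q
    unfolding pm_sum_def using assms
    by (intro setsum_keys_plus_distrib) (simp_all add: additive_map_zero additive_map_add)
  then show ?thesis unfolding additive_map_def by blast
qed

lemma pm_sum_single:
  assumes "\<And>t. additive_map (h t)" shows "pm_sum h (Poly_Mapping.single t a) = h t a"
  using additive_map_zero[OF assms] by (simp add: pm_sum_def)

lemma pm_sum_additive_param:
  assumes "\<And>t a. additive_map (\<lambda>x. h x t a)" shows "additive_map (\<lambda>x. pm_sum (h x) p)"
  using assms unfolding additive_map_def pm_sum_def by (simp add: sum.distrib)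

lemma additive_map_eq_on:
  assumes f: "additive_map f" and g: "additive_map g"
    and "\<And>t. t \<in> keys p \<Longrightarrow> f (Poly_Mapping.single t (lookup p t)) = g (Poly_Mapping.single t (lookup p t))"
  shows "f p = g p"
  by (rule poly_mapping_add_induct[where p = p and P = "\<lambda>p. f p = g p"])
    (use assms in \<open>simp_all add: additive_map_zero additive_map_add\<close>)

definition add_closed :: "'q::ab_group_add set \<Rightarrow> bool" where
  "add_closed C \<longleftrightarrow> 0 \<in> C \<and> (\<forall>a\<in>C. \<forall>b\<in>C. a + b \<in> C) \<and> (\<forall>a\<in>C. - a \<in> C)"

lemma add_closed_sum: "add_closed C \<Longrightarrow> (\<And>i. i \<in> I \<Longrightarrow> f i \<in> C) \<Longrightarrow> sum f I \<in> C"
  by (induction I rule: infinite_finite_induct) (auto simp: add_closed_def)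

definition pm_scale :: "'k::field \<Rightarrow> ('i \<Rightarrow>\<^sub>0 'k) \<Rightarrow> ('i \<Rightarrow>\<^sub>0 'k)" where
  "pm_scale c p = Poly_Mapping.map ((*) c) p"

lemma lookup_pm_scale [simp]: "lookup (pm_scale c p) i = c * lookup p i"
  unfolding pm_scale_def by (simp add: map.rep_eq when_def)

lemma pm_scale_vector_space: "vector_space (pm_scale :: 'k::field \<Rightarrow> ('i \<Rightarrow>\<^sub>0 'k) \<Rightarrow> _)"
  by unfold_locales (auto intro!: poly_mapping_eqI simp: lookup_add algebra_simps)

lemma pm_scale_single [simp]: "pm_scale c (Poly_Mapping.single i d) = Poly_Mapping.single i (c * d)"
  by (auto intro!: poly_mapping_eqI simp: lookup_single when_def)

lemma pm_scale_add: "pm_scale c (p + q) = pm_scale c p + pm_scale c q"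
  by (auto intro!: poly_mapping_eqI simp: lookup_add algebra_simps)

lemma keys_pm_scale: "keys (pm_scale c p) \<subseteq> keys p"
  by (auto simp: in_keys_iff)

abbreviation supp_in :: "'i set \<Rightarrow> ('i \<Rightarrow>\<^sub>0 'q::zero) set" where
  "supp_in I \<equiv> {p. keys p \<subseteq> I}"

lemma add_closed_supp_in: "add_closed (supp_in I :: ('i \<Rightarrow>\<^sub>0 'q::ab_group_add) set)"
proof -
  have "keys (- p) = keys p" for p :: "'i \<Rightarrow>\<^sub>0 'q"
    by (auto simp: in_keys_iff)
  then show ?thesis unfolding add_closed_def using keys_add by fastforce
qed

text \<open>\<open>act c w a\<close> stands for the action of \<open>c \<cdot> w\<close> on \<open>a\<close>.\<close>

definition word_action ::
    "letter list set \<Rightarrow> 'q::ab_group_add set \<Rightarrow> ('k::field \<Rightarrow> letter list \<Rightarrow> 'q \<Rightarrow> 'q) \<Rightarrow> bool" where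
  "word_action N C act \<longleftrightarrow> add_closed C \<and>
     (\<forall>c w. additive_map (act c w)) \<and> (\<forall>w a. additive_map (\<lambda>c. act c w a)) \<and>
     (\<forall>c w. \<forall>a\<in>C. act c w a \<in> C) \<and>
     (\<forall>c v d w. \<forall>a\<in>C. act c v (act d w a) = act (c * d) (v @ w) a) \<and>
     (\<forall>a\<in>C. act 1 [] a = a) \<and> (\<forall>c w. \<forall>a\<in>C. w \<notin> N \<longrightarrow> act c w a = 0)"

lemma word_actionD:
  assumes "word_action N C act"
  shows "add_closed C" "additive_map (act c w)" "additive_map (\<lambda>c. act c w a)"
    "a \<in> C \<Longrightarrow> act c w a \<in> C"
    "a \<in> C \<Longrightarrow> act c v (act d w a) = act (c * d) (v @ w) a"
    "a \<in> C \<Longrightarrow> act 1 [] a = a" "a \<in> C \<Longrightarrow> w \<notin> N \<Longrightarrow> act c w a = 0"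
  using assms by (simp_all add: word_action_def)

definition poly_act ::
    "('k::field \<Rightarrow> letter list \<Rightarrow> 'q::ab_group_add \<Rightarrow> 'q) \<Rightarrow> (letter list \<Rightarrow>\<^sub>0 'k) \<Rightarrow> 'q \<Rightarrow> 'q" where
  "poly_act act p a = pm_sum (\<lambda>w c. act c w a) p"

lemma
  assumes "word_action N C act"
  shows poly_act_additive: "additive_map (poly_act act p)"
    and poly_act_additive_left: "additive_map (\<lambda>p. poly_act act p a)"
    and poly_act_single: "poly_act act (Poly_Mapping.single w c) a = act c w a"
    and poly_act_closed: "a \<in> C \<Longrightarrow> poly_act act p a \<in> C"
proof -
  note A = word_actionD[OF assms]
  show "additive_map (\<lambda>p. poly_act act p a)"
    unfolding poly_act_def by (rule pm_sum_additive) (rule A)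
  show "poly_act act (Poly_Mapping.single w c) a = act c w a"
    unfolding poly_act_def by (rule pm_sum_single) (rule A)
  show "additive_map (poly_act act p)"
    unfolding poly_act_def by (rule pm_sum_additive_param) (rule A)
  show "a \<in> C \<Longrightarrow> poly_act act p a \<in> C"
    unfolding poly_act_def pm_sum_def by (intro add_closed_sum A) auto
qed

lemma poly_act_mult:
  assumes "word_action N C act" "a \<in> C"
  shows "poly_act act (p * q) a = poly_act act p (poly_act act q a)"
proof -
  note A = word_actionD[OF assms(1)] and add = poly_act_additive[OF assms(1)]
    and addl = poly_act_additive_left[OF assms(1)] and [simp] = poly_act_single[OF assms(1)]
  show ?thesis
  proof (rule poly_mapping_add_induct[where p = p])
    show "poly_act act (0 * q) a = poly_act act 0 (poly_act act q a)"
      using additive_map_zero[OF addl] by simp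
    show "poly_act act ((p1 + p2) * q) a = poly_act act (p1 + p2) (poly_act act q a)"
      if "poly_act act (p1 * q) a = poly_act act p1 (poly_act act q a)"
        "poly_act act (p2 * q) a = poly_act act p2 (poly_act act q a)" for p1 p2
      using that by (simp add: distrib_right additive_map_add[OF addl])
    show "poly_act act (Poly_Mapping.single v (lookup p v) * q) a =
        poly_act act (Poly_Mapping.single v (lookup p v)) (poly_act act q a)" for v
    proof (rule poly_mapping_add_induct[where p = q])
      show "poly_act act (Poly_Mapping.single v (lookup p v) * 0) a =
        poly_act act (Poly_Mapping.single v (lookup p v)) (poly_act act 0 a)"
        using additive_map_zero[OF addl] additive_map_zero[OF A(2)] by simp
      show "poly_act act (Poly_Mapping.single v (lookup p v) * (q1 + q2)) a =
        poly_act act (Poly_Mapping.single v (lookup p v)) (poly_act act (q1 + q2) a)"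
        if "poly_act act (Poly_Mapping.single v (lookup p v) * q1) a =
            poly_act act (Poly_Mapping.single v (lookup p v)) (poly_act act q1 a)"
          "poly_act act (Poly_Mapping.single v (lookup p v) * q2) a =
            poly_act act (Poly_Mapping.single v (lookup p v)) (poly_act act q2 a)" for q1 q2
        using that by (simp add: distrib_left additive_map_add[OF addl] additive_map_add[OF A(2)])
      show "poly_act act (Poly_Mapping.single v (lookup p v) * Poly_Mapping.single w (lookup q w)) a =
        poly_act act (Poly_Mapping.single v (lookup p v)) (poly_act act (Poly_Mapping.single w (lookup q w)) a)" for w
        by (simp add: mult_single plus_list_def A(5)[OF assms(2)])
    qed
  qed
qed

lemma poly_act_eq_0:
  assumes "word_action N C act" "a \<in> C" "keys p \<inter> N = {}"
  shows "poly_act act p a = 0"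
  unfolding poly_act_def pm_sum_def
proof (rule sum.neutral, intro ballI)
  fix w assume "w \<in> keys p"
  then have "w \<notin> N" using assms(3) by blast
  then show "act (lookup p w) w a = 0" using word_actionD(7)[OF assms(1,2)] by blast
qed

text \<open>The quotient of the free algebra by the span of the words outside \<open>N\<close>,
  described through its quotient map, so that the opposite algebra with reversed words is an
  instance too.\<close>

locale word_algebra = ring A for A :: "('a, 'c) ring_scheme" (structure) +
  fixes \<Phi> :: "(letter list \<Rightarrow>\<^sub>0 'k::field) \<Rightarrow> 'a" and N :: "letter list set"
  assumes Phi_add: "\<Phi> (p + q) = \<Phi> p \<oplus> \<Phi> q"
    and Phi_mult: "\<Phi> (p * q) = \<Phi> p \<otimes> \<Phi> q"
    and Phi_one: "\<Phi> 1 = \<one>"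
    and Phi_range: "range \<Phi> = carrier A"
    and Phi_eq_zero_iff: "\<Phi> p = \<zero> \<longleftrightarrow> keys p \<inter> N = {}"
    and Nil_normal: "[] \<in> N"
    and normal_factor: "v @ w \<in> N \<Longrightarrow> v \<in> N \<and> w \<in> N"
begin

lemma Phi_closed: "\<Phi> p \<in> carrier A"
  using Phi_range by auto

lemma Phi_cases: "x \<in> carrier A \<Longrightarrow> \<exists>p. x = \<Phi> p"
  using Phi_range by auto

lemma one_single: "(1 :: letter list \<Rightarrow>\<^sub>0 'k) = Poly_Mapping.single [] 1"
  by (metis single_one zero_list_def)

lemma Phi_zero: "\<Phi> 0 = \<zero>" by (simp add: Phi_eq_zero_iff)

lemma Phi_eqD: 
  assumes "\<Phi> p = \<Phi> q" shows "keys (p - q) \<inter> N = {}"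
proof -
  have "\<Phi> (p - q) \<oplus> \<Phi> q = \<Phi> p" by (simp flip: Phi_add)
  then have "\<Phi> (p - q) = \<zero>" using assms Phi_closed by (metis add.r_cancel_one')
  then show ?thesis by (simp add: Phi_eq_zero_iff)
qed

text \<open>\<open>j\<close> carries the structure into the fixed type of module elements. A ring
  element acts through an arbitrary preimage under \<open>\<Phi>\<close>; by
  \<open>wmod_smult\<close> the choice does not matter.\<close>

definition wmod :: "('q::ab_group_add \<Rightarrow> 'v) \<Rightarrow> 'q set \<Rightarrow> ('k \<Rightarrow> letter list \<Rightarrow> 'q \<Rightarrow> 'q) \<Rightarrow> ('a, 'v) module" where
  "wmod j C act = \<lparr>carrier = j ` C, monoid.mult = (\<lambda>u v. u), one = j 0, ring.zero = j 0,
     ring.add = (\<lambda>u v. j (inv_into UNIV j u + inv_into UNIV j v)),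
     module.smult = (\<lambda>x u. j (poly_act act (SOME p. \<Phi> p = x) (inv_into UNIV j u)))\<rparr>"

lemma wmod_simps:
  "carrier (wmod j C act) = j ` C" "\<zero>\<^bsub>wmod j C act\<^esub> = j 0"
  by (simp_all add: wmod_def)

lemma wmod_restrict: "(wmod j C act)\<lparr>carrier := j ` C'\<rparr> = wmod j C' act"
  by (simp add: wmod_def)

lemma wmod_add: "inj j \<Longrightarrow> j a \<oplus>\<^bsub>wmod j C act\<^esub> j b = j (a + b)"
  by (simp add: wmod_def)

lemma wmod_smult:
  assumes "inj j" "word_action N C act" "a \<in> C"
  shows "\<Phi> p \<odot>\<^bsub>wmod j C act\<^esub> j a = j (poly_act act p a)"
proof -
  let ?q = "SOME q. \<Phi> q = \<Phi> p"
  have "\<Phi> ?q = \<Phi> p" by (rule someI) simp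
  then have "poly_act act (?q - p) a = 0"
    using Phi_eqD poly_act_eq_0[OF assms(2,3)] by blast
  then have "poly_act act ?q a = poly_act act p a"
    using additive_map_diff[OF poly_act_additive_left[OF assms(2)]] by simp
  then show ?thesis using assms(1) by (simp add: wmod_def)
qed

lemma left_module_wmod:
  assumes j: "inj j" and act: "word_action N C act"
  shows "left_module A (wmod j C act)"
proof (rule left_moduleI)
  note A = word_actionD[OF act]
  note [simp] = wmod_add[OF j] wmod_simps wmod_smult[OF j act]
  have C: "0 \<in> C" "\<And>a b. a \<in> C \<Longrightarrow> b \<in> C \<Longrightarrow> a + b \<in> C" "\<And>a. a \<in> C \<Longrightarrow> - a \<in> C"
    using A(1) by (auto simp: add_closed_def)
  let ?M = "wmod j C act"
  show "ring A" by (rule ring_axioms)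
  show "\<zero>\<^bsub>?M\<^esub> \<in> carrier ?M" using C by simp
  fix u assume "u \<in> carrier ?M"
  then obtain a where a: "u = j a" "a \<in> C" by auto
  show "\<zero>\<^bsub>?M\<^esub> \<oplus>\<^bsub>?M\<^esub> u = u" using a by simp
  show "\<exists>y\<in>carrier ?M. y \<oplus>\<^bsub>?M\<^esub> u = \<zero>\<^bsub>?M\<^esub>"
    using a C by (intro bexI[of _ "j (- a)"]) simp_all
  show "\<one> \<odot>\<^bsub>?M\<^esub> u = u"
    using a A(6) by (simp flip: Phi_one add: one_single poly_act_single[OF act])
  { fix x assume "x \<in> carrier A"
    then obtain p where p: "x = \<Phi> p" using Phi_cases by blast
    show "x \<odot>\<^bsub>?M\<^esub> u \<in> carrier ?M" using p a poly_act_closed[OF act] by simp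
    fix y assume "y \<in> carrier A"
    then obtain q where q: "y = \<Phi> q" using Phi_cases by blast
    show "(x \<oplus> y) \<odot>\<^bsub>?M\<^esub> u = (x \<odot>\<^bsub>?M\<^esub> u) \<oplus>\<^bsub>?M\<^esub> (y \<odot>\<^bsub>?M\<^esub> u)"
      using p q a by (simp flip: Phi_add add: additive_map_add[OF poly_act_additive_left[OF act]])
    show "(x \<otimes> y) \<odot>\<^bsub>?M\<^esub> u = x \<odot>\<^bsub>?M\<^esub> (y \<odot>\<^bsub>?M\<^esub> u)"
      using p q a by (simp flip: Phi_mult add: poly_act_mult[OF act] poly_act_closed[OF act]) }
  fix v assume "v \<in> carrier ?M"
  then obtain b where b: "v = j b" "b \<in> C" by auto
  show "u \<oplus>\<^bsub>?M\<^esub> v \<in> carrier ?M" using a b C by simp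
  show "u \<oplus>\<^bsub>?M\<^esub> v = v \<oplus>\<^bsub>?M\<^esub> u" using a b by (simp add: add.commute)
  show "x \<odot>\<^bsub>?M\<^esub> (u \<oplus>\<^bsub>?M\<^esub> v) = (x \<odot>\<^bsub>?M\<^esub> u) \<oplus>\<^bsub>?M\<^esub> (x \<odot>\<^bsub>?M\<^esub> v)" if "x \<in> carrier A" for x
    using Phi_cases[OF that] a b C by (auto simp: additive_map_add[OF poly_act_additive[OF act]])
  fix w assume "w \<in> carrier ?M"
  then obtain c where "w = j c" "c \<in> C" by auto
  then show "u \<oplus>\<^bsub>?M\<^esub> v \<oplus>\<^bsub>?M\<^esub> w = u \<oplus>\<^bsub>?M\<^esub> (v \<oplus>\<^bsub>?M\<^esub> w)"
    using a b by (simp add: add.assoc)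
qed

text \<open>Single words with a coefficient suffice to check compatibility, because they generate
  the algebra additively.\<close>

lemma wmod_homI:
  fixes M :: "('a, 'u) module"
  assumes j: "inj j" and act: "word_action N C act" and M: "left_module A M"
    and cl: "\<And>a. a \<in> C \<Longrightarrow> h a \<in> carrier M"
    and add: "\<And>a b. a \<in> C \<Longrightarrow> b \<in> C \<Longrightarrow> h (a + b) = h a \<oplus>\<^bsub>M\<^esub> h b"
    and smult: "\<And>c w a. a \<in> C \<Longrightarrow> h (act c w a) = \<Phi> (Poly_Mapping.single w c) \<odot>\<^bsub>M\<^esub> h a"
  shows "(\<lambda>u. h (inv_into UNIV j u)) \<in> left_module_hom A (wmod j C act) M"
proof (rule left_module_homI)
  interpret M: left_module A M by fact
  note A = word_actionD[OF act]
  have C: "0 \<in> C" "\<And>a b. a \<in> C \<Longrightarrow> b \<in> C \<Longrightarrow> a + b \<in> C" using A(1) by (auto simp: add_closed_def)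
  have "h 0 = h 0 \<oplus>\<^bsub>M\<^esub> h 0" using add[OF C(1) C(1)] by simp
  then have h0: "h 0 = \<zero>\<^bsub>M\<^esub>" using cl[OF C(1)] by (metis M.M.add.l_cancel_one')
  fix u assume "u \<in> carrier (wmod j C act)"
  then obtain a where a: "u = j a" "a \<in> C" by (auto simp: wmod_simps)
  show "h (inv_into UNIV j u) \<in> carrier M" using a j cl by simp
  show "h (inv_into UNIV j (x \<odot>\<^bsub>wmod j C act\<^esub> u)) = x \<odot>\<^bsub>M\<^esub> h (inv_into UNIV j u)" if x: "x \<in> carrier A" for x
  proof -
    obtain p where p: "x = \<Phi> p" using Phi_cases[OF x] by blast
    have "poly_act act p a \<in> C \<and> h (poly_act act p a) = \<Phi> p \<odot>\<^bsub>M\<^esub> h a"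
    proof (rule poly_mapping_add_induct[where p = p])
      show "poly_act act 0 a \<in> C \<and> h (poly_act act 0 a) = \<Phi> 0 \<odot>\<^bsub>M\<^esub> h a"
        using C h0 M.zero_smult[OF cl[OF a(2)]]
        by (simp add: additive_map_zero[OF poly_act_additive_left[OF act]] Phi_zero)
      show "poly_act act (Poly_Mapping.single t (lookup p t)) a \<in> C \<and>
          h (poly_act act (Poly_Mapping.single t (lookup p t)) a) = \<Phi> (Poly_Mapping.single t (lookup p t)) \<odot>\<^bsub>M\<^esub> h a"
        for t using a(2) by (simp add: poly_act_single[OF act] smult A(4))
    next
      fix p q
      assume "poly_act act p a \<in> C \<and> h (poly_act act p a) = \<Phi> p \<odot>\<^bsub>M\<^esub> h a"
        "poly_act act q a \<in> C \<and> h (poly_act act q a) = \<Phi> q \<odot>\<^bsub>M\<^esub> h a"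
      then show "poly_act act (p + q) a \<in> C \<and> h (poly_act act (p + q) a) = \<Phi> (p + q) \<odot>\<^bsub>M\<^esub> h a"
        using cl[OF a(2)] C
        by (simp add: additive_map_add[OF poly_act_additive_left[OF act]] add Phi_add Phi_closed M.smult_l_distr)
    qed
    then show ?thesis using a p j by (simp add: wmod_smult[OF j act])
  qed
  fix v assume "v \<in> carrier (wmod j C act)"
  then obtain b where b: "v = j b" "b \<in> C" by (auto simp: wmod_simps)
  then show "h (inv_into UNIV j (u \<oplus>\<^bsub>wmod j C act\<^esub> v)) = h (inv_into UNIV j u) \<oplus>\<^bsub>M\<^esub> h (inv_into UNIV j v)"
    using a j add by (simp add: wmod_add)
qed

lemma wmod_hom_wmod:
  assumes "inj j" "word_action N C act" "inj j'" "word_action N C' act'"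
    and "additive_map h" "\<And>a. a \<in> C \<Longrightarrow> h a \<in> C'"
    and "\<And>c w a. a \<in> C \<Longrightarrow> h (act c w a) = act' c w (h a)"
  shows "(\<lambda>u. j' (h (inv_into UNIV j u))) \<in> left_module_hom A (wmod j C act) (wmod j' C' act')"
proof (rule wmod_homI[OF assms(1,2) left_module_wmod[OF assms(3,4)]])
  fix a assume a: "a \<in> C"
  show "j' (h a) \<in> carrier (wmod j' C' act')" using assms(6)[OF a] by (simp add: wmod_simps)
  show "j' (h (act c w a)) = \<Phi> (Poly_Mapping.single w c) \<odot>\<^bsub>wmod j' C' act'\<^esub> j' (h a)" for c w
    unfolding wmod_smult[OF assms(3,4) assms(6)[OF a]] poly_act_single[OF assms(4)] assms(7)[OF a] ..
  show "j' (h (a + b)) = j' (h a) \<oplus>\<^bsub>wmod j' C' act'\<^esub> j' (h b)" for b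
    unfolding wmod_add[OF assms(3)] additive_map_add[OF assms(5)] ..
qed


subsection \<open>Every module is given by a word action\<close>

text \<open>Evaluation of formal linear combinations in \<open>M\<close>. Elements outside the
  carrier count as zero, so the map is linear on all formal combinations.\<close>

definition comb :: "('a, 'v) module \<Rightarrow> ('v \<Rightarrow>\<^sub>0 'k) \<Rightarrow> 'v" where
  "comb M p = finsum M (\<lambda>v. if v \<in> carrier M then \<Phi> (Poly_Mapping.single [] (lookup p v)) \<odot>\<^bsub>M\<^esub> v else \<zero>\<^bsub>M\<^esub>) (keys p)"

context
  fixes M :: "('a, 'v) module"
  assumes M: "left_module A M"
begin

interpretation M: left_module A M by (fact M)

lemma smult_Phi_closed [simp]: "m \<in> carrier M \<Longrightarrow> \<Phi> p \<odot>\<^bsub>M\<^esub> m \<in> carrier M"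
  by (simp add: M.smult_closed Phi_closed)

lemma comb_superset:
  assumes "finite S" "keys p \<subseteq> S"
  shows "comb M p = finsum M (\<lambda>v. if v \<in> carrier M then \<Phi> (Poly_Mapping.single [] (lookup p v)) \<odot>\<^bsub>M\<^esub> v else \<zero>\<^bsub>M\<^esub>) S"
  unfolding comb_def
  using assms by (intro M.M.add.finprod_mono_neutral_cong_left)
    (auto simp: in_keys_iff Phi_zero M.zero_smult)

lemma comb_closed [simp]: "comb M p \<in> carrier M"
  unfolding comb_def by (intro M.M.finsum_closed) auto

lemma comb_add: "comb M (p + q) = comb M p \<oplus>\<^bsub>M\<^esub> comb M q"
proof -
  let ?S = "keys p \<union> keys q"
  have "comb M (p + q) = finsum M (\<lambda>v. (if v \<in> carrier M then \<Phi> (Poly_Mapping.single [] (lookup p v)) \<odot>\<^bsub>M\<^esub> v else \<zero>\<^bsub>M\<^esub>)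
      \<oplus>\<^bsub>M\<^esub> (if v \<in> carrier M then \<Phi> (Poly_Mapping.single [] (lookup q v)) \<odot>\<^bsub>M\<^esub> v else \<zero>\<^bsub>M\<^esub>)) ?S"
    unfolding comb_superset[of ?S "p + q", OF _ keys_add, simplified]
    by (intro M.M.finsum_cong') (auto simp: lookup_add single_add Phi_add Phi_closed M.smult_l_distr)
  also have "\<dots> = comb M p \<oplus>\<^bsub>M\<^esub> comb M q"
    unfolding comb_superset[of ?S p, simplified] comb_superset[of ?S q, simplified]
    by (intro M.M.finsum_addf) auto
  finally show ?thesis .
qed

lemma comb_zero: "comb M 0 = \<zero>\<^bsub>M\<^esub>" by (simp add: comb_def)

lemma comb_single: "m \<in> carrier M \<Longrightarrow> comb M (Poly_Mapping.single m c) = \<Phi> (Poly_Mapping.single [] c) \<odot>\<^bsub>M\<^esub> m"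
  by (subst comb_superset[of "{m}"]) auto

lemma smult_zero_Phi: "\<Phi> p \<odot>\<^bsub>M\<^esub> \<zero>\<^bsub>M\<^esub> = \<zero>\<^bsub>M\<^esub>"
  by (simp add: M.smult_zero Phi_closed)

lemma comb_scale: "comb M (pm_scale c p) = \<Phi> (Poly_Mapping.single [] c) \<odot>\<^bsub>M\<^esub> comb M p"
proof (rule poly_mapping_add_induct[where p = p])
  have "pm_scale c (0 :: 'v \<Rightarrow>\<^sub>0 'k) = 0" by (auto intro!: poly_mapping_eqI)
  then show "comb M (pm_scale c 0) = \<Phi> (Poly_Mapping.single [] c) \<odot>\<^bsub>M\<^esub> comb M 0"
    by (simp add: comb_zero smult_zero_Phi)
  show "comb M (pm_scale c (p + q)) = \<Phi> (Poly_Mapping.single [] c) \<odot>\<^bsub>M\<^esub> comb M (p + q)"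
    if "comb M (pm_scale c p) = \<Phi> (Poly_Mapping.single [] c) \<odot>\<^bsub>M\<^esub> comb M p"
      "comb M (pm_scale c q) = \<Phi> (Poly_Mapping.single [] c) \<odot>\<^bsub>M\<^esub> comb M q" for p q
    using that by (simp add: pm_scale_add comb_add M.smult_r_distr Phi_closed)
  show "comb M (pm_scale c (Poly_Mapping.single t (lookup p t))) =
      \<Phi> (Poly_Mapping.single [] c) \<odot>\<^bsub>M\<^esub> comb M (Poly_Mapping.single t (lookup p t))" for t
  proof (cases "t \<in> carrier M")
    case True
    then show ?thesis
      by (simp add: comb_single Phi_closed mult_single plus_list_def flip: M.smult_assoc Phi_mult)
  next
    case False
    then have "comb M (Poly_Mapping.single t d) = \<zero>\<^bsub>M\<^esub>" for d
      by (subst comb_superset[of "{t}"]) auto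
    then show ?thesis by (simp add: smult_zero_Phi)
  qed
qed

text \<open>\<open>M\<close> is a quotient of the formal combinations. A basis of the kernel is
  extended by single elements; those added span a complement, hence form a basis of \<open>M\<close>
  over the field.\<close>

lemma module_basis:
  obtains B where "B \<subseteq> carrier M" "bij_betw (comb M) (supp_in B) (carrier M)"
proof -
  interpret V: vector_space "pm_scale :: 'k \<Rightarrow> ('v \<Rightarrow>\<^sub>0 'k) \<Rightarrow> _" by (rule pm_scale_vector_space)
  let ?W = "{p. comb M p = \<zero>\<^bsub>M\<^esub>}"
  have W: "V.subspace ?W"
    by (rule V.subspaceI) (auto simp: comb_zero comb_add comb_scale smult_zero_Phi)
  obtain B0 where B0: "B0 \<subseteq> ?W" "V.independent B0" "?W \<subseteq> V.span B0"
    using V.maximal_independent_subset[of ?W] by blast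
  let ?S = "(\<lambda>v. Poly_Mapping.single v (1::'k)) ` carrier M"
  obtain B where B: "B0 \<subseteq> B" "B \<subseteq> B0 \<union> ?S" "V.independent B" "B0 \<union> ?S \<subseteq> V.span B"
    using V.maximal_independent_subset_extend[of B0 "B0 \<union> ?S"] B0 by blast
  let ?X = "{v \<in> carrier M. Poly_Mapping.single v 1 \<in> B - B0}"
  \<comment> \<open>The added basis vectors are single terms, so their span is a coordinate
    subspace.\<close>
  have "V.span (B - B0) = supp_in ?X"
  proof (intro equalityI subsetI)
    have "V.subspace (supp_in ?X :: ('v \<Rightarrow>\<^sub>0 'k) set)"
    proof (rule V.subspaceI)
      show "0 \<in> (supp_in ?X :: ('v \<Rightarrow>\<^sub>0 'k) set)" by simp
      show "p + q \<in> supp_in ?X" if "p \<in> supp_in ?X" "q \<in> supp_in ?X" for p q :: "'v \<Rightarrow>\<^sub>0 'k"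
        using that add_closed_supp_in[of ?X] unfolding add_closed_def by blast
      show "pm_scale c p \<in> supp_in ?X" if "p \<in> supp_in ?X" for c and p :: "'v \<Rightarrow>\<^sub>0 'k"
        using that keys_pm_scale[of c p] by simp
    qed
    moreover have "B - B0 \<subseteq> supp_in ?X" using B(2) by auto
    ultimately show "p \<in> supp_in ?X" if "p \<in> V.span (B - B0)" for p
      using V.span_minimal that by blast
  next
    fix p :: "'v \<Rightarrow>\<^sub>0 'k" assume p: "p \<in> supp_in ?X"
    have "(\<Sum>t\<in>keys p. pm_scale (lookup p t) (Poly_Mapping.single t 1)) \<in> V.span (B - B0)"
    proof (intro V.span_sum V.span_scale V.span_base)
      fix t assume "t \<in> keys p"
      then show "Poly_Mapping.single t 1 \<in> B - B0" using p by blast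
    qed
    then show "p \<in> V.span (B - B0)" by (simp add: poly_mapping_sum_single)
  qed
  note sp = this
  have W0: "p \<in> ?W" if "p \<in> V.span B0" for p
    using that V.span_minimal[OF B0(1) W] by blast
  have "inj_on (comb M) (supp_in ?X)"
  proof (rule inj_onI)
    fix p q :: "'v \<Rightarrow>\<^sub>0 'k" assume pq: "p \<in> supp_in ?X" "q \<in> supp_in ?X" "comb M p = comb M q"
    have "comb M (p - q) \<oplus>\<^bsub>M\<^esub> comb M q = comb M p" by (simp flip: comb_add)
    then have "comb M (p - q) = \<zero>\<^bsub>M\<^esub>" using pq(3) comb_closed by (metis M.M.add.r_cancel_one')
    then have 1: "p - q \<in> V.span B0" using B0(3) by blast
    have 2: "p - q \<in> V.span (B - B0)" using pq sp V.span_diff by blast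
    have "V.representation B (p - q) b = 0" for b
    proof (cases "b \<in> B0")
      case True
      have "V.representation B (p - q) = V.representation (B - B0) (p - q)"
        using B(3) 2 by (intro V.representation_extend) auto
      then show ?thesis using True V.representation_ne_zero by fastforce
    next
      case False
      have "V.representation B (p - q) = V.representation B0 (p - q)"
        using B(1,3) 1 by (intro V.representation_extend) auto
      then show ?thesis using False V.representation_ne_zero by fastforce
    qed
    moreover have "p - q \<in> V.span B" using 1 B(1) V.span_mono by blast
    ultimately have "p - q = 0" using V.sum_nonzero_representation_eq[OF B(3)] by fastforce
    then show "p = q" by simp
  qed
  moreover have "comb M ` supp_in ?X = carrier M"
  proof (intro equalityI subsetI)
    fix m assume m: "m \<in> carrier M"
    then have "Poly_Mapping.single m 1 \<in> V.span B" using B(4) by blast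
    then have "Poly_Mapping.single m 1 \<in> V.span (B0 \<union> (B - B0))" using B(1) by (simp add: Un_absorb1)
    then obtain p q where pq: "p \<in> V.span B0" "q \<in> V.span (B - B0)" "Poly_Mapping.single m (1::'k) = p + q"
      unfolding V.span_Un by blast
    have "m = comb M (p + q)"
      using m by (simp flip: pq(3) add: comb_single one_single[symmetric] Phi_one M.smult_one)
    also have "\<dots> = comb M q" using W0[OF pq(1)] by (simp add: comb_add)
    finally show "m \<in> comb M ` supp_in ?X" using pq(2) sp by blast
  qed (use comb_closed in auto)
  ultimately show thesis using that[of ?X] by (auto simp: bij_betw_def)
qed

text \<open>Transport of structure along a basis over the field. With coefficient vectors and an
  action of words, induced modules can be written down explicitly.\<close>

lemma module_representation:
  obtains B and act :: "'k \<Rightarrow> letter list \<Rightarrow> ('v \<Rightarrow>\<^sub>0 'k) \<Rightarrow> ('v \<Rightarrow>\<^sub>0 'k)"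
  where "word_action N (supp_in B) act" "\<And>c p. keys p \<subseteq> B \<Longrightarrow> act c [] p = pm_scale c p"
    "bij_betw (comb M) (supp_in B) (carrier M)"
    "\<And>c w p. keys p \<subseteq> B \<Longrightarrow> comb M (act c w p) = \<Phi> (Poly_Mapping.single w c) \<odot>\<^bsub>M\<^esub> comb M p"
proof -
  obtain B where B: "bij_betw (comb M) (supp_in B) (carrier M)" using module_basis by blast
  let ?C = "supp_in B :: ('v \<Rightarrow>\<^sub>0 'k) set"
  let ?i = "inv_into ?C (comb M)"
  define act where "act c w p = ?i (\<Phi> (Poly_Mapping.single w c) \<odot>\<^bsub>M\<^esub> comb M p)" for c w p
  have ci: "comb M (?i m) = m" if "m \<in> carrier M" for m using B that by (simp add: bij_betw_inv_into_right)
  have ic: "?i (comb M p) = p" if "p \<in> ?C" for p using B that by (simp add: bij_betw_inv_into_left)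
  have iC: "?i m \<in> ?C" if "m \<in> carrier M" for m
    using B that by (metis bij_betw_def inv_into_into)
  have C: "add_closed ?C" by (rule add_closed_supp_in)
  have iadd: "?i (m \<oplus>\<^bsub>M\<^esub> m') = ?i m + ?i m'" if "m \<in> carrier M" "m' \<in> carrier M" for m m'
  proof -
    have "?i m + ?i m' \<in> ?C" using C iC that unfolding add_closed_def by blast
    from ic[OF this] show ?thesis using that by (simp add: comb_add ci)
  qed
  have cact: "comb M (act c w p) = \<Phi> (Poly_Mapping.single w c) \<odot>\<^bsub>M\<^esub> comb M p" for c w p
    unfolding act_def by (simp add: ci)
  have i0: "?i \<zero>\<^bsub>M\<^esub> = 0" using ic[of 0] by (simp add: comb_zero)
  have "word_action N ?C act"
    unfolding word_action_def
  proof (intro conjI allI ballI impI)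
    show "add_closed ?C" by (rule C)
    show "additive_map (act c w)" for c w
      unfolding additive_map_def act_def by (simp add: comb_add M.smult_r_distr Phi_closed iadd)
    show "additive_map (\<lambda>c. act c w a)" for w a
      unfolding additive_map_def act_def by (simp add: single_add Phi_add M.smult_l_distr Phi_closed iadd)
    show "act c w a \<in> ?C" for c w a unfolding act_def by (rule iC) simp
    show "act c v (act d w a) = act (c * d) (v @ w) a" for c v d w a
      unfolding act_def[of c v] cact
      by (simp add: act_def Phi_closed mult_single plus_list_def flip: M.smult_assoc Phi_mult)
    show "act 1 [] a = a" if "a \<in> ?C" for a
      unfolding act_def one_single[symmetric] Phi_one by (simp add: M.smult_one ic[OF that])
    show "act c w a = 0" if "w \<notin> N" for c w a
    proof -
      have "\<Phi> (Poly_Mapping.single w c) = \<zero>" using that by (simp add: Phi_eq_zero_iff)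
      then show ?thesis unfolding act_def by (simp add: M.zero_smult i0)
    qed
  qed
  moreover have "act c [] p = pm_scale c p" if "keys p \<subseteq> B" for c p
  proof -
    have "pm_scale c p \<in> ?C" using that keys_pm_scale[of c p] by blast
    from ic[OF this] show ?thesis unfolding act_def by (simp add: comb_scale)
  qed
  ultimately show thesis using that B cact by blast
qed

end

end


section \<open>Induced modules\<close>

text \<open>\<open>N\<close> is the set of products \<open>t @ s\<close>: the algebra is then a free right module, with basis
  \<open>T\<close>, over the subalgebra spanned by \<open>S\<close>.\<close>

definition word_split :: "letter list set \<Rightarrow> letter list set \<Rightarrow> letter list set \<Rightarrow> bool" where
  "word_split N T S \<longleftrightarrow> (\<forall>t\<in>T. \<forall>s\<in>S. t @ s \<in> N) \<and> (\<forall>w\<in>N. \<exists>t\<in>T. \<exists>s\<in>S. w = t @ s) \<and>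
     (\<forall>t\<in>T. \<forall>t'\<in>T. \<forall>s\<in>S. \<forall>s'\<in>S. t @ s = t' @ s' \<longrightarrow> t = t') \<and>
     [] \<in> S \<and> (\<forall>s\<in>S. \<forall>s'\<in>S. s @ s' \<in> N \<longrightarrow> s @ s' \<in> S)"

definition split_fst :: "letter list set \<Rightarrow> letter list set \<Rightarrow> letter list \<Rightarrow> letter list" where
  "split_fst T S w = (SOME t. t \<in> T \<and> (\<exists>s\<in>S. w = t @ s))"

definition split_snd :: "letter list set \<Rightarrow> letter list set \<Rightarrow> letter list \<Rightarrow> letter list" where
  "split_snd T S w = drop (length (split_fst T S w)) w"

lemma
  assumes "word_split N T S" "t \<in> T" "s \<in> S"
  shows split_fst_append: "split_fst T S (t @ s) = t" and split_snd_append: "split_snd T S (t @ s) = s"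
    and split_normal: "t @ s \<in> N"
proof -
  show "split_fst T S (t @ s) = t"
    unfolding split_fst_def
  proof (rule some_equality)
    show "t \<in> T \<and> (\<exists>s'\<in>S. t @ s = t @ s')" using assms by blast
    show "t' = t" if "t' \<in> T \<and> (\<exists>s'\<in>S. t @ s = t' @ s')" for t'
      using that assms unfolding word_split_def by metis
  qed
  then show "split_snd T S (t @ s) = s" by (simp add: split_snd_def)
  show "t @ s \<in> N" using assms by (simp add: word_split_def)
qed

lemma
  assumes "word_split N T S"
  shows word_split_Nil: "[] \<in> S" and word_split_first: "t \<in> T \<Longrightarrow> t \<in> N"
proof -
  show n: "[] \<in> S" using assms by (simp add: word_split_def)
  show "t \<in> T \<Longrightarrow> t \<in> N" using split_normal[OF assms _ n] by simp
qed

lemma word_splitE: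
  assumes "w \<in> N" "word_split N T S"
  obtains t s where "t \<in> T" "s \<in> S" "w = t @ s"
  using assms unfolding word_split_def by blast

lemma word_split_append: "word_split N T S \<Longrightarrow> s \<in> S \<Longrightarrow> s' \<in> S \<Longrightarrow> s @ s' \<in> N \<Longrightarrow> s @ s' \<in> S"
  unfolding word_split_def by blast

text \<open>The tensor product over the subalgebra is a sum of copies of the coefficients indexed by
  \<open>T\<close>. To apply \<open>w\<close> at the place \<open>t\<close>, the word
  \<open>w @ t\<close> is split anew, and its \<open>S\<close> part acts on the coefficient.\<close>

definition ind_act :: "letter list set \<Rightarrow> letter list set \<Rightarrow> letter list set \<Rightarrow>
    ('k::field \<Rightarrow> letter list \<Rightarrow> 'q::ab_group_add \<Rightarrow> 'q) \<Rightarrow> 'k \<Rightarrow> letter list \<Rightarrow>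
    (letter list \<Rightarrow>\<^sub>0 'q) \<Rightarrow> (letter list \<Rightarrow>\<^sub>0 'q)" where
  "ind_act N T S act c w = pm_sum (\<lambda>t m. if w @ t \<in> N
     then Poly_Mapping.single (split_fst T S (w @ t)) (act c (split_snd T S (w @ t)) m) else 0)"

definition ind_car :: "letter list set \<Rightarrow> 'q::zero set \<Rightarrow> (letter list \<Rightarrow>\<^sub>0 'q) set" where
  "ind_car T C = {p. keys p \<subseteq> T \<and> (\<forall>t. lookup p t \<in> C)}"

lemma add_closed_ind_car:
  fixes C :: "'q::ab_group_add set"
  assumes "add_closed C" shows "add_closed (ind_car T C)"
proof -
  have "keys (- p) = keys p" for p :: "letter list \<Rightarrow>\<^sub>0 'q"
    by (auto simp: in_keys_iff)
  then show ?thesis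
    using assms unfolding add_closed_def ind_car_def
    by (auto simp: lookup_add dest!: subsetD[OF keys_add])
qed

lemma single_in_ind_car: "add_closed C \<Longrightarrow> t \<in> T \<Longrightarrow> m \<in> C \<Longrightarrow> Poly_Mapping.single t m \<in> ind_car T C"
  by (auto simp: ind_car_def lookup_single when_def add_closed_def)

lemma ind_car_lookup: "p \<in> ind_car T C \<Longrightarrow> t \<in> keys p \<Longrightarrow> t \<in> T \<and> lookup p t \<in> C"
  by (auto simp: ind_car_def)

lemma ind_car_eqI:
  assumes "p \<in> ind_car T C" "additive_map f" "additive_map g"
    and "\<And>t m. t \<in> T \<Longrightarrow> m \<in> C \<Longrightarrow> f (Poly_Mapping.single t m) = g (Poly_Mapping.single t m)"
  shows "f p = g p"
proof (rule additive_map_eq_on[OF assms(2,3)])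
  fix t assume "t \<in> keys p"
  then have "t \<in> T" "lookup p t \<in> C" using ind_car_lookup[OF assms(1)] by simp_all
  then show "f (Poly_Mapping.single t (lookup p t)) = g (Poly_Mapping.single t (lookup p t))"
    by (rule assms(4))
qed

lemma ind_car_closedI:
  assumes "p \<in> ind_car T C" "additive_map f" "add_closed D"
    and "\<And>t m. t \<in> T \<Longrightarrow> m \<in> C \<Longrightarrow> f (Poly_Mapping.single t m) \<in> D"
  shows "f p \<in> D"
proof (rule poly_mapping_add_induct[where p = p])
  show "f 0 \<in> D" using assms(2,3) by (simp add: additive_map_zero add_closed_def)
  show "f (Poly_Mapping.single t (lookup p t)) \<in> D" if "t \<in> keys p" for t
    using assms(4) ind_car_lookup[OF assms(1) that] by blast
  show "f (p + q) \<in> D" if "f p \<in> D" "f q \<in> D" for p q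
    using that assms(2,3) by (simp add: additive_map_add add_closed_def)
qed

text \<open>The action twisted by the augmentation of the algebra.\<close>

definition triv_act :: "('k \<Rightarrow> letter list \<Rightarrow> 'q \<Rightarrow> 'q::zero) \<Rightarrow> 'k \<Rightarrow> letter list \<Rightarrow> 'q \<Rightarrow> 'q" where
  "triv_act act c w m = (if w = [] then act c [] m else 0)"

lemma word_power_append: "concat (replicate i u) @ u = u @ concat (replicate i u)"
  by (induction i) auto

context word_algebra
begin

lemma triv_act:
  assumes "word_action N C act" shows "word_action N C (triv_act act)"
proof -
  note A = word_actionD[OF assms]
  have "0 \<in> C" using A(1) by (simp add: add_closed_def)
  moreover have "triv_act act c v (triv_act act d w a) = triv_act act (c * d) (v @ w) a" if "a \<in> C" for c v d w a
    using A(5)[OF that, of c "[]" d "[]"] additive_map_zero[OF A(2)] by (simp add: triv_act_def)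
  moreover have "additive_map (triv_act act c w)" "additive_map (\<lambda>c. triv_act act c w a)" for c w a
    using A(2)[of c "[]"] A(3)[of "[]" a] unfolding triv_act_def additive_map_def by simp_all
  ultimately show ?thesis
    unfolding word_action_def using A(1,4,6) Nil_normal by (auto simp: triv_act_def)
qed

context
  fixes T S and C :: "'q::ab_group_add set" and act :: "'k \<Rightarrow> letter list \<Rightarrow> 'q \<Rightarrow> 'q"
  assumes split: "word_split N T S" and act: "word_action N C act"
begin

lemma ind_term_additive: "additive_map (\<lambda>m. if w @ t \<in> N
     then Poly_Mapping.single (split_fst T S (w @ t)) (act c (split_snd T S (w @ t)) m) else 0)"
  using word_actionD(2)[OF act] by (auto simp: additive_map_def single_add)

lemma ind_act_additive: "additive_map (ind_act N T S act c w)"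
  unfolding ind_act_def by (rule pm_sum_additive) (rule ind_term_additive)

lemma ind_act_single:
  "ind_act N T S act c w (Poly_Mapping.single t m) = (if w @ t \<in> N
     then Poly_Mapping.single (split_fst T S (w @ t)) (act c (split_snd T S (w @ t)) m) else 0)"
  unfolding ind_act_def by (rule pm_sum_single) (rule ind_term_additive)

lemma ind_act_split:
  assumes "t' \<in> T" "s \<in> S" "w @ t = t' @ s"
  shows "ind_act N T S act c w (Poly_Mapping.single t m) = Poly_Mapping.single t' (act c s m)"
  unfolding ind_act_single assms(3)
  using split_fst_append[OF split assms(1,2)] split_snd_append[OF split assms(1,2)]
    split_normal[OF split assms(1,2)] by simp

lemma ind_act_not_normal: "w @ t \<notin> N \<Longrightarrow> ind_act N T S act c w (Poly_Mapping.single t m) = 0"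
  unfolding ind_act_single by simp

lemma word_action_ind: "word_action N (ind_car T C) (ind_act N T S act)"
proof -
  note A = word_actionD[OF act]
  note add = ind_act_additive
  have car: "add_closed (ind_car T C)" using A(1) by (rule add_closed_ind_car)
  have addl: "additive_map (\<lambda>c. ind_act N T S act c w a)" for w a
    unfolding ind_act_def
    by (rule pm_sum_additive_param) (use A(3) in \<open>auto simp: additive_map_def single_add\<close>)
  show ?thesis
    unfolding word_action_def
  proof (intro conjI allI ballI impI car add addl)
    fix c :: 'k and w :: "letter list" and p :: "letter list \<Rightarrow>\<^sub>0 'q" assume p: "p \<in> ind_car T C"
    show "ind_act N T S act c w p \<in> ind_car T C"
    proof (rule ind_car_closedI[OF p add car])
      fix t m assume tm: "t \<in> T" "m \<in> C"
      show "ind_act N T S act c w (Poly_Mapping.single t m) \<in> ind_car T C"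
      proof (cases "w @ t \<in> N")
        case True
        then obtain t' s where "t' \<in> T" "s \<in> S" "w @ t = t' @ s" using split by (rule word_splitE)
        then show ?thesis using tm by (simp add: ind_act_split single_in_ind_car A(1,4))
      next
        case False
        then show ?thesis using car by (simp add: ind_act_not_normal add_closed_def)
      qed
    qed
    show "ind_act N T S act c v (ind_act N T S act d w p) = ind_act N T S act (c * d) (v @ w) p" for v and d :: 'k
    proof (rule ind_car_eqI[OF p additive_map_comp[OF add add] add])
      fix t m assume tm: "t \<in> T" "m \<in> C"
      show "ind_act N T S act c v (ind_act N T S act d w (Poly_Mapping.single t m)) =
        ind_act N T S act (c * d) (v @ w) (Poly_Mapping.single t m)"
      proof (cases "w @ t \<in> N")
        case True
        then obtain t1 s1 where 1: "t1 \<in> T" "s1 \<in> S" "w @ t = t1 @ s1" using split by (rule word_splitE)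
        show ?thesis
        proof (cases "v @ t1 \<in> N")
          case True
          then obtain t2 s2 where 2: "t2 \<in> T" "s2 \<in> S" "v @ t1 = t2 @ s2" using split by (rule word_splitE)
          \<comment> \<open>Both sides land at the place \<open>t2\<close>. If
            \<open>s2 @ s1\<close> is not normal, the whole word is not either, and the coefficient
            on the left vanishes as well.\<close>
          have e: "(v @ w) @ t = t2 @ (s2 @ s1)" using 1 2 by (metis append.assoc)
          have l: "ind_act N T S act c v (ind_act N T S act d w (Poly_Mapping.single t m)) =
              Poly_Mapping.single t2 (act (c * d) (s2 @ s1) m)"
            using tm by (simp add: ind_act_split[OF 1] ind_act_split[OF 2] A(5))
          show ?thesis
          proof (cases "s2 @ s1 \<in> N")
            case True
            then have "s2 @ s1 \<in> S" using word_split_append[OF split] 1 2 by blast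
            then show ?thesis unfolding l using ind_act_split[OF 2(1) _ e] by simp
          next
            case False
            then have "(v @ w) @ t \<notin> N" unfolding e using normal_factor by blast
            from ind_act_not_normal[OF this] show ?thesis unfolding l A(7)[OF tm(2) False] by simp
          qed
        next
          case False
          have e: "(v @ w) @ t = (v @ t1) @ s1" using 1 by simp
          have "(v @ w) @ t \<notin> N" unfolding e using False normal_factor by blast
          then show ?thesis
            unfolding ind_act_split[OF 1] ind_act_not_normal[OF False] by (rule ind_act_not_normal[symmetric])
        qed
      next
        case False
        then have "(v @ w) @ t \<notin> N" using normal_factor[of v "w @ t"] by auto
        from ind_act_not_normal[OF this] show ?thesis
          unfolding ind_act_not_normal[OF False] additive_map_zero[OF add] by simp
      qed
    qed
    show "ind_act N T S act 1 [] p = p"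
    proof (rule ind_car_eqI[OF p add additive_map_id])
      fix t m assume "t \<in> T" "m \<in> C"
      then show "ind_act N T S act 1 [] (Poly_Mapping.single t m) = Poly_Mapping.single t m"
        using ind_act_split[OF _ word_split_Nil[OF split], of t "[]" t] by (simp add: A(6))
    qed
    show "ind_act N T S act c w p = 0" if "w \<notin> N"
    proof (rule ind_car_eqI[OF p add])
      show "additive_map (\<lambda>_. 0)" by (simp add: additive_map_def)
      show "ind_act N T S act c w (Poly_Mapping.single t m) = 0" for t m
        using that normal_factor by (intro ind_act_not_normal) blast
    qed
  qed
qed

end

text \<open>One step of the filtration: \<open>S'\<close> is generated by \<open>S\<close> and the word \<open>u\<close>. With \<open>\<epsilon>\<close> the
  trivial action and \<open>B\<close>, \<open>B'\<close> the subalgebras spanned by \<open>S\<close>, \<open>S'\<close>, the maps below form the exact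
  sequence \<open>0 \<rightarrow> A \<otimes>\<^sub>B M\<^sub>\<epsilon> \<rightarrow> A \<otimes>\<^sub>B M \<rightarrow> A \<otimes>\<^sub>B\<^sub>' M \<rightarrow> 0\<close> with first map
  \<open>t \<otimes> m \<mapsto> tu \<otimes> m - t \<otimes> um\<close>; the map \<open>step_htpy\<close> is a contracting homotopy.\<close>

definition step_proj where
  "step_proj T' S' act = pm_sum (\<lambda>t m. Poly_Mapping.single (split_fst T' S' t) (act (1::'k) (split_snd T' S' t) m))"

definition step_incl where
  "step_incl act u = pm_sum (\<lambda>t m. Poly_Mapping.single (t @ u) m - Poly_Mapping.single t (act (1::'k) u m))"

definition step_exp :: "letter list set \<Rightarrow> letter list set \<Rightarrow> letter list \<Rightarrow> letter list \<Rightarrow> nat" where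
  "step_exp T' S' u t = (THE i. split_snd T' S' t = concat (replicate i u))"

definition step_htpy where
  "step_htpy T' S' act u = pm_sum (\<lambda>t m. \<Sum>i<step_exp T' S' u t.
     Poly_Mapping.single (split_fst T' S' t @ concat (replicate i u))
       (act (1::'k) (concat (replicate (step_exp T' S' u t - 1 - i) u)) m))"

context
  fixes T S T' S' u and C :: "'q::ab_group_add set" and act :: "'k \<Rightarrow> letter list \<Rightarrow> 'q \<Rightarrow> 'q"
  assumes split: "word_split N T S" and split': "word_split N T' S'"
    and T_eq: "T = {t @ concat (replicate i u) | t i. t \<in> T'}"
    and S_sub: "S \<subseteq> S'" and u_pow: "\<And>i. concat (replicate i u) \<in> S'" and u_ne: "u \<noteq> []"
    and su: "\<And>s. s \<in> S \<Longrightarrow> s \<noteq> [] \<Longrightarrow> s @ u \<in> N \<Longrightarrow> s @ u \<in> S"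
    and act: "word_action N C act"
begin

abbreviation (input) pw :: "nat \<Rightarrow> letter list" where "pw i \<equiv> concat (replicate i u)"

lemma pw_inj: "pw i = pw j \<longleftrightarrow> i = j"
proof
  assume "pw i = pw j"
  then have "length (pw i) = length (pw j)" by simp
  then show "i = j" using u_ne by (simp add: length_concat sum_list_replicate)
qed simp

lemma T_cases: "t \<in> T \<Longrightarrow> \<exists>t' i. t' \<in> T' \<and> t = t' @ pw i"
  unfolding T_eq by blast

lemma T_pw: "t' \<in> T' \<Longrightarrow> t' @ pw i \<in> T"
  unfolding T_eq by blast

lemma T_u: "t \<in> T \<Longrightarrow> t @ u \<in> T"
proof -
  assume "t \<in> T"
  then obtain t' i where "t' \<in> T'" "t = t' @ pw i" using T_cases by blast
  then show "t @ u \<in> T" using T_pw[of t' "Suc i"] by (simp add: word_power_append)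
qed

lemma split_pw: 
  assumes "t' \<in> T'"
  shows "split_fst T' S' (t' @ pw i) = t'" "split_snd T' S' (t' @ pw i) = pw i"
    "step_exp T' S' u (t' @ pw i) = i"
proof -
  show *: "split_fst T' S' (t' @ pw i) = t'" "split_snd T' S' (t' @ pw i) = pw i"
    using split_fst_append[OF split' assms u_pow] split_snd_append[OF split' assms u_pow] by simp_all
  show "step_exp T' S' u (t' @ pw i) = i"
    unfolding step_exp_def * by (rule the_equality) (simp_all only: pw_inj)
qed

lemma step_additive:
  "additive_map (step_proj T' S' act)" "additive_map (step_incl act u)" "additive_map (step_htpy T' S' act u)"
proof -
  note A = word_actionD[OF act]
  have [simp]: "act c w (a + b) = act c w a + act c w b" for c w a b using A(2) by (rule additive_map_add)
  show "additive_map (step_proj T' S' act)" unfolding step_proj_def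
    by (rule pm_sum_additive) (simp add: additive_map_def single_add)
  show "additive_map (step_incl act u)" unfolding step_incl_def
    by (rule pm_sum_additive) (simp add: additive_map_def single_add)
  show "additive_map (step_htpy T' S' act u)" unfolding step_htpy_def
    by (rule pm_sum_additive) (simp add: additive_map_def single_add sum.distrib)
qed

lemma step_single:
  "step_proj T' S' act (Poly_Mapping.single t m) = Poly_Mapping.single (split_fst T' S' t) (act 1 (split_snd T' S' t) m)"
  "step_incl act u (Poly_Mapping.single t m) = Poly_Mapping.single (t @ u) m - Poly_Mapping.single t (act 1 u m)"
  "step_htpy T' S' act u (Poly_Mapping.single t m) = (\<Sum>i<step_exp T' S' u t.
     Poly_Mapping.single (split_fst T' S' t @ pw i) (act 1 (pw (step_exp T' S' u t - 1 - i)) m))"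
proof -
  note A = word_actionD[OF act]
  have [simp]: "act c w (a + b) = act c w a + act c w b" for c w a b using A(2) by (rule additive_map_add)
  show "step_proj T' S' act (Poly_Mapping.single t m) = Poly_Mapping.single (split_fst T' S' t) (act 1 (split_snd T' S' t) m)"
    unfolding step_proj_def by (rule pm_sum_single) (simp add: additive_map_def single_add)
  show "step_incl act u (Poly_Mapping.single t m) = Poly_Mapping.single (t @ u) m - Poly_Mapping.single t (act 1 u m)"
    unfolding step_incl_def by (rule pm_sum_single) (simp add: additive_map_def single_add)
  show "step_htpy T' S' act u (Poly_Mapping.single t m) = (\<Sum>i<step_exp T' S' u t.
     Poly_Mapping.single (split_fst T' S' t @ pw i) (act 1 (pw (step_exp T' S' u t - 1 - i)) m))"
    unfolding step_htpy_def by (rule pm_sum_single) (simp add: additive_map_def single_add sum.distrib)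
qed

lemma step_proj_pw: "t' \<in> T' \<Longrightarrow> step_proj T' S' act (Poly_Mapping.single (t' @ pw i) m) = Poly_Mapping.single t' (act 1 (pw i) m)"
  unfolding step_single split_pw ..

lemma step_htpy_pw: "t' \<in> T' \<Longrightarrow> step_htpy T' S' act u (Poly_Mapping.single (t' @ pw i) m) =
    (\<Sum>k<i. Poly_Mapping.single (t' @ pw k) (act 1 (pw (i - 1 - k)) m))"
  unfolding step_single split_pw ..

lemma T'_sub: "T' \<subseteq> T"
  using T_pw[of _ 0] by auto

lemma ind_car_T'_sub: "ind_car T' C \<subseteq> ind_car T C"
  using T'_sub by (auto simp: ind_car_def)

lemma step_closed:
  assumes "p \<in> ind_car T C"
  shows "step_proj T' S' act p \<in> ind_car T' C" "step_incl act u p \<in> ind_car T C"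
    "step_htpy T' S' act u p \<in> ind_car T C"
proof -
  note A = word_actionD[OF act]
  note car = add_closed_ind_car[OF A(1)]
  have diff: "a - b \<in> ind_car T C" if "a \<in> ind_car T C" "b \<in> ind_car T C" for a b :: "letter list \<Rightarrow>\<^sub>0 'q"
    using that car[of T] unfolding add_closed_def by (metis uminus_add_conv_diff add.commute)
  show "step_proj T' S' act p \<in> ind_car T' C"
  proof (rule ind_car_closedI[OF assms step_additive(1) car])
    fix t m assume "t \<in> T" "m \<in> C"
    then show "step_proj T' S' act (Poly_Mapping.single t m) \<in> ind_car T' C"
      using T_cases[of t] by (auto simp: step_proj_pw single_in_ind_car A(1,4))
  qed
  show "step_incl act u p \<in> ind_car T C"
  proof (rule ind_car_closedI[OF assms step_additive(2) car])
    fix t m assume "t \<in> T" "m \<in> C"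
    then show "step_incl act u (Poly_Mapping.single t m) \<in> ind_car T C"
      unfolding step_single by (intro diff single_in_ind_car A T_u)
  qed
  show "step_htpy T' S' act u p \<in> ind_car T C"
  proof (rule ind_car_closedI[OF assms step_additive(3) car])
    fix t m assume tm: "t \<in> T" "m \<in> C"
    then obtain t' i where "t' \<in> T'" "t = t' @ pw i" using T_cases by blast
    then show "step_htpy T' S' act u (Poly_Mapping.single t m) \<in> ind_car T C"
      using tm by (auto simp: step_htpy_pw intro!: add_closed_sum car single_in_ind_car A T_pw)
  qed
qed

lemma step_proj_incl:
  assumes "p \<in> ind_car T C" shows "step_proj T' S' act (step_incl act u p) = 0"
proof (rule ind_car_eqI[OF assms additive_map_comp[OF step_additive(1,2)]])
  note A = word_actionD[OF act]
  show "additive_map (\<lambda>_. 0)" by (simp add: additive_map_def)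
  fix t m assume tm: "t \<in> T" "m \<in> C"
  then obtain t' i where t: "t' \<in> T'" "t = t' @ pw i" using T_cases by blast
  have tu: "t @ u = t' @ pw (Suc i)" using t by (simp add: word_power_append)
  have "step_proj T' S' act (step_incl act u (Poly_Mapping.single t m)) =
      Poly_Mapping.single t' (act 1 (pw (Suc i)) m) - Poly_Mapping.single t' (act 1 (pw i) (act 1 u m))"
    unfolding step_single(2) additive_map_diff[OF step_additive(1)] tu
    unfolding t(2) step_proj_pw[OF t(1)] ..
  then show "step_proj T' S' act (step_incl act u (Poly_Mapping.single t m)) = 0"
    using tm by (simp add: A(5) word_power_append)
qed

lemma step_proj_id:
  assumes "p \<in> ind_car T' C" shows "step_proj T' S' act p = p"
proof (rule ind_car_eqI[OF assms step_additive(1) additive_map_id])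
  fix t m assume "t \<in> T'" "m \<in> C"
  then show "step_proj T' S' act (Poly_Mapping.single t m) = Poly_Mapping.single t m"
    using step_proj_pw[of t 0 m] by (simp add: word_actionD(6)[OF act])
qed

text \<open>The homotopy of the difference is a difference of two sums with the same terms, except
  that the first has one more, for \<open>k = i\<close>, and this one is the given element.\<close>

lemma step_htpy_incl:
  assumes "p \<in> ind_car T C" shows "step_htpy T' S' act u (step_incl act u p) = p"
proof (rule ind_car_eqI[OF assms additive_map_comp[OF step_additive(3,2)] additive_map_id])
  note A = word_actionD[OF act]
  fix t m assume tm: "t \<in> T" "m \<in> C"
  then obtain t' i where t: "t' \<in> T'" "t = t' @ pw i" using T_cases by blast
  have tu: "t @ u = t' @ pw (Suc i)" using t by (simp add: word_power_append)
  have e: "act 1 (pw (i - 1 - k)) (act 1 u m) = act 1 (pw (i - k)) m" if k: "k < i" for k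
  proof -
    define l where "l = i - 1 - k"
    then have l: "i - 1 - k = l" "i - k = Suc l" using k by simp_all
    show ?thesis unfolding l using A(5)[OF tm(2), of 1 "pw l" 1 u] by (simp add: word_power_append)
  qed
  have "step_htpy T' S' act u (step_incl act u (Poly_Mapping.single t m)) =
      (\<Sum>k<Suc i. Poly_Mapping.single (t' @ pw k) (act 1 (pw (i - k)) m)) -
      (\<Sum>k<i. Poly_Mapping.single (t' @ pw k) (act 1 (pw (i - 1 - k)) (act 1 u m)))"
    unfolding step_single(2) additive_map_diff[OF step_additive(3)] tu
    unfolding t(2) step_htpy_pw[OF t(1)] by simp
  also have "\<dots> = Poly_Mapping.single (t' @ pw i) (act 1 [] m)"
    using e by simp
  finally show "step_htpy T' S' act u (step_incl act u (Poly_Mapping.single t m)) = Poly_Mapping.single t m"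
    using tm t by (simp add: A(6))
qed

text \<open>Each summand of the homotopy becomes a difference of consecutive terms; the telescope
  starts at the projection of the given element and ends at the element itself.\<close>

lemma step_incl_htpy:
  assumes "p \<in> ind_car T C" 
  shows "step_incl act u (step_htpy T' S' act u p) = p - step_proj T' S' act p"
proof (rule ind_car_eqI[OF assms additive_map_comp[OF step_additive(2,3)]])
  note A = word_actionD[OF act]
  show "additive_map (\<lambda>p. p - step_proj T' S' act p)"
    using step_additive(1) by (simp add: additive_map_def)
  fix t m assume tm: "t \<in> T" "m \<in> C"
  then obtain t' i where t: "t' \<in> T'" "t = t' @ pw i" using T_cases by blast
  let ?g = "\<lambda>k. Poly_Mapping.single (t' @ pw k) (act 1 (pw (i - k)) m)"
  have e: "step_incl act u (Poly_Mapping.single (t' @ pw k) (act 1 (pw (i - 1 - k)) m)) = ?g (Suc k) - ?g k"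
    if k: "k < i" for k
  proof -
    define l where "l = i - 1 - k"
    then have l: "i - k = Suc l" and l': "i - 1 - k = l" "i - Suc k = l" using k by simp_all
    show ?thesis unfolding step_single(2) l l' using A(5)[OF tm(2), of 1 u 1 "pw l"]
      by (simp add: word_power_append)
  qed
  have add0: "step_incl act u (sum f I) = (\<Sum>i\<in>I. step_incl act u (f i))" for I :: "nat set" and f
    by (induction I rule: infinite_finite_induct)
      (simp_all add: additive_map_zero[OF step_additive(2)] additive_map_add[OF step_additive(2)])
  have "step_incl act u (step_htpy T' S' act u (Poly_Mapping.single t m)) = (\<Sum>k<i. ?g (Suc k) - ?g k)"
    unfolding t(2) step_htpy_pw[OF t(1)] add0 using e by (intro sum.cong) auto
  also have "\<dots> = ?g i - ?g 0" by (rule sum_lessThan_telescope)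
  also have "\<dots> = Poly_Mapping.single t m - step_proj T' S' act (Poly_Mapping.single t m)"
    unfolding t(2) step_proj_pw[OF t(1)] using A(6)[OF tm(2)] by simp
  finally show "step_incl act u (step_htpy T' S' act u (Poly_Mapping.single t m)) =
      Poly_Mapping.single t m - step_proj T' S' act (Poly_Mapping.single t m)" .
qed

text \<open>\<open>w @ t\<close> is decomposed in two ways, through the splitting for
  \<open>T\<close> and through the one for \<open>T'\<close>. Both are regrouped into a
  \<open>T'\<close> word times an \<open>S'\<close> word, and uniqueness there identifies
  them.\<close>

lemma step_proj_act:
  assumes "p \<in> ind_car T C"
  shows "step_proj T' S' act (ind_act N T S act c w p) = ind_act N T' S' act c w (step_proj T' S' act p)"
proof (rule ind_car_eqI[OF assms additive_map_comp[OF step_additive(1) ind_act_additive[OF split act]]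
      additive_map_comp[OF ind_act_additive[OF split' act] step_additive(1)]])
  note A = word_actionD[OF act]
  fix t m assume tm: "t \<in> T" "m \<in> C"
  then obtain t' i where t: "t' \<in> T'" "t = t' @ pw i" using T_cases by blast
  let ?r = "ind_act N T' S' act c w (step_proj T' S' act (Poly_Mapping.single t m))"
  have r: "?r = ind_act N T' S' act c w (Poly_Mapping.single t' (act 1 (pw i) m))"
    unfolding t(2) step_proj_pw[OF t(1)] ..
  show "step_proj T' S' act (ind_act N T S act c w (Poly_Mapping.single t m)) = ?r"
  proof (cases "w @ t' \<in> N")
    case False
    have e: "w @ t = (w @ t') @ pw i" using t by simp
    have "w @ t \<notin> N" unfolding e using False normal_factor by blast
    from ind_act_not_normal[OF split act this] show ?thesis unfolding r ind_act_not_normal[OF split' act False]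
      by (simp add: additive_map_zero[OF step_additive(1)])
  next
    case True
    then obtain t2 s2 where 2: "t2 \<in> T'" "s2 \<in> S'" "w @ t' = t2 @ s2" using split' by (rule word_splitE)
    have r': "?r = Poly_Mapping.single t2 (act c (s2 @ pw i) m)"
      unfolding r ind_act_split[OF split' act 2] using A(5)[OF tm(2)] by simp
    have wt: "w @ t = t2 @ (s2 @ pw i)" using t 2 by (metis append.assoc)
    show ?thesis
    proof (cases "w @ t \<in> N")
      case False
      then have "s2 @ pw i \<notin> N"
        using split_normal[OF split' 2(1) word_split_append[OF split' 2(2) u_pow]] unfolding wt by blast
      then show ?thesis unfolding r' ind_act_not_normal[OF split act False] A(7)[OF tm(2)]
        by (simp add: A(7)[OF tm(2)] additive_map_zero[OF step_additive(1)])
    next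
      case wtN: True
      then obtain t1 s1 where 1: "t1 \<in> T" "s1 \<in> S" "w @ t = t1 @ s1" using split by (rule word_splitE)
      obtain t3 j where 3: "t3 \<in> T'" "t1 = t3 @ pw j" using T_cases[OF 1(1)] by blast
      have l: "step_proj T' S' act (ind_act N T S act c w (Poly_Mapping.single t m)) =
          Poly_Mapping.single t3 (act c (pw j @ s1) m)"
        unfolding ind_act_split[OF split act 1] unfolding 3(2) step_proj_pw[OF 3(1)]
        using A(5)[OF tm(2)] by simp
      have e: "t2 @ (s2 @ pw i) = t3 @ (pw j @ s1)" using wt 1(3) 3(2) by simp
      have "s2 @ pw i \<in> N" using wtN normal_factor unfolding wt by blast
      then have in1: "s2 @ pw i \<in> S'" by (rule word_split_append[OF split' 2(2) u_pow])
      have "pw j @ s1 \<in> N" using wtN normal_factor unfolding wt e by blast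
      then have in2: "pw j @ s1 \<in> S'" by (rule word_split_append[OF split' u_pow subsetD[OF S_sub 1(2)]])
      have "t2 = t3" using split_fst_append[OF split' 2(1) in1] split_fst_append[OF split' 3(1) in2] e by simp
      then show ?thesis unfolding l r' using e by simp
    qed
  qed
qed

text \<open>Here the twisted action is forced. For nonempty \<open>s1\<close> the word
  \<open>s1 @ u\<close> lies in \<open>S\<close> or is not normal, so the two terms of the
  difference cancel, and the left side must vanish too.\<close>

lemma step_incl_act:
  assumes "p \<in> ind_car T C"
  shows "step_incl act u (ind_act N T S (triv_act act) c w p) = ind_act N T S act c w (step_incl act u p)"
proof (rule ind_car_eqI[OF assms additive_map_comp[OF step_additive(2) ind_act_additive[OF split triv_act[OF act]]]
      additive_map_comp[OF ind_act_additive[OF split act] step_additive(2)]])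
  note A = word_actionD[OF act]
  note addE = ind_act_additive[OF split act]
  fix t m assume tm: "t \<in> T" "m \<in> C"
  let ?r = "ind_act N T S act c w (step_incl act u (Poly_Mapping.single t m))"
  let ?l = "step_incl act u (ind_act N T S (triv_act act) c w (Poly_Mapping.single t m))"
  have r: "?r = ind_act N T S act c w (Poly_Mapping.single (t @ u) m) -
      ind_act N T S act c w (Poly_Mapping.single t (act 1 u m))"
    unfolding step_single(2) additive_map_diff[OF addE] ..
  show "?l = ?r"
  proof (cases "w @ t \<in> N")
    case False
    then have n: "w @ (t @ u) \<notin> N" using normal_factor[of "w @ t" u] by auto
    show ?thesis unfolding r ind_act_not_normal[OF split act n] ind_act_not_normal[OF split act False]
        ind_act_not_normal[OF split triv_act[OF act] False]
      by (simp add: additive_map_zero[OF step_additive(2)])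
  next
    case True
    then obtain t1 s1 where 1: "t1 \<in> T" "s1 \<in> S" "w @ t = t1 @ s1" using split by (rule word_splitE)
    have l: "?l = step_incl act u (Poly_Mapping.single t1 (triv_act act c s1 m))"
      unfolding ind_act_split[OF split triv_act[OF act] 1] ..
    have second: "ind_act N T S act c w (Poly_Mapping.single t (act 1 u m)) =
        Poly_Mapping.single t1 (act c (s1 @ u) m)"
      unfolding ind_act_split[OF split act 1] using A(5)[OF tm(2)] by simp
    show ?thesis
    proof (cases "s1 = []")
      case True
      have e: "w @ (t @ u) = (t1 @ u) @ []" using 1 True by (metis append.assoc append_Nil2)
      have "?l = Poly_Mapping.single (t1 @ u) (act c [] m) - Poly_Mapping.single t1 (act 1 u (act c [] m))"
        unfolding l step_single(2) using True by (simp add: triv_act_def)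
      moreover have "act 1 u (act c [] m) = act c (s1 @ u) m" using A(5)[OF tm(2)] True by simp
      ultimately show ?thesis
        unfolding r second ind_act_split[OF split act T_u[OF 1(1)] word_split_Nil[OF split] e] by simp
    next
      case False
      have l0: "?l = 0" unfolding l using False
        by (simp add: triv_act_def additive_map_zero[OF step_additive(2)])
      have e: "w @ (t @ u) = t1 @ (s1 @ u)" using 1 by (metis append.assoc)
      show ?thesis
      proof (cases "s1 @ u \<in> N")
        case True
        then have "s1 @ u \<in> S" using su 1(2) False by blast
        from ind_act_split[OF split act 1(1) this e] show ?thesis unfolding l0 r second by simp
      next
        case False
        then have n: "w @ (t @ u) \<notin> N" unfolding e using normal_factor by blast
        show ?thesis unfolding l0 r second ind_act_not_normal[OF split act n] A(7)[OF tm(2) False] by simp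
      qed
    qed
  qed
qed

text \<open>The homotopy yields injectivity of the first map and puts the kernel of the second into
  its image; \<open>pd_le_cokernel\<close> then applies.\<close>

lemma pd_le_step:
  fixes pr :: "'v \<Rightarrow> 'v \<Rightarrow> 'v" and j :: "(letter list \<Rightarrow>\<^sub>0 'q::ab_group_add) \<Rightarrow> 'v"
  assumes "pairing pr fs sn" and j: "inj j"
    and pd1: "pd_le A k (wmod j (ind_car T C) (ind_act N T S (triv_act act)))"
    and pd2: "pd_le A k (wmod j (ind_car T C) (ind_act N T S act))"
  shows "pd_le A (Suc k) (wmod j (ind_car T' C) (ind_act N T' S' act))"
proof -
  interpret pairing pr fs sn by fact
  note E = word_action_ind[OF split act] and E\<epsilon> = word_action_ind[OF split triv_act[OF act]]
    and E' = word_action_ind[OF split' act]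
  let ?D = "step_incl act u" and ?p = "step_proj T' S' act" and ?s = "step_htpy T' S' act u"
  note cl = step_closed and ad = step_additive
  let ?L = "ind_car T C" and ?L' = "ind_car T' C"
  have D: "(\<lambda>v. j (?D (inv_into UNIV j v))) \<in> left_module_hom A
      (wmod j ?L (ind_act N T S (triv_act act))) (wmod j ?L (ind_act N T S act))"
  proof (rule wmod_hom_wmod[OF j E\<epsilon> j E ad(2)])
    fix p c w assume "p \<in> ?L"
    then show "?D p \<in> ?L" "?D (ind_act N T S (triv_act act) c w p) = ind_act N T S act c w (?D p)"
      by (rule cl(2), rule step_incl_act)
  qed
  have p: "(\<lambda>v. j (?p (inv_into UNIV j v))) \<in> left_module_hom A
      (wmod j ?L (ind_act N T S act)) (wmod j ?L' (ind_act N T' S' act))"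
  proof (rule wmod_hom_wmod[OF j E j E' ad(1)])
    fix p c w assume "p \<in> ?L"
    then show "?p p \<in> ?L'" "?p (ind_act N T S act c w p) = ind_act N T' S' act c w (?p p)"
      by (rule cl(1), rule step_proj_act)
  qed
  show ?thesis
  proof (rule pd_le_cokernel[OF pd1 pd2 left_module_wmod[OF j E'] D _ p])
    show "inj_on (\<lambda>v. j (?D (inv_into UNIV j v))) (carrier (wmod j ?L (ind_act N T S (triv_act act))))"
    proof (rule inj_onI)
      fix v w assume "v \<in> carrier (wmod j ?L (ind_act N T S (triv_act act)))"
        "w \<in> carrier (wmod j ?L (ind_act N T S (triv_act act)))"
        and e: "j (?D (inv_into UNIV j v)) = j (?D (inv_into UNIV j w))"
      then obtain a b where ab: "v = j a" "w = j b" "a \<in> ?L" "b \<in> ?L" by (auto simp: wmod_simps)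
      then have "?D a = ?D b" using e j by (simp add: inj_eq)
      then have "?s (?D a) = ?s (?D b)" by (rule arg_cong)
      then have "a = b" unfolding step_htpy_incl[OF ab(3)] step_htpy_incl[OF ab(4)] .
      then show "v = w" unfolding ab(1,2) by (rule arg_cong)
    qed
    show "(\<lambda>v. j (?p (inv_into UNIV j v))) ` carrier (wmod j ?L (ind_act N T S act)) =
        carrier (wmod j ?L' (ind_act N T' S' act))"
    proof -
      have "?p ` ?L = ?L'"
      proof (intro equalityI subsetI)
        fix q assume q: "q \<in> ?L'"
        then have "q \<in> ?L" using ind_car_T'_sub by blast
        then show "q \<in> ?p ` ?L" using step_proj_id[OF q] by (metis image_eqI)
      qed (use cl(1) in blast)
      then have "j ` ?p ` ?L = j ` ?L'" by (rule arg_cong)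
      then show ?thesis unfolding wmod_simps image_image inv_f_f[OF j] .
    qed
    show "(\<lambda>v. j (?D (inv_into UNIV j v))) ` carrier (wmod j ?L (ind_act N T S (triv_act act))) =
        {v \<in> carrier (wmod j ?L (ind_act N T S act)).
          j (?p (inv_into UNIV j v)) = \<zero>\<^bsub>wmod j ?L' (ind_act N T' S' act)\<^esub>}"
    proof -
      have "?D ` ?L = {q \<in> ?L. ?p q = 0}"
      proof (intro equalityI subsetI)
        fix q assume q: "q \<in> {q \<in> ?L. ?p q = 0}"
        then have "q = ?D (?s q)" using step_incl_htpy[of q] by simp
        then show "q \<in> ?D ` ?L" using cl(3) q by blast
      qed (use cl(2) step_proj_incl in auto)
      then have "j ` ?D ` ?L = j ` {q \<in> ?L. ?p q = 0}" by (rule arg_cong)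
      moreover have "j ` {q \<in> ?L. ?p q = 0} = {v \<in> j ` ?L. j (?p (inv_into UNIV j v)) = j 0}"
      proof (intro equalityI subsetI)
        fix v assume "v \<in> {v \<in> j ` ?L. j (?p (inv_into UNIV j v)) = j 0}"
        then obtain q where q: "q \<in> ?L" "v = j q" "j (?p q) = j 0" using inv_f_f[OF j] by auto
        then show "v \<in> j ` {q \<in> ?L. ?p q = 0}" using injD[OF j q(3)] by blast
      qed (use inv_f_f[OF j] in auto)
      ultimately show ?thesis unfolding wmod_simps image_image inv_f_f[OF j] by (rule trans)
    qed
  qed
qed

end

end


section \<open>Bounds for the projective dimension\<close>

lemma ind_car_supp_induct [consumes 1, case_names zero single add]:
  fixes p :: "letter list \<Rightarrow>\<^sub>0 ('i \<Rightarrow>\<^sub>0 'k::ab_group_add)"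
  assumes p: "p \<in> ind_car T (supp_in B)" and 0: "P 0"
    and s: "\<And>t x c. t \<in> T \<Longrightarrow> x \<in> B \<Longrightarrow> P (Poly_Mapping.single t (Poly_Mapping.single x c))"
    and add: "\<And>p q. P p \<Longrightarrow> P q \<Longrightarrow> P (p + q)"
  shows "P p"
proof (rule poly_mapping_add_induct[where p = p])
  show "P 0" by (rule 0)
  show "P (p + q)" if "P p" "P q" for p q using that by (rule add)
  fix t assume "t \<in> keys p"
  then have t: "t \<in> T" "keys (lookup p t) \<subseteq> B" using ind_car_lookup[OF p, of t] by auto
  show "P (Poly_Mapping.single t (lookup p t))"
  proof (rule poly_mapping_add_induct[where p = "lookup p t" and P = "\<lambda>m. P (Poly_Mapping.single t m)"])
    show "P (Poly_Mapping.single t 0)" using 0 by simp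
    show "P (Poly_Mapping.single t (m + m'))"
      if "P (Poly_Mapping.single t m)" "P (Poly_Mapping.single t m')" for m m'
      unfolding single_add using that by (rule add)
    fix x assume "x \<in> keys (lookup p t)"
    then have "x \<in> B" using t by blast
    then show "P (Poly_Mapping.single t (Poly_Mapping.single x (lookup (lookup p t) x)))"
      using t(1) by (intro s)
  qed
qed

lemma single_single_in_ind_car:
  fixes c :: "'k::ab_group_add"
  shows "t \<in> T \<Longrightarrow> x \<in> B \<Longrightarrow> Poly_Mapping.single t (Poly_Mapping.single x c) \<in> ind_car T (supp_in B)"
  by (rule single_in_ind_car[OF add_closed_supp_in]) auto

lemma word_action_subset:
  assumes "word_action N C act" "D \<subseteq> C" "add_closed D" "\<And>c w a. a \<in> D \<Longrightarrow> act c w a \<in> D"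
  shows "word_action N D act"
  using assms unfolding word_action_def by blast

context word_algebra
begin

text \<open>The two ends of the filtration: the subalgebra is the ground field or the whole
  algebra.\<close>

lemma word_split_trivial: "word_split N N {[]}" "word_split N {[]} N"
  using Nil_normal by (auto simp: word_split_def)

text \<open>Induction from the ground field gives a free module. That the empty word acts by scaling
  makes \<open>B\<close> a set of free generators.\<close>

lemma projective_wmod_free:
  fixes j :: "(letter list \<Rightarrow>\<^sub>0 ('i \<Rightarrow>\<^sub>0 'k)) \<Rightarrow> 'v"
  assumes j: "inj j" and act: "word_action N (supp_in B) act"
    and scal: "\<And>c p. keys p \<subseteq> B \<Longrightarrow> act c [] p = pm_scale c p"
  shows "projective_module A (wmod j (ind_car N (supp_in B)) (ind_act N N {[]} act))"
proof (rule projective_moduleI)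
  let ?C = "ind_car N (supp_in B :: ('i \<Rightarrow>\<^sub>0 'k) set)" and ?E = "ind_act N N {[]} act"
  let ?P = "wmod j ?C ?E"
  note E = word_action_ind[OF word_split_trivial(1) act]
  note EA = word_actionD[OF E]
  note addE = ind_act_additive[OF word_split_trivial(1) act]
  have C: "add_closed ?C" by (rule EA(1))
  show "left_module A ?P" by (rule left_module_wmod[OF j E])
  fix M1 M2 :: "('a, 'v) module" and g f
  assume M1: "left_module A M1" and M2: "left_module A M2" and g: "g \<in> left_module_hom A M1 M2"
    and gs: "g ` carrier M1 = carrier M2" and f: "f \<in> left_module_hom A ?P M2"
  interpret M1: left_module A M1 by fact
  interpret M2: left_module A M2 by fact
  obtain B1 and act1 :: "'k \<Rightarrow> letter list \<Rightarrow> ('v \<Rightarrow>\<^sub>0 'k) \<Rightarrow> ('v \<Rightarrow>\<^sub>0 'k)" where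
    act1: "word_action N (supp_in B1) act1"
    and bij: "bij_betw (comb M1) (supp_in B1) (carrier M1)"
    and comb1: "\<And>c w p. keys p \<subseteq> B1 \<Longrightarrow> comb M1 (act1 c w p) = \<Phi> (Poly_Mapping.single w c) \<odot>\<^bsub>M1\<^esub> comb M1 p"
    using module_representation[OF M1] by metis
  note A1 = word_actionD[OF act1]
  define gen where "gen x = (Poly_Mapping.single [] (Poly_Mapping.single x 1) :: letter list \<Rightarrow>\<^sub>0 ('i \<Rightarrow>\<^sub>0 'k))" for x
  have gen: "gen x \<in> ?C" if "x \<in> B" for x
    unfolding gen_def using that Nil_normal by (rule single_single_in_ind_car[rotated])
  have "\<forall>x\<in>B. \<exists>q. keys q \<subseteq> B1 \<and> g (comb M1 q) = f (j (gen x))"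
  proof
    fix x assume "x \<in> B"
    then have "j (gen x) \<in> carrier ?P" using gen by (simp add: wmod_simps)
    then have "f (j (gen x)) \<in> g ` carrier M1" using left_module_hom_closed[OF f] gs by simp
    then obtain m where m: "m \<in> carrier M1" "f (j (gen x)) = g m" by blast
    then obtain q where "q \<in> supp_in B1" "m = comb M1 q" using bij unfolding bij_betw_def by blast
    then show "\<exists>q. keys q \<subseteq> B1 \<and> g (comb M1 q) = f (j (gen x))" using m by auto
  qed
  then obtain n where n: "\<And>x. x \<in> B \<Longrightarrow> keys (n x) \<subseteq> B1" "\<And>x. x \<in> B \<Longrightarrow> g (comb M1 (n x)) = f (j (gen x))"
    by metis
  \<comment> \<open>The lift is determined by preimages \<open>n x\<close> of the generators:
    \<open>t\<close> \<otimes> \<open>x\<close> goes to \<open>t\<close> applied to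
    \<open>n x\<close>.\<close>
  define H where "H = pm_sum (\<lambda>t. pm_sum (\<lambda>x c. act1 c t (n x)))"
  have inner: "additive_map (pm_sum (\<lambda>x c. act1 c t (n x)))" for t
    by (rule pm_sum_additive) (rule A1)
  have H: "additive_map H" unfolding H_def by (rule pm_sum_additive) (rule inner)
  have Hs: "H (Poly_Mapping.single t (Poly_Mapping.single x c)) = act1 c t (n x)" for t x c
  proof -
    have "H (Poly_Mapping.single t (Poly_Mapping.single x c)) = pm_sum (\<lambda>x c. act1 c t (n x)) (Poly_Mapping.single x c)"
      unfolding H_def by (rule pm_sum_single) (rule inner)
    also have "\<dots> = act1 c t (n x)" by (rule pm_sum_single) (rule A1)
    finally show ?thesis .
  qed
  have HE: "p \<in> ?C \<and> keys (H p) \<subseteq> B1 \<and> (\<forall>c w. H (?E c w p) = act1 c w (H p)) \<and> g (comb M1 (H p)) = f (j p)"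
    if "p \<in> ?C" for p
    using that
  proof (induction p rule: ind_car_supp_induct)
    case zero
    have 0: "0 \<in> ?C" using C by (simp add: add_closed_def)
    have z: "H 0 = 0" "?E c w 0 = 0" "act1 c w 0 = 0" for c w
      using additive_map_zero[OF H] additive_map_zero[OF addE] additive_map_zero[OF A1(2)] by auto
    have "f (j 0) = \<zero>\<^bsub>M2\<^esub>"
      using left_module_hom_zero[OF f left_module_wmod[OF j E] M2] by (simp add: wmod_simps)
    moreover have "g (comb M1 0) = \<zero>\<^bsub>M2\<^esub>"
      using left_module_hom_zero[OF g M1 M2] by (simp add: comb_zero[OF M1])
    ultimately show ?case using 0 z by simp
  next
    case (single t x c)
    have tx: "Poly_Mapping.single t (Poly_Mapping.single x c) \<in> ?C" using single by (rule single_single_in_ind_car)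
    have x: "Poly_Mapping.single x d \<in> (supp_in B :: ('i \<Rightarrow>\<^sub>0 'k) set)" for d using single by simp
    have nx: "n x \<in> supp_in B1" using n(1)[OF single(2)] by simp
    have Es: "?E d w (Poly_Mapping.single s (Poly_Mapping.single x e)) =
        Poly_Mapping.single (w @ s) (Poly_Mapping.single x (d * e))" if "w @ s \<in> N" for d w s e
    proof -
      have "?E d w (Poly_Mapping.single s (Poly_Mapping.single x e)) =
          Poly_Mapping.single (w @ s) (act d [] (Poly_Mapping.single x e))"
        by (rule ind_act_split[OF word_split_trivial(1) act that]) simp_all
      then show ?thesis using scal[of "Poly_Mapping.single x e" d] x by simp
    qed
    have "H (?E d w (Poly_Mapping.single t (Poly_Mapping.single x c))) = act1 d w (H (Poly_Mapping.single t (Poly_Mapping.single x c)))" for d w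
    proof (cases "w @ t \<in> N")
      case True
      show ?thesis unfolding Es[OF True] Hs using A1(5)[OF nx] by simp
    next
      case False
      show ?thesis unfolding ind_act_not_normal[OF word_split_trivial(1) act False] Hs additive_map_zero[OF H]
        using A1(5,7)[OF nx] False by simp
    qed
    moreover have "g (comb M1 (act1 c t (n x))) = f (j (Poly_Mapping.single t (Poly_Mapping.single x c)))"
    proof -
      have cx: "comb M1 (n x) \<in> carrier M1" by (rule comb_closed[OF M1])
      have jg: "j (gen x) \<in> carrier ?P" using gen[OF single(2)] by (simp add: wmod_simps)
      have "g (comb M1 (act1 c t (n x))) = \<Phi> (Poly_Mapping.single t c) \<odot>\<^bsub>M2\<^esub> f (j (gen x))"
        unfolding comb1[OF n(1)[OF single(2)]] left_module_hom_smult[OF g Phi_closed cx] n(2)[OF single(2)] ..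
      also have "\<dots> = f (\<Phi> (Poly_Mapping.single t c) \<odot>\<^bsub>?P\<^esub> j (gen x))"
        unfolding left_module_hom_smult[OF f Phi_closed jg] ..
      also have "\<Phi> (Poly_Mapping.single t c) \<odot>\<^bsub>?P\<^esub> j (gen x) = j (?E c t (gen x))"
        unfolding wmod_smult[OF j E gen[OF single(2)]] poly_act_single[OF E] ..
      also have "?E c t (gen x) = Poly_Mapping.single t (Poly_Mapping.single x c)"
        unfolding gen_def using Es[of t "[]" c 1] single(1) by simp
      finally show ?thesis .
    qed
    moreover have "keys (act1 c t (n x)) \<subseteq> B1" using A1(4)[OF nx] by simp
    ultimately show ?case using tx unfolding Hs by blast
  next
    case (add p q)
    then have p: "p \<in> ?C" "q \<in> ?C" by simp_all
    have "keys (H p) \<subseteq> B1" "keys (H q) \<subseteq> B1" using add by simp_all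
    then have k: "keys (H p + H q) \<subseteq> B1" using keys_add[of "H p" "H q"] by blast
    have "g (comb M1 (H p + H q)) = g (comb M1 (H p)) \<oplus>\<^bsub>M2\<^esub> g (comb M1 (H q))"
      unfolding comb_add[OF M1] by (rule left_module_hom_add[OF g comb_closed[OF M1] comb_closed[OF M1]])
    also have "\<dots> = f (j p) \<oplus>\<^bsub>M2\<^esub> f (j q)" using add by simp
    also have "\<dots> = f (j p \<oplus>\<^bsub>?P\<^esub> j q)"
      by (rule left_module_hom_add[OF f, symmetric]) (use p in \<open>simp_all add: wmod_simps\<close>)
    also have "\<dots> = f (j (p + q))" unfolding wmod_add[OF j] ..
    finally have "g (comb M1 (H p + H q)) = f (j (p + q))" .
    moreover have "p + q \<in> ?C" using C p unfolding add_closed_def by blast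
    moreover have "H (?E c w (p + q)) = act1 c w (H p + H q)" for c w
      using add by (simp add: additive_map_add[OF addE] additive_map_add[OF H] additive_map_add[OF A1(2)])
    ultimately show ?case using k by (simp add: additive_map_add[OF H])
  qed
  have "(\<lambda>v. comb M1 (H (inv_into UNIV j v))) \<in> left_module_hom A ?P M1"
  proof (rule wmod_homI[OF j E M1])
    show "comb M1 (H a) \<in> carrier M1" for a by (rule comb_closed[OF M1])
    show "comb M1 (H (a + b)) = comb M1 (H a) \<oplus>\<^bsub>M1\<^esub> comb M1 (H b)" for a b
      unfolding additive_map_add[OF H] by (rule comb_add[OF M1])
    show "comb M1 (H (?E c w a)) = \<Phi> (Poly_Mapping.single w c) \<odot>\<^bsub>M1\<^esub> comb M1 (H a)" if "a \<in> ?C" for c w a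
      using HE[OF that] comb1 by simp
  qed
  moreover have "g (comb M1 (H (inv_into UNIV j v))) = f v" if v: "v \<in> carrier ?P" for v
  proof -
    obtain p where p: "p \<in> ?C" "v = j p" using v unfolding wmod_simps by blast
    then show ?thesis using HE[OF p(1)] inv_f_f[OF j] by simp
  qed
  ultimately show "\<exists>h\<in>left_module_hom A ?P M1. \<forall>v\<in>carrier ?P. g (h v) = f v"
    by (intro bexI[of _ "\<lambda>v. comb M1 (H (inv_into UNIV j v))"] ballI)
qed

theorem pd_le_filtration:
  fixes M :: "('a, 'v) module" and j :: "(letter list \<Rightarrow>\<^sub>0 ('v \<Rightarrow>\<^sub>0 'k)) \<Rightarrow> 'v"
    and pr :: "'v \<Rightarrow> 'v \<Rightarrow> 'v" and T S :: "nat \<Rightarrow> letter list set"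
  assumes pr: "pairing pr fs sn" and j: "inj j" and M: "left_module A M"
    and split: "\<And>k. k \<le> n \<Longrightarrow> word_split N (T k) (S k)"
    and T0: "T 0 = N" and S0: "S 0 = {[]}" and Tn: "T n = {[]}" and Sn: "S n = N"
    and T: "\<And>k. k < n \<Longrightarrow> T k = {t @ concat (replicate i (u k)) | t i. t \<in> T (Suc k)}"
    and S: "\<And>k. k < n \<Longrightarrow> S k \<subseteq> S (Suc k)"
    and pw: "\<And>k i. k < n \<Longrightarrow> concat (replicate i (u k)) \<in> S (Suc k)"
    and u: "\<And>k. k < n \<Longrightarrow> u k \<noteq> []"
    and su: "\<And>k s. k < n \<Longrightarrow> s \<in> S k \<Longrightarrow> s \<noteq> [] \<Longrightarrow> s @ u k \<in> N \<Longrightarrow> s @ u k \<in> S k"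
  shows "pd_le A n M"
proof -
  interpret M: left_module A M by fact
  obtain B and act :: "'k \<Rightarrow> letter list \<Rightarrow> ('v \<Rightarrow>\<^sub>0 'k) \<Rightarrow> ('v \<Rightarrow>\<^sub>0 'k)" where
    act: "word_action N (supp_in B) act" and scal: "\<And>c p. keys p \<subseteq> B \<Longrightarrow> act c [] p = pm_scale c p"
    and bij: "bij_betw (comb M) (supp_in B) (carrier M)"
    and comb: "\<And>c w p. keys p \<subseteq> B \<Longrightarrow> comb M (act c w p) = \<Phi> (Poly_Mapping.single w c) \<odot>\<^bsub>M\<^esub> comb M p"
    by (rule module_representation[OF M], rule that, assumption, simp, assumption, simp)
  \<comment> \<open>The action varies in the induction, because the step uses the hypothesis both
    for \<open>act\<close> and for its twisted version, on the same coefficients.\<close>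
  have main: "pd_le A k (wmod j (ind_car (T k) (supp_in B)) (ind_act N (T k) (S k) act))"
    if "k \<le> n" "word_action N (supp_in B) act" "\<And>c p. keys p \<subseteq> B \<Longrightarrow> act c [] p = pm_scale c p" for k and
      act :: "'k \<Rightarrow> letter list \<Rightarrow> ('v \<Rightarrow>\<^sub>0 'k) \<Rightarrow> ('v \<Rightarrow>\<^sub>0 'k)"
    using that
  proof (induction k arbitrary: act)
    case 0
    have "projective_module A (wmod j (ind_car N (supp_in B)) (ind_act N N {[]} act))"
    proof (rule projective_wmod_free[OF j 0(2)])
      show "act c [] p = pm_scale c p" if "keys p \<subseteq> B" for c p using that by (rule 0(3))
    qed
    then show ?case unfolding T0 S0 pd_le.simps(1) .
  next
    case (Suc k)
    have k: "k < n" "k \<le> n" using Suc.prems(1) by simp_all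
    note act = Suc.prems(2)
    have triv: "triv_act act c [] p = pm_scale c p" if "keys p \<subseteq> B" for c p
      using Suc.prems(3)[OF that] by (simp add: triv_act_def)
    show ?case
    proof (rule pd_le_step[where T = "T k" and S = "S k" and T' = "T (Suc k)" and S' = "S (Suc k)"
          and u = "u k" and pr = pr and fs = fs and sn = sn])
      show "word_split N (T k) (S k)" by (rule split[OF k(2)])
      show "word_split N (T (Suc k)) (S (Suc k))" by (rule split[OF Suc.prems(1)])
      show "T k = {t @ concat (replicate i (u k)) | t i. t \<in> T (Suc k)}" by (rule T[OF k(1)])
      show "S k \<subseteq> S (Suc k)" by (rule S[OF k(1)])
      show "concat (replicate i (u k)) \<in> S (Suc k)" for i by (rule pw[OF k(1)])
      show "u k \<noteq> []" by (rule u[OF k(1)])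
      show "s @ u k \<in> S k" if "s \<in> S k" "s \<noteq> []" "s @ u k \<in> N" for s
        using that by (rule su[OF k(1)])
      show "word_action N (supp_in B) act" by (rule act)
      show "pairing pr fs sn" by (rule pr)
      show "inj j" by (rule j)
      show "pd_le A k (wmod j (ind_car (T k) (supp_in B)) (ind_act N (T k) (S k) (triv_act act)))"
        using triv by (intro Suc.IH[OF k(2) triv_act[OF act]])
      show "pd_le A k (wmod j (ind_car (T k) (supp_in B)) (ind_act N (T k) (S k) act))"
        using Suc.prems(3) by (intro Suc.IH[OF k(2) act])
    qed
  qed
  \<comment> \<open>At the top, the induced module is a single copy of the coefficients with the
    original action, hence isomorphic to \<open>M\<close>.\<close>
  let ?E = "ind_act N {[]} N act" and ?C = "ind_car {[]} (supp_in B :: ('v \<Rightarrow>\<^sub>0 'k) set)"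
  note E = word_action_ind[OF word_split_trivial(2) act]
  have pd: "pd_le A n (wmod j ?C ?E)"
    using main[OF order_refl act scal] unfolding Tn Sn .
  have Csingle: "p = Poly_Mapping.single [] (lookup p [])" if "p \<in> ?C" for p
  proof (rule poly_mapping_eqI)
    fix t
    have "lookup p t = 0" if "t \<noteq> []"
      using \<open>p \<in> ?C\<close> that unfolding ind_car_def by (auto simp: not_in_keys_iff_lookup_eq_zero[symmetric])
    then show "lookup p t = lookup (Poly_Mapping.single [] (lookup p [])) t"
      by (simp add: lookup_single when_def)
  qed
  let ?h = "\<lambda>p. comb M (lookup p [])"
  have "(\<lambda>v. ?h (inv_into UNIV j v)) \<in> left_module_hom A (wmod j ?C ?E) M"
  proof (rule wmod_homI[where h = ?h, OF j E M])
    show "?h a \<in> carrier M" for a by (rule comb_closed[OF M])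
    show "?h (a + b) = ?h a \<oplus>\<^bsub>M\<^esub> ?h b" for a b unfolding lookup_add by (rule comb_add[OF M])
    fix c w a assume a: "a \<in> ?C"
    then have la: "keys (lookup a []) \<subseteq> B" by (simp add: ind_car_def)
    have "lookup (?E c w a) [] = act c w (lookup a [])"
    proof (cases "w \<in> N")
      case True
      have "?E c w (Poly_Mapping.single [] (lookup a [])) = Poly_Mapping.single [] (act c w (lookup a []))"
        by (rule ind_act_split[OF word_split_trivial(2) act]) (use True in simp_all)
      then show ?thesis using Csingle[OF a] by (metis lookup_single_eq)
    next
      case False
      then show ?thesis using word_actionD(7)[OF E a False] word_actionD(7)[OF act _ False, of "lookup a []"] la by simp
    qed
    then show "?h (?E c w a) = \<Phi> (Poly_Mapping.single w c) \<odot>\<^bsub>M\<^esub> ?h a"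
      using comb[OF la] by simp
  qed
  moreover have "bij_betw (\<lambda>v. ?h (inv_into UNIV j v)) (carrier (wmod j ?C ?E)) (carrier M)"
  proof -
    have "bij_betw (\<lambda>p. lookup p []) ?C (supp_in B)"
    proof (rule bij_betw_imageI)
      show "inj_on (\<lambda>p. lookup p []) ?C" by (rule inj_onI) (metis Csingle)
      show "(\<lambda>p. lookup p []) ` ?C = supp_in B"
      proof (intro equalityI subsetI)
        fix m :: "'v \<Rightarrow>\<^sub>0 'k" assume m: "m \<in> supp_in B"
        have "Poly_Mapping.single [] m \<in> ?C"
          by (rule single_in_ind_car[OF add_closed_supp_in _ m]) simp
        then show "m \<in> (\<lambda>p. lookup p []) ` ?C" by (metis image_eqI lookup_single_eq)
      qed (auto simp: ind_car_def)
    qed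
    from bij_betw_trans[OF this bij] have 1: "bij_betw ?h ?C (carrier M)" unfolding comp_def .
    have 2: "bij_betw (inv_into UNIV j) (j ` ?C) ?C"
      using inv_f_f[OF j] by (intro bij_betw_byWitness[where f' = j]) auto
    show ?thesis unfolding wmod_simps using bij_betw_trans[OF 2 1] unfolding comp_def .
  qed
  ultimately show ?thesis by (rule pd_le_iso[OF pd _ _ M])
qed


subsection \<open>Lower bound\<close>

text \<open>\<open>L a\<close> is a basis of the left ideal \<open>A a\<close>, and \<open>Ann a\<close> one of the left annihilator of \<open>a\<close>.\<close>

definition L :: "letter list \<Rightarrow> letter list set" where "L a = {t @ a | t. t @ a \<in> N}"
definition Ann :: "letter list \<Rightarrow> letter list set" where "Ann a = {t \<in> N. t @ a \<notin> N}"
definition left_closed :: "letter list set \<Rightarrow> bool" where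
  "left_closed Z \<longleftrightarrow> Z \<subseteq> N \<and> (\<forall>t\<in>Z. \<forall>w. w @ t \<in> N \<longrightarrow> w @ t \<in> Z)"

definition unit_act :: "'k \<Rightarrow> letter list \<Rightarrow> ('i \<Rightarrow>\<^sub>0 'k) \<Rightarrow> ('i \<Rightarrow>\<^sub>0 'k)" where
  "unit_act c w m = (if w = [] then pm_scale c m else 0)"

text \<open>The regular left action of the algebra on itself, with vector coefficients so that
  induction from the ground field supplies the axioms.\<close>

definition mono_act :: "'k \<Rightarrow> letter list \<Rightarrow> (letter list \<Rightarrow>\<^sub>0 ('i \<Rightarrow>\<^sub>0 'k)) \<Rightarrow> (letter list \<Rightarrow>\<^sub>0 ('i \<Rightarrow>\<^sub>0 'k))" where
  "mono_act = ind_act N N {[]} unit_act"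

lemma left_closed_L: "left_closed (L a)"
proof -
  have "t @ a \<in> N \<Longrightarrow> t @ a \<in> L a" for t unfolding L_def by blast
  moreover have "w @ t @ a = (w @ t) @ a" for w t by simp
  ultimately have "w @ t @ a \<in> N \<Longrightarrow> w @ t @ a \<in> L a" for w t by metis
  then show ?thesis unfolding left_closed_def by (auto simp: L_def[of a])
qed

lemma left_closed_Ann: "left_closed (Ann a)"
proof -
  have "(w @ t) @ a \<notin> N" if "t @ a \<notin> N" for w t
    using that normal_factor[of w "t @ a"] by auto
  then show ?thesis unfolding left_closed_def Ann_def by simp
qed

lemma left_closed_N: "left_closed N"
  by (simp add: left_closed_def)

lemma pm_scale_simps:
  "pm_scale c (pm_scale d p) = pm_scale (c * d) p" "pm_scale 1 p = p"
  "pm_scale (c + d) p = pm_scale c p + pm_scale d p" "pm_scale c 0 = 0"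
  by (rule poly_mapping_eqI, simp add: mult.assoc) (rule poly_mapping_eqI, simp,
    rule poly_mapping_eqI, simp add: lookup_add distrib_right, rule poly_mapping_eqI, simp)

lemma word_action_unit: "word_action N (supp_in B :: ('i \<Rightarrow>\<^sub>0 'k) set) unit_act"
  unfolding word_action_def
proof (intro conjI allI ballI impI)
  show "add_closed (supp_in B :: ('i \<Rightarrow>\<^sub>0 'k) set)" by (rule add_closed_supp_in)
  fix c d :: 'k and v w
  show "additive_map (unit_act c w :: ('i \<Rightarrow>\<^sub>0 'k) \<Rightarrow> _)"
    unfolding additive_map_def unit_act_def by (simp add: pm_scale_add)
  fix a :: "'i \<Rightarrow>\<^sub>0 'k"
  show "additive_map (\<lambda>c. unit_act c w a)"
    unfolding additive_map_def unit_act_def by (simp add: pm_scale_simps(3))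
  show "unit_act c v (unit_act d w a) = unit_act (c * d) (v @ w) a"
    unfolding unit_act_def by (simp add: pm_scale_simps(1,4))
  show "unit_act 1 [] a = a" unfolding unit_act_def by (simp add: pm_scale_simps(2))
  show "unit_act c w a = 0" if "w \<notin> N"
    using that Nil_normal unfolding unit_act_def by auto
  show "unit_act c w a \<in> supp_in B" if "a \<in> supp_in B"
    using that order_trans[OF keys_pm_scale[of c a]] by (simp add: unit_act_def)
qed

lemma mono_act_additive: "additive_map (mono_act c w)"
  unfolding mono_act_def by (rule ind_act_additive[OF word_split_trivial(1) word_action_unit])

lemma mono_act_single:
  "mono_act c w (Poly_Mapping.single t m) = (if w @ t \<in> N then Poly_Mapping.single (w @ t) (pm_scale c m) else 0)"
proof (cases "w @ t \<in> N")
  case True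
  have "mono_act c w (Poly_Mapping.single t m) = Poly_Mapping.single (w @ t) (unit_act c [] m)"
    unfolding mono_act_def by (rule ind_act_split[OF word_split_trivial(1) word_action_unit True]) simp_all
  then show ?thesis using True by (simp add: unit_act_def)
next
  case False
  then show ?thesis unfolding mono_act_def ind_act_not_normal[OF word_split_trivial(1) word_action_unit False] by simp
qed

lemma word_action_mono:
  assumes "left_closed Z"
  shows "word_action N (ind_car Z (supp_in B :: ('i \<Rightarrow>\<^sub>0 'k) set)) mono_act"
proof (rule word_action_subset)
  show "word_action N (ind_car N (supp_in B :: ('i \<Rightarrow>\<^sub>0 'k) set)) mono_act"
    unfolding mono_act_def by (rule word_action_ind[OF word_split_trivial(1) word_action_unit])
  show "ind_car Z (supp_in B :: ('i \<Rightarrow>\<^sub>0 'k) set) \<subseteq> ind_car N (supp_in B)"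
    using assms by (auto simp: ind_car_def left_closed_def)
  show c: "add_closed (ind_car Z (supp_in B :: ('i \<Rightarrow>\<^sub>0 'k) set))"
    by (rule add_closed_ind_car[OF add_closed_supp_in])
  show "mono_act c w a \<in> ind_car Z (supp_in B)" if "a \<in> ind_car Z (supp_in B)"
    for c w and a :: "letter list \<Rightarrow>\<^sub>0 ('i \<Rightarrow>\<^sub>0 'k)"
  proof (rule ind_car_closedI[OF that mono_act_additive c])
    fix t and m :: "'i \<Rightarrow>\<^sub>0 'k" assume tm: "t \<in> Z" "m \<in> supp_in B"
    have "pm_scale c m \<in> supp_in B" using tm keys_pm_scale[of c m] by simp
    then show "mono_act c w (Poly_Mapping.single t m) \<in> ind_car Z (supp_in B)"
      unfolding mono_act_single
      using assms tm c single_in_ind_car[OF add_closed_supp_in[of B], of "w @ t" Z "pm_scale c m"]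
      by (auto simp: left_closed_def add_closed_def)
  qed
qed

text \<open>A map of left modules whose image is the left ideal of \<open>a\<close> and whose kernel
  is its left annihilator; in a monomial algebra both have bases of words.\<close>

definition right_mult :: "letter list \<Rightarrow> (letter list \<Rightarrow>\<^sub>0 'q::ab_group_add) \<Rightarrow> (letter list \<Rightarrow>\<^sub>0 'q)" where
  "right_mult a = pm_sum (\<lambda>t m. if t @ a \<in> N then Poly_Mapping.single (t @ a) m else 0)"

definition restr :: "letter list set \<Rightarrow> (letter list \<Rightarrow>\<^sub>0 'q::ab_group_add) \<Rightarrow> (letter list \<Rightarrow>\<^sub>0 'q)" where
  "restr Z = pm_sum (\<lambda>t m. if t \<in> Z then Poly_Mapping.single t m else 0)"

lemma right_mult_additive: "additive_map (right_mult a)"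
  unfolding right_mult_def by (rule pm_sum_additive) (simp add: additive_map_def single_add)

lemma right_mult_single: "right_mult a (Poly_Mapping.single t m) = (if t @ a \<in> N then Poly_Mapping.single (t @ a) m else 0)"
  unfolding right_mult_def by (rule pm_sum_single) (simp add: additive_map_def single_add)

lemma restr_additive: "additive_map (restr Z)"
  unfolding restr_def by (rule pm_sum_additive) (simp add: additive_map_def single_add)

lemma restr_single: "restr Z (Poly_Mapping.single t m) = (if t \<in> Z then Poly_Mapping.single t m else 0)"
  unfolding restr_def by (rule pm_sum_single) (simp add: additive_map_def single_add)

lemma additive_map_lookup: "additive_map (\<lambda>p. lookup p t)"
  by (simp add: additive_map_def lookup_add)

lemma lookup_right_mult:
  fixes p :: "letter list \<Rightarrow>\<^sub>0 'q::ab_group_add"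
  shows "lookup (right_mult a p) (t @ a) = (if t @ a \<in> N then lookup p t else 0)"
proof -
  have "additive_map (\<lambda>p :: letter list \<Rightarrow>\<^sub>0 'q. if t @ a \<in> N then lookup p t else 0)"
    by (simp add: additive_map_def lookup_add)
  from additive_map_eq_on[OF additive_map_comp[OF additive_map_lookup right_mult_additive] this] show ?thesis
    by (auto simp: right_mult_single lookup_single when_def)
qed

lemma right_mult_mono_act:
  "right_mult a (mono_act c w p) = mono_act c w (right_mult a p)"
proof (rule additive_map_eq_on[OF additive_map_comp[OF right_mult_additive mono_act_additive]
      additive_map_comp[OF mono_act_additive right_mult_additive]])
  fix t
  have "w @ t @ a \<in> N \<Longrightarrow> w @ t \<in> N \<and> t @ a \<in> N"
    using normal_factor[of "w @ t" a] normal_factor[of w "t @ a"] by simp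
  then show "right_mult a (mono_act c w (Poly_Mapping.single t (lookup p t))) =
      mono_act c w (right_mult a (Poly_Mapping.single t (lookup p t)))"
    by (auto simp: right_mult_single mono_act_single additive_map_zero[OF mono_act_additive]
        additive_map_zero[OF right_mult_additive])
qed

lemma right_mult_image:
  fixes C :: "'q::ab_group_add set"
  assumes C: "add_closed C"
  shows "right_mult a ` ind_car N C = ind_car (L a) C"
proof (intro equalityI subsetI)
  note car = add_closed_ind_car[OF C]
  fix q assume "q \<in> right_mult a ` ind_car N C"
  then obtain p where p: "p \<in> ind_car N C" "q = right_mult a p" by blast
  show "q \<in> ind_car (L a) C" unfolding p(2)
  proof (rule ind_car_closedI[OF p(1) right_mult_additive car])
    fix t m assume "t \<in> N" "m \<in> C"
    then show "right_mult a (Poly_Mapping.single t m) \<in> ind_car (L a) C"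
      using car[of "L a"] single_in_ind_car[OF C, of "t @ a" "L a" m]
      by (auto simp: right_mult_single L_def add_closed_def)
  qed
next
  note car = add_closed_ind_car[OF C]
  fix q assume q: "q \<in> ind_car (L a) C"
  \<comment> \<open>A preimage arises by removing the suffix \<open>a\<close> from every
    word.\<close>
  define strip where "strip = pm_sum (\<lambda>(s :: letter list) (m :: 'q). Poly_Mapping.single (take (length s - length a) s) m)"
  have add: "additive_map strip"
    unfolding strip_def by (rule pm_sum_additive) (simp add: additive_map_def single_add)
  have st: "strip (Poly_Mapping.single (t @ a) m) = Poly_Mapping.single t m" for t m
  proof -
    have "strip (Poly_Mapping.single (t @ a) m) = Poly_Mapping.single (take (length (t @ a) - length a) (t @ a)) m"
      unfolding strip_def by (rule pm_sum_single) (simp add: additive_map_def single_add)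
    then show ?thesis by simp
  qed
  have "strip q \<in> ind_car N C"
  proof (rule ind_car_closedI[OF q add car])
    fix t m assume "t \<in> L a" and m: "m \<in> C"
    then obtain s where s: "t = s @ a" "s @ a \<in> N" by (auto simp: L_def)
    then have "s \<in> N" using normal_factor by blast
    then show "strip (Poly_Mapping.single t m) \<in> ind_car N C"
      unfolding s(1) st by (rule single_in_ind_car[OF C _ m])
  qed
  moreover have "right_mult a (strip q) = q"
  proof (rule ind_car_eqI[OF q additive_map_comp[OF right_mult_additive add] additive_map_id])
    fix t m assume "t \<in> L a"
    then obtain s where s: "t = s @ a" "s @ a \<in> N" by (auto simp: L_def)
    show "right_mult a (strip (Poly_Mapping.single t m)) = Poly_Mapping.single t m"
      unfolding s(1) st right_mult_single using s(2) by simp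
  qed
  ultimately show "q \<in> right_mult a ` ind_car N C" by (metis image_eqI)
qed

lemma right_mult_kernel: "{p \<in> ind_car N C. right_mult a p = 0} = ind_car (Ann a) C"
proof (intro equalityI subsetI)
  fix p assume p: "p \<in> {p \<in> ind_car N C. right_mult a p = 0}"
  have "t \<in> Ann a" if "t \<in> keys p" for t
  proof -
    have "t \<in> N" using p that by (auto simp: ind_car_def)
    moreover have "t @ a \<notin> N" using lookup_right_mult[of a p t] p that by (auto simp: in_keys_iff)
    ultimately show ?thesis by (simp add: Ann_def)
  qed
  then show "p \<in> ind_car (Ann a) C" using p by (auto simp: ind_car_def)
next
  fix p assume p: "p \<in> ind_car (Ann a) C"
  have "additive_map (\<lambda>_. 0)" by (simp add: additive_map_def)
  from ind_car_eqI[OF p right_mult_additive this] have "right_mult a p = 0"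
    by (simp add: right_mult_single Ann_def)
  moreover have "p \<in> ind_car N C" using p by (auto simp: ind_car_def Ann_def)
  ultimately show "p \<in> {p \<in> ind_car N C. right_mult a p = 0}" by simp
qed

context
  fixes j :: "(letter list \<Rightarrow>\<^sub>0 ('v \<Rightarrow>\<^sub>0 'k)) \<Rightarrow> 'v" and pr :: "'v \<Rightarrow> 'v \<Rightarrow> 'v" and fs sn and x0 :: 'v
  assumes j: "inj j" and pr: "pairing pr fs sn"
begin

interpretation pairing pr fs sn by (rule pr)

abbreviation (input) K0 :: "('v \<Rightarrow>\<^sub>0 'k) set" where "K0 \<equiv> supp_in {x0}"

text \<open>The left ideal with the word basis \<open>Z\<close>. Coefficients supported on the one
  point \<open>x0\<close> are a copy of the field inside the type that \<open>j\<close>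
  encodes.\<close>

definition mono_mod :: "letter list set \<Rightarrow> ('a, 'v) module" where
  "mono_mod Z = wmod j (ind_car Z K0) mono_act"

lemma left_module_mono_mod: "left_closed Z \<Longrightarrow> left_module A (mono_mod Z)"
  unfolding mono_mod_def by (rule left_module_wmod[OF j word_action_mono])

lemma projective_mono_mod_N: "projective_module A (mono_mod N)"
  unfolding mono_mod_def mono_act_def
  by (rule projective_wmod_free[OF j word_action_unit]) (simp add: unit_act_def)

lemma right_mult_hom:
  "(\<lambda>v. j (right_mult a (inv_into UNIV j v))) \<in> left_module_hom A (mono_mod N) (mono_mod (L a))"
  unfolding mono_mod_def
proof (rule wmod_hom_wmod[OF j word_action_mono[OF left_closed_N] j word_action_mono[OF left_closed_L] right_mult_additive])
  fix c w and p :: "letter list \<Rightarrow>\<^sub>0 ('v \<Rightarrow>\<^sub>0 'k)" assume "p \<in> ind_car N K0"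
  then show "right_mult a p \<in> ind_car (L a) K0" using right_mult_image[OF add_closed_supp_in] by blast
  show "right_mult a (mono_act c w p) = mono_act c w (right_mult a p)" by (rule right_mult_mono_act)
qed

lemma right_mult_surj:
  "(\<lambda>v. j (right_mult a (inv_into UNIV j v))) ` carrier (mono_mod N) = carrier (mono_mod (L a))"
proof -
  have "j ` right_mult a ` ind_car N K0 = j ` ind_car (L a) K0"
    unfolding right_mult_image[OF add_closed_supp_in] ..
  then show ?thesis unfolding mono_mod_def wmod_simps image_image inv_f_f[OF j] .
qed

lemma ker_wmod:
  assumes "\<And>p. p \<in> D \<Longrightarrow> p \<in> C \<and> h p = 0" "\<And>p. p \<in> C \<Longrightarrow> h p = 0 \<Longrightarrow> p \<in> D"
  shows "ker_module (wmod j C act) (wmod j C' act') (\<lambda>v. j (h (inv_into UNIV j v))) = wmod j D act"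
proof -
  have "a_kernel (wmod j C act) (wmod j C' act') (\<lambda>v. j (h (inv_into UNIV j v))) =
      {v \<in> j ` C. j (h (inv_into UNIV j v)) = j 0}"
    by (simp add: a_kernel_def' wmod_simps)
  also have "\<dots> = j ` D"
  proof (intro equalityI subsetI)
    fix v assume "v \<in> {v \<in> j ` C. j (h (inv_into UNIV j v)) = j 0}"
    then obtain p where p: "p \<in> C" "v = j p" "j (h p) = j 0" using inv_f_f[OF j] by auto
    then show "v \<in> j ` D" using injD[OF j p(3)] assms(2) by blast
  next
    fix v assume "v \<in> j ` D"
    then obtain p where p: "p \<in> D" "v = j p" by blast
    then show "v \<in> {v \<in> j ` C. j (h (inv_into UNIV j v)) = j 0}"
      using assms(1)[OF p(1)] inv_f_f[OF j] by simp
  qed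
  finally show ?thesis unfolding ker_module_def by (simp only: wmod_restrict)
qed

text \<open>Dimension shifting along right multiplication by \<open>a\<close>, a surjection from the
  free module of rank one.\<close>

lemma pd_le_Ann: "pd_le A (Suc k) (mono_mod (L a)) \<Longrightarrow> pd_le A k (mono_mod (Ann a))"
proof -
  assume "pd_le A (Suc k) (mono_mod (L a))"
  from pd_le_kernel[OF this projective_mono_mod_N right_mult_hom right_mult_surj]
  have "pd_le A k (ker_module (mono_mod N) (mono_mod (L a)) (\<lambda>v. j (right_mult a (inv_into UNIV j v))))" .
  also have "ker_module (mono_mod N) (mono_mod (L a)) (\<lambda>v. j (right_mult a (inv_into UNIV j v))) = mono_mod (Ann a)"
    unfolding mono_mod_def
    by (rule ker_wmod) (use right_mult_kernel[of K0 a] in blast)+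
  finally show ?thesis .
qed

text \<open>By the last hypothesis the words of \<open>Z\<close> outside \<open>L a\<close> also
  span a left ideal, so deleting them is a module retraction onto the ideal of
  \<open>a\<close>.\<close>

lemma pd_le_left_ideal:
  assumes "pd_le A k (mono_mod Z)" "left_closed Z" "L a \<subseteq> Z"
    and "\<And>z w. z \<in> Z \<Longrightarrow> z \<notin> L a \<Longrightarrow> w @ z \<notin> L a"
  shows "pd_le A k (mono_mod (L a))"
proof (rule pd_le_summand[OF assms(1) left_module_mono_mod[OF left_closed_L]])
  show "(\<lambda>v. v) \<in> left_module_hom A (mono_mod (L a)) (mono_mod Z)"
  proof -
    have "(\<lambda>v. j (inv_into UNIV j v)) \<in> left_module_hom A (mono_mod (L a)) (mono_mod Z)"
      unfolding mono_mod_def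
    proof (rule wmod_hom_wmod[OF j word_action_mono[OF left_closed_L] j word_action_mono[OF assms(2)] additive_map_id])
      show "p \<in> ind_car Z K0" if "p \<in> ind_car (L a) K0" for p :: "letter list \<Rightarrow>\<^sub>0 ('v \<Rightarrow>\<^sub>0 'k)"
        using that assms(3) by (auto simp: ind_car_def)
    qed simp
    moreover have "j (inv_into UNIV j v) = v" if "v \<in> carrier (mono_mod (L a))" for v
      using that inv_f_f[OF j] by (auto simp: mono_mod_def wmod_simps)
    moreover have "carrier (mono_mod (L a)) \<subseteq> carrier (mono_mod Z)"
      using assms(3) by (auto simp: mono_mod_def wmod_simps ind_car_def)
    ultimately show ?thesis
      by (intro left_module_homI) (auto simp: mono_mod_def wmod_def)
  qed
  show "(\<lambda>v. j (restr (L a) (inv_into UNIV j v))) \<in> left_module_hom A (mono_mod Z) (mono_mod (L a))"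
    unfolding mono_mod_def
  proof (rule wmod_hom_wmod[OF j word_action_mono[OF assms(2)] j word_action_mono[OF left_closed_L] restr_additive])
    fix p :: "letter list \<Rightarrow>\<^sub>0 ('v \<Rightarrow>\<^sub>0 'k)" assume p: "p \<in> ind_car Z K0"
    show "restr (L a) p \<in> ind_car (L a) K0"
    proof (rule ind_car_closedI[OF p restr_additive])
      show c: "add_closed (ind_car (L a) K0)" by (rule add_closed_ind_car[OF add_closed_supp_in])
      fix t m assume "m \<in> K0"
      then show "restr (L a) (Poly_Mapping.single t m) \<in> ind_car (L a) K0"
        unfolding restr_single using single_in_ind_car[OF add_closed_supp_in, of t "L a" m] c
        by (auto simp: add_closed_def)
    qed
    show "restr (L a) (mono_act c w p) = mono_act c w (restr (L a) p)" for c w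
    proof (rule ind_car_eqI[OF p additive_map_comp[OF restr_additive mono_act_additive]
          additive_map_comp[OF mono_act_additive restr_additive]])
      fix t m assume t: "t \<in> Z"
      have "w @ t \<in> L a" if "t \<in> L a" "w @ t \<in> N"
        using left_closed_L[of a] that by (simp add: left_closed_def)
      then show "restr (L a) (mono_act c w (Poly_Mapping.single t m)) = mono_act c w (restr (L a) (Poly_Mapping.single t m))"
        using assms(4)[OF t] by (auto simp: restr_single mono_act_single additive_map_zero[OF restr_additive]
            additive_map_zero[OF mono_act_additive])
    qed
  qed
  fix v assume "v \<in> carrier (mono_mod (L a))"
  then obtain p where p: "p \<in> ind_car (L a) K0" "v = j p" by (auto simp: mono_mod_def wmod_simps)
  have "restr (L a) p = p"
    by (rule ind_car_eqI[OF p(1) restr_additive additive_map_id]) (simp add: restr_single)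
  then show "j (restr (L a) (inv_into UNIV j v)) = v" using p inv_f_f[OF j] by simp
qed

text \<open>\<open>a\<close> kills \<open>b\<close> but no proper suffix of \<open>a\<close> does. A
  word of the annihilator with a left multiple ending in \<open>a\<close> must therefore itself end
  in \<open>a\<close>, and the ideal of \<open>a\<close> is a summand of the annihilator.\<close>

lemma pd_le_relation:
  assumes "pd_le A (Suc k) (mono_mod (L b))" "a @ b \<notin> N"
    and "\<And>p s. a = p @ s \<Longrightarrow> p \<noteq> [] \<Longrightarrow> s @ b \<in> N"
  shows "pd_le A k (mono_mod (L a))"
proof (rule pd_le_left_ideal[OF pd_le_Ann[OF assms(1)] left_closed_Ann])
  show "L a \<subseteq> Ann b"
  proof
    fix z assume "z \<in> L a"
    then obtain t where t: "z = t @ a" "t @ a \<in> N" by (auto simp: L_def)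
    have "t @ (a @ b) \<notin> N" using assms(2) normal_factor by blast
    then show "z \<in> Ann b" using t by (simp add: Ann_def)
  qed
  fix z w assume z: "z \<in> Ann b" "z \<notin> L a"
  show "w @ z \<notin> L a"
  proof
    assume "w @ z \<in> L a"
    then obtain v where v: "w @ z = v @ a" by (auto simp: L_def)
    then obtain us where us: "w = v @ us \<and> us @ z = a \<or> w @ us = v \<and> z = us @ a"
      unfolding append_eq_append_conv2 by blast
    \<comment> \<open>\<open>z\<close> and \<open>a\<close> are suffixes of the same word, so one of
      them is a suffix of the other.\<close>
    have "(\<exists>p. z = p @ a) \<or> (\<exists>p. a = p @ z \<and> p \<noteq> [])"
    proof (cases "us = []")
      case True
      then have "z = [] @ a" using us by auto
      then show ?thesis by blast
    qed (use us in blast)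
    then consider p where "z = p @ a" | p where "a = p @ z" "p \<noteq> []" by blast
    then show False
    proof cases
      case 1
      then show False using z by (auto simp: L_def Ann_def)
    next
      case (2 p)
      then show False using assms(3)[of p z] z by (simp add: Ann_def)
    qed
  qed
qed

text \<open>A splitting of right multiplication by \<open>b\<close> provides an element e with e b =
  b, so its constant coefficient is one. But a b = 0 forces a e = 0, whose coefficient at the word
  \<open>a\<close> is that same constant.\<close>

lemma not_projective_relation:
  assumes "a @ b \<notin> N" "a \<in> N" "b \<in> N"
  shows "\<not> projective_module A (mono_mod (L b))"
proof
  assume P: "projective_module A (mono_mod (L b))"
  let ?R = "\<lambda>v. j (right_mult b (inv_into UNIV j v))"
  note lmL = left_module_mono_mod[OF left_closed_L[of b]] and lmN = left_module_mono_mod[OF left_closed_N]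
  obtain s where s: "s \<in> left_module_hom A (mono_mod (L b)) (mono_mod N)"
    and id: "\<And>v. v \<in> carrier (mono_mod (L b)) \<Longrightarrow> ?R (s v) = v"
    by (rule projective_module_lift[OF P lmN lmL right_mult_hom right_mult_surj left_module_hom_id],
        rule that, assumption, simp)
  let ?b = "Poly_Mapping.single b (Poly_Mapping.single x0 1) :: letter list \<Rightarrow>\<^sub>0 ('v \<Rightarrow>\<^sub>0 'k)"
  have "b \<in> L b" using assms(3) by (auto simp: L_def intro!: exI[of _ "[]"])
  then have bin: "?b \<in> ind_car (L b) K0" by (intro single_single_in_ind_car) simp_all
  then have jb: "j ?b \<in> carrier (mono_mod (L b))" by (simp add: mono_mod_def wmod_simps)
  from left_module_hom_closed[OF s jb] obtain e where e: "s (j ?b) = j e" "e \<in> ind_car N K0"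
    by (auto simp: mono_mod_def wmod_simps)
  have "j (right_mult b e) = j ?b" using id[OF jb] unfolding e(1) inv_f_f[OF j] .
  then have "right_mult b e = ?b" by (rule injD[OF j])
  then have e1: "lookup e [] = Poly_Mapping.single x0 1"
    using lookup_right_mult[of b e "[]"] assms(3) by simp
  let ?x = "\<Phi> (Poly_Mapping.single a 1)"
  have "?x \<odot>\<^bsub>mono_mod (L b)\<^esub> j ?b = j (mono_act 1 a ?b)"
    unfolding mono_mod_def wmod_smult[OF j word_action_mono[OF left_closed_L] bin]
      poly_act_single[OF word_action_mono[OF left_closed_L]] ..
  also have "\<dots> = \<zero>\<^bsub>mono_mod (L b)\<^esub>"
    unfolding mono_act_single mono_mod_def wmod_simps using assms(1) by simp
  finally have "s (?x \<odot>\<^bsub>mono_mod (L b)\<^esub> j ?b) = \<zero>\<^bsub>mono_mod N\<^esub>"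
    using left_module_hom_zero[OF s lmL lmN] by simp
  moreover have "s (?x \<odot>\<^bsub>mono_mod (L b)\<^esub> j ?b) = ?x \<odot>\<^bsub>mono_mod N\<^esub> j e"
    unfolding left_module_hom_smult[OF s Phi_closed jb] e(1) ..
  moreover have "?x \<odot>\<^bsub>mono_mod N\<^esub> j e = j (mono_act 1 a e)"
    unfolding mono_mod_def wmod_smult[OF j word_action_mono[OF left_closed_N] e(2)]
      poly_act_single[OF word_action_mono[OF left_closed_N]] ..
  ultimately have "j (mono_act 1 a e) = j 0" by (simp add: mono_mod_def wmod_simps)
  then have "mono_act 1 a e = 0" by (rule injD[OF j])
  moreover have "lookup (mono_act 1 a e) a = lookup e []"
  proof (rule additive_map_eq_on[OF additive_map_comp[OF additive_map_lookup mono_act_additive] additive_map_lookup])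
    have "pm_scale 1 m = m" for m :: "'v \<Rightarrow>\<^sub>0 'k" by (rule poly_mapping_eqI) simp
    then show "lookup (mono_act 1 a (Poly_Mapping.single t (lookup e t))) a = lookup (Poly_Mapping.single t (lookup e t)) []" for t
      using assms(2) by (auto simp: mono_act_single lookup_single when_def)
  qed
  ultimately have "Poly_Mapping.single x0 (1 :: 'k) = 0" using e1 by simp
  then show False by (metis lookup_single_eq lookup_zero zero_neq_one)
qed

text \<open>Moving one place down the chain lowers an assumed bound by one, until the ideal of its
  second word would be projective.\<close>

lemma not_pd_le_chain:
  assumes "\<And>i. i < n \<Longrightarrow> c i \<in> N" "\<And>i. Suc i < n \<Longrightarrow> c i @ c (Suc i) \<notin> N"
    and "\<And>i p s. Suc i < n \<Longrightarrow> c i = p @ s \<Longrightarrow> p \<noteq> [] \<Longrightarrow> s @ c (Suc i) \<in> N"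
  shows "Suc i < n \<Longrightarrow> \<not> pd_le A i (mono_mod (L (c (Suc i))))"
proof (induction i)
  case 0
  then show ?case using not_projective_relation[OF assms(2) assms(1) assms(1)] by simp
next
  case (Suc i)
  show ?case
  proof
    assume "pd_le A (Suc i) (mono_mod (L (c (Suc (Suc i)))))"
    then have "pd_le A i (mono_mod (L (c (Suc i))))"
    proof (rule pd_le_relation)
      show "c (Suc i) @ c (Suc (Suc i)) \<notin> N" by (rule assms(2)[OF Suc.prems])
      show "s @ c (Suc (Suc i)) \<in> N" if "c (Suc i) = p @ s" "p \<noteq> []" for p s
        by (rule assms(3)[OF Suc.prems that])
    qed
    then show False using Suc by simp
  qed
qed

section \<open>The trivial module\<close>

definition trivial_mod :: "('a, 'v) module" where
  "trivial_mod = wmod j (ind_car {[]} K0) (triv_act mono_act)"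

lemma word_action_trivial_mod: "word_action N (ind_car {[]} K0) (triv_act mono_act)"
proof (rule word_action_subset[OF triv_act[OF word_action_mono[OF left_closed_N]]])
  show "ind_car {[]} K0 \<subseteq> ind_car N K0" using Nil_normal by (auto simp: ind_car_def)
  show car: "add_closed (ind_car {[]} K0)" by (rule add_closed_ind_car[OF add_closed_supp_in])
  fix c w and p :: "letter list \<Rightarrow>\<^sub>0 ('v \<Rightarrow>\<^sub>0 'k)" assume p: "p \<in> ind_car {[]} K0"
  have "mono_act c [] p \<in> ind_car {[]} K0"
  proof (rule ind_car_closedI[OF p mono_act_additive car])
    fix t :: "letter list" and m :: "'v \<Rightarrow>\<^sub>0 'k" assume "t \<in> {[]}" "m \<in> K0"
    then show "mono_act c [] (Poly_Mapping.single t m) \<in> ind_car {[]} K0"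
      using single_in_ind_car[OF add_closed_supp_in, of "[]" "{[]}" "pm_scale c m" "{x0}"] keys_pm_scale[of c m] Nil_normal
      by (auto simp: mono_act_single)
  qed
  then show "triv_act mono_act c w p \<in> ind_car {[]} K0"
    using car by (simp add: triv_act_def add_closed_def)
qed

lemma left_module_trivial_mod: "left_module A trivial_mod"
  unfolding trivial_mod_def by (rule left_module_wmod[OF j word_action_trivial_mod])

text \<open>The augmentation ideal is the direct sum of the left ideals of the letters, because a
  nonempty word has exactly one last letter; the ideal of \<open>[l]\<close> is thus a
  summand.\<close>

lemma pd_le_trivial_mod:
  assumes "pd_le A (Suc k) trivial_mod" "[l] \<in> N"
  shows "pd_le A k (mono_mod (L [l]))"
proof -
  let ?h = "restr {[]} :: (letter list \<Rightarrow>\<^sub>0 ('v \<Rightarrow>\<^sub>0 'k)) \<Rightarrow> _"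
  note C = add_closed_supp_in
  have hcl: "?h p \<in> ind_car {[]} K0" if p: "p \<in> ind_car N K0" for p
  proof (rule ind_car_closedI[OF p restr_additive])
    show car: "add_closed (ind_car {[]} K0)" by (rule add_closed_ind_car[OF C])
    show "restr {[]} (Poly_Mapping.single t m) \<in> ind_car {[]} K0" if "m \<in> K0" for t m
      unfolding restr_single using single_in_ind_car[OF C _ that, of t "{[]}"] car by (auto simp: add_closed_def)
  qed
  have hid: "?h p = p" if p: "p \<in> ind_car {[]} K0" for p
    by (rule ind_car_eqI[OF p restr_additive additive_map_id]) (simp add: restr_single)
  have hom: "(\<lambda>v. j (?h (inv_into UNIV j v))) \<in> left_module_hom A (mono_mod N) trivial_mod"
    unfolding mono_mod_def trivial_mod_def
  proof (rule wmod_hom_wmod[OF j word_action_mono[OF left_closed_N] j word_action_trivial_mod restr_additive])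
    fix c w p assume p: "p \<in> ind_car N K0"
    show "?h p \<in> ind_car {[]} K0" by (rule hcl[OF p])
    have add: "additive_map (triv_act mono_act c w :: (letter list \<Rightarrow>\<^sub>0 ('v \<Rightarrow>\<^sub>0 'k)) \<Rightarrow> _)"
      by (rule word_actionD(2)[OF word_action_trivial_mod])
    show "?h (mono_act c w p) = triv_act mono_act c w (?h p)"
      by (rule additive_map_eq_on[OF additive_map_comp[OF restr_additive mono_act_additive] additive_map_comp[OF add restr_additive]])
        (auto simp: restr_single mono_act_single triv_act_def additive_map_zero[OF restr_additive]
          additive_map_zero[OF mono_act_additive])
  qed
  have surj: "(\<lambda>v. j (?h (inv_into UNIV j v))) ` carrier (mono_mod N) = carrier trivial_mod"
  proof -
    have "?h ` ind_car N K0 = ind_car {[]} K0"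
    proof (intro equalityI subsetI)
      fix p assume p: "p \<in> ind_car {[]} K0"
      then have "p \<in> ind_car N K0" using Nil_normal by (auto simp: ind_car_def)
      then show "p \<in> ?h ` ind_car N K0" using hid[OF p] by (metis image_eqI)
    qed (use hcl in blast)
    then have "j ` ?h ` ind_car N K0 = j ` ind_car {[]} K0" by (rule arg_cong)
    then show ?thesis unfolding mono_mod_def trivial_mod_def wmod_simps image_image inv_f_f[OF j] .
  qed
  have lr: "lookup (?h p) [] = lookup p []" for p
    by (rule additive_map_eq_on[OF additive_map_comp[OF additive_map_lookup restr_additive] additive_map_lookup])
      (auto simp: restr_single lookup_single when_def)
  have ker: "ker_module (mono_mod N) trivial_mod (\<lambda>v. j (?h (inv_into UNIV j v))) = mono_mod (N - {[]})"
    unfolding mono_mod_def trivial_mod_def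
  proof (rule ker_wmod)
    fix p assume p: "p \<in> ind_car (N - {[]}) K0"
    have "additive_map (\<lambda>_. 0)" by (simp add: additive_map_def)
    from ind_car_eqI[OF p restr_additive this] have "?h p = 0" by (simp add: restr_single)
    then show "p \<in> ind_car N K0 \<and> ?h p = 0" using p by (auto simp: ind_car_def)
  next
    fix p assume p: "p \<in> ind_car N K0" "?h p = 0"
    then have "lookup p [] = 0" using lr[of p] by simp
    then show "p \<in> ind_car (N - {[]}) K0" using p(1) by (auto simp: ind_car_def in_keys_iff)
  qed
  have "pd_le A k (mono_mod (N - {[]}))"
    using pd_le_kernel[OF assms(1) projective_mono_mod_N hom surj] unfolding ker .
  then show ?thesis
  proof (rule pd_le_left_ideal)
    show "left_closed (N - {[]})" by (auto simp: left_closed_def)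
    show "L [l] \<subseteq> N - {[]}" by (auto simp: L_def)
    show "w @ z \<notin> L [l]" if "z \<in> N - {[]}" "z \<notin> L [l]" for z w
    proof (cases z rule: rev_cases)
      case (snoc z' l')
      then have "l' \<noteq> l" using that by (auto simp: L_def)
      then show ?thesis using snoc by (auto simp: L_def)
    qed (use that in simp)
  qed
qed

theorem not_pd_le_trivial_mod:
  assumes "n \<ge> 2" "\<And>i. i < n \<Longrightarrow> c i \<in> N" "\<And>i. Suc i < n \<Longrightarrow> c i @ c (Suc i) \<notin> N"
    and "\<And>i p s. Suc i < n \<Longrightarrow> c i = p @ s \<Longrightarrow> p \<noteq> [] \<Longrightarrow> s @ c (Suc i) \<in> N"
    and "c (n - 1) = [l]" "m < n"
  shows "\<not> pd_le A m trivial_mod"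
proof
  assume "pd_le A m trivial_mod"
  \<comment> \<open>A bound below \<open>n\<close> gives the bound \<open>Suc i\<close>; one degree
    is spent on the augmentation, and \<open>i\<close> degrees remain for \<open>c (Suc i)\<close>,
    the last word of the chain.\<close>
  obtain i where i: "n = Suc (Suc i)" using assms(1) by (metis add_2_eq_Suc le_Suc_ex)
  have "pd_le A (Suc i) trivial_mod"
    by (rule pd_le_mono[OF \<open>pd_le A m trivial_mod\<close>]) (use assms(6) i in simp)
  moreover have "[l] \<in> N" using assms(2)[of "n - 1"] assms(1,5) by simp
  ultimately have "pd_le A i (mono_mod (L [l]))" by (rule pd_le_trivial_mod)
  moreover have "\<not> pd_le A i (mono_mod (L (c (Suc i))))"
  proof (rule not_pd_le_chain[where n = n])
    show "c i \<in> N" if "i < n" for i using that by (rule assms(2))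
    show "c i @ c (Suc i) \<notin> N" if "Suc i < n" for i using that by (rule assms(3))
    show "s @ c (Suc i) \<in> N" if "Suc i < n" "c i = p @ s" "p \<noteq> []" for i p s using that by (rule assms(4))
    show "Suc i < n" using i by simp
  qed
  ultimately show False using assms(5) i by simp
qed

end

end


section \<open>Monomial algebras and their opposites\<close>

lemma ring_of_type_algebra_simps:
  "carrier ring_of_type_algebra = UNIV" "x \<otimes>\<^bsub>ring_of_type_algebra\<^esub> y = x * y"
  "\<one>\<^bsub>ring_of_type_algebra\<^esub> = 1" "\<zero>\<^bsub>ring_of_type_algebra\<^esub> = 0" "x \<oplus>\<^bsub>ring_of_type_algebra\<^esub> y = x + y"
  by (simp_all add: ring_of_type_algebra_def)

lemma ring_ring_of_type_algebra: "ring (ring_of_type_algebra :: 'r::ring_1 ring)"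
proof -
  have "\<exists>y. x + y = 0" for x :: 'r using add.right_inverse by blast
  then show ?thesis unfolding ring_of_type_algebra_def
    by unfold_locales (auto simp: algebra_simps Units_def)
qed

lemma ideal_avoiding:
  "ideal {p :: letter list \<Rightarrow>\<^sub>0 'k::field. keys p \<inter> normal_words W = {}} ring_of_type_algebra" (is "ideal ?J ?R")
proof (rule idealI)
  show "ring ?R" by (rule ring_ring_of_type_algebra)
  interpret R: ring ?R by (rule ring_ring_of_type_algebra)
  have J: "add_closed ?J"
  proof -
    have "keys (- p) = keys p" for p :: "letter list \<Rightarrow>\<^sub>0 'k" by (auto simp: in_keys_iff)
    then show ?thesis unfolding add_closed_def using keys_add by fastforce
  qed
  show "subgroup ?J (add_monoid ?R)"
  proof (rule R.add.subgroupI)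
    show "?J \<subseteq> carrier ?R" by (simp add: ring_of_type_algebra_simps)
    have "0 \<in> ?J" by simp
    then show "?J \<noteq> {}" by blast
    show "p \<oplus>\<^bsub>?R\<^esub> q \<in> ?J" if "p \<in> ?J" "q \<in> ?J" for p q
      using that J by (simp add: ring_of_type_algebra_simps add_closed_def)
    show "\<ominus>\<^bsub>?R\<^esub> p \<in> ?J" if "p \<in> ?J" for p
    proof -
      have "\<ominus>\<^bsub>?R\<^esub> p = - p"
        by (rule R.minus_equality) (simp_all add: ring_of_type_algebra_simps)
      then show ?thesis using that J by (simp add: add_closed_def)
    qed
  qed
  fix p q assume p: "p \<in> ?J"
  have n: "a @ w \<notin> normal_words W" "w @ a \<notin> normal_words W" if "w \<notin> normal_words W" for a w
    using that normal_words_sublist[of "a @ w" W w] normal_words_sublist[of "w @ a" W w] by auto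
  have "w \<notin> normal_words W" if w: "w \<in> keys (q * p)" for w
  proof -
    obtain a b where "w = a @ b" "b \<in> keys p" using keys_mult[of q p] w by (auto simp: plus_list_def)
    then show ?thesis using n(1) p by blast
  qed
  moreover have "w \<notin> normal_words W" if w: "w \<in> keys (p * q)" for w
  proof -
    obtain a b where "w = a @ b" "a \<in> keys p" using keys_mult[of p q] w by (auto simp: plus_list_def)
    then show ?thesis using n(2) p by blast
  qed
  ultimately show "q \<otimes>\<^bsub>?R\<^esub> p \<in> ?J" "p \<otimes>\<^bsub>?R\<^esub> q \<in> ?J"
    unfolding ring_of_type_algebra_simps by blast+
qed

text \<open>A word that contains a relation is a multiple of it, and the span of these words absorbs
  multiplication. The quotient thus has the normal words as a basis.\<close>

lemma monomial_ideal_eq: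
  "monomial_ideal W = {p :: letter list \<Rightarrow>\<^sub>0 'k::field. keys p \<inter> normal_words W = {}}" (is "_ = ?J")
proof -
  let ?R = "ring_of_type_algebra :: (letter list \<Rightarrow>\<^sub>0 'k) ring"
  let ?S = "(\<lambda>w. Poly_Mapping.single w (1::'k)) ` W"
  interpret R: ring ?R by (rule ring_ring_of_type_algebra)
  interpret I: ideal "monomial_ideal W" ?R
    unfolding monomial_ideal_def by (rule R.genideal_ideal) (simp add: ring_of_type_algebra_simps)
  have "?S \<subseteq> ?J" by (auto simp: normal_words_def)
  then have "monomial_ideal W \<subseteq> ?J"
    unfolding monomial_ideal_def by (rule R.genideal_minimal[OF ideal_avoiding])
  moreover have "?J \<subseteq> monomial_ideal W"
  proof
    fix p assume p: "p \<in> ?J"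
    show "p \<in> monomial_ideal W"
    proof (rule poly_mapping_add_induct[where p = p])
      show "(0 :: letter list \<Rightarrow>\<^sub>0 'k) \<in> monomial_ideal W" using I.zero_closed by (simp add: ring_of_type_algebra_simps)
      show "p + q \<in> monomial_ideal W" if "p \<in> monomial_ideal W" "q \<in> monomial_ideal W" for p q :: "letter list \<Rightarrow>\<^sub>0 'k"
        using I.a_closed[OF that] by (simp add: ring_of_type_algebra_simps)
      fix w assume "w \<in> keys p"
      then obtain v where "v \<in> W" "sublist v w" using p by (auto simp: normal_words_def)
      then obtain a b where v: "v \<in> W" "w = a @ v @ b" by (auto simp: sublist_def)
      have "Poly_Mapping.single v (1::'k) \<in> monomial_ideal W"
        unfolding monomial_ideal_def
        by (rule subsetD[OF R.genideal_self]) (use v(1) in \<open>auto simp: ring_of_type_algebra_simps\<close>)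
      from I.I_r_closed[OF I.I_l_closed[OF this]]
      have "Poly_Mapping.single a (lookup p w) * Poly_Mapping.single v 1 * Poly_Mapping.single b 1 \<in> monomial_ideal W"
        by (simp add: ring_of_type_algebra_simps)
      then show "Poly_Mapping.single w (lookup p w) \<in> monomial_ideal W"
        by (simp add: mult_single plus_list_def v(2))
    qed
  qed
  ultimately show ?thesis by blast
qed

definition mono_coset :: "letter list set \<Rightarrow> (letter list \<Rightarrow>\<^sub>0 'k::field) \<Rightarrow> (letter list \<Rightarrow>\<^sub>0 'k) set" where
  "mono_coset W p = monomial_ideal W +>\<^bsub>ring_of_type_algebra\<^esub> p"

lemma word_algebra_monomial:
  assumes "[] \<in> normal_words W"
  shows "word_algebra (monomial_algebra W) (mono_coset W :: (letter list \<Rightarrow>\<^sub>0 'k::field) \<Rightarrow> _) (normal_words W)"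
proof -
  let ?R = "ring_of_type_algebra :: (letter list \<Rightarrow>\<^sub>0 'k) ring"
  have I: "ideal (monomial_ideal W :: (letter list \<Rightarrow>\<^sub>0 'k) set) ?R"
    unfolding monomial_ideal_eq by (rule ideal_avoiding)
  interpret R: ring ?R by (rule ring_ring_of_type_algebra)
  interpret I: ideal "monomial_ideal W" ?R by (rule I)
  interpret A: ring "monomial_algebra W :: (letter list \<Rightarrow>\<^sub>0 'k) set ring"
    unfolding monomial_algebra_def by (rule I.quotient_is_ring)
  have hom: "(mono_coset W :: (letter list \<Rightarrow>\<^sub>0 'k) \<Rightarrow> _) \<in> ring_hom ?R (monomial_algebra W)"
    unfolding mono_coset_def monomial_algebra_def by (rule I.rcos_ring_hom)
  show ?thesis
  proof unfold_locales
    fix p q :: "letter list \<Rightarrow>\<^sub>0 'k"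
    show "mono_coset W (p + q) = mono_coset W p \<oplus>\<^bsub>monomial_algebra W\<^esub> mono_coset W q"
      using ring_hom_add[OF hom, of p q] by (simp add: ring_of_type_algebra_simps)
    show "mono_coset W (p * q) = mono_coset W p \<otimes>\<^bsub>monomial_algebra W\<^esub> mono_coset W q"
      using ring_hom_mult[OF hom, of p q] by (simp add: ring_of_type_algebra_simps)
    show "mono_coset W (1 :: letter list \<Rightarrow>\<^sub>0 'k) = \<one>\<^bsub>monomial_algebra W\<^esub>"
      using ring_hom_one[OF hom] by (simp add: ring_of_type_algebra_simps)
    show "range (mono_coset W :: (letter list \<Rightarrow>\<^sub>0 'k) \<Rightarrow> _) = carrier (monomial_algebra W)"
      by (auto simp: monomial_algebra_def FactRing_def A_RCOSETS_def' ring_of_type_algebra_simps mono_coset_def)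
    have "mono_coset W p = \<zero>\<^bsub>monomial_algebra W\<^esub> \<longleftrightarrow> p \<in> monomial_ideal W"
      using I.rcos_const_imp_mem[of p] R.a_rcos_zero[OF I, of p]
      by (auto simp: monomial_algebra_def FactRing_def mono_coset_def ring_of_type_algebra_simps)
    then show "(mono_coset W p = \<zero>\<^bsub>monomial_algebra W\<^esub>) = (keys p \<inter> normal_words W = {})"
      by (simp add: monomial_ideal_eq)
    show "[] \<in> normal_words W" by (rule assms)
    show "v \<in> normal_words W \<and> w \<in> normal_words W" if "v @ w \<in> normal_words W" for v w
      using normal_words_sublist[OF that, of v] normal_words_sublist[OF that, of w] by simp
  qed
qed

text \<open>The antiautomorphism of the free algebra that reverses words; composed with it, a
  quotient map onto an algebra becomes one onto the opposite algebra.\<close>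

definition rev_poly :: "(letter list \<Rightarrow>\<^sub>0 'k::field) \<Rightarrow> (letter list \<Rightarrow>\<^sub>0 'k)" where
  "rev_poly = Poly_Mapping.map_key rev"

lemma rev_poly_simps:
  "rev_poly (Poly_Mapping.single w c) = Poly_Mapping.single (rev w) c"
  "rev_poly (p + q) = rev_poly p + rev_poly q" "rev_poly 0 = 0"
  "keys (rev_poly p) = rev ` keys p" "rev_poly (rev_poly p) = p"
proof -
  have r: "inj (rev :: letter list \<Rightarrow> _)" by simp
  show "rev_poly (Poly_Mapping.single w c) = Poly_Mapping.single (rev w) c"
    using map_key_single[OF r, of "rev w" c] by (simp add: rev_poly_def)
  show "rev_poly (p + q) = rev_poly p + rev_poly q" "rev_poly 0 = 0"
    unfolding rev_poly_def by (rule map_key_plus[OF r], rule map_key_zero[OF r])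
  show "keys (rev_poly p) = rev ` keys p"
    unfolding rev_poly_def keys_map_key[OF r]
  proof (intro equalityI subsetI)
    fix w assume "w \<in> rev -` keys p"
    then show "w \<in> rev ` keys p" by (intro image_eqI[of _ _ "rev w"]) simp_all
  qed auto
  have rr: "(rev :: letter list \<Rightarrow> letter list) \<circ> rev = (\<lambda>x. x)" by (simp add: fun_eq_iff)
  show "rev_poly (rev_poly p) = p"
    unfolding rev_poly_def map_key_compose[OF r r] rr by (rule map_key_id)
qed

lemma rev_poly_mult: "rev_poly (p * q) = rev_poly q * rev_poly p"
proof (rule poly_mapping_add_induct[where p = p])
  show "rev_poly (0 * q) = rev_poly q * rev_poly 0" by (simp add: rev_poly_simps)
  show "rev_poly ((p1 + p2) * q) = rev_poly q * rev_poly (p1 + p2)"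
    if "rev_poly (p1 * q) = rev_poly q * rev_poly p1" "rev_poly (p2 * q) = rev_poly q * rev_poly p2" for p1 p2
    using that by (simp add: rev_poly_simps(2) distrib_left distrib_right)
  fix v
  show "rev_poly (Poly_Mapping.single v (lookup p v) * q) = rev_poly q * rev_poly (Poly_Mapping.single v (lookup p v))"
  proof (rule poly_mapping_add_induct[where p = q])
    show "rev_poly (Poly_Mapping.single v (lookup p v) * 0) = rev_poly 0 * rev_poly (Poly_Mapping.single v (lookup p v))"
      by (simp add: rev_poly_simps(3))
    show "rev_poly (Poly_Mapping.single v (lookup p v) * (q1 + q2)) = rev_poly (q1 + q2) * rev_poly (Poly_Mapping.single v (lookup p v))"
      if "rev_poly (Poly_Mapping.single v (lookup p v) * q1) = rev_poly q1 * rev_poly (Poly_Mapping.single v (lookup p v))"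
        "rev_poly (Poly_Mapping.single v (lookup p v) * q2) = rev_poly q2 * rev_poly (Poly_Mapping.single v (lookup p v))" for q1 q2
      using that by (simp add: rev_poly_simps(2) distrib_left distrib_right)
    show "rev_poly (Poly_Mapping.single v (lookup p v) * Poly_Mapping.single w (lookup q w)) =
        rev_poly (Poly_Mapping.single w (lookup q w)) * rev_poly (Poly_Mapping.single v (lookup p v))" for w
      by (simp add: rev_poly_simps(1) mult_single plus_list_def mult.commute)
  qed
qed

lemma ring_opposite:
  assumes "ring A" shows "ring (opposite_ring A)"
proof -
  interpret A: ring A by fact
  show ?thesis
  proof (rule ringI)
    show "abelian_group (opposite_ring A)"
    proof (rule abelian_groupI)
      fix x assume "x \<in> carrier (opposite_ring A)"
      then show "\<exists>y\<in>carrier (opposite_ring A). y \<oplus>\<^bsub>opposite_ring A\<^esub> x = \<zero>\<^bsub>opposite_ring A\<^esub>"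
        by (intro bexI[of _ "\<ominus>\<^bsub>A\<^esub> x"]) (simp_all add: opposite_ring_def A.l_neg)
    next
      fix x y assume "x \<in> carrier (opposite_ring A)" "y \<in> carrier (opposite_ring A)"
      then show "x \<oplus>\<^bsub>opposite_ring A\<^esub> y = y \<oplus>\<^bsub>opposite_ring A\<^esub> x"
        by (simp add: opposite_ring_def A.a_comm)
    qed (simp_all add: opposite_ring_def A.a_assoc)
    show "Group.monoid (opposite_ring A)"
      by (rule monoidI) (auto simp: opposite_ring_def A.m_assoc)
  qed (auto simp: opposite_ring_def A.l_distr A.r_distr)
qed

lemma (in word_algebra) word_algebra_opposite:
  "word_algebra (opposite_ring A) (\<lambda>p. \<Phi> (rev_poly p)) (rev ` N)"
proof -
  interpret O: ring "opposite_ring A" by (rule ring_opposite[OF ring_axioms])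
  show ?thesis
  proof unfold_locales
    fix p q
    show "\<Phi> (rev_poly (p + q)) = \<Phi> (rev_poly p) \<oplus>\<^bsub>opposite_ring A\<^esub> \<Phi> (rev_poly q)"
      by (simp add: rev_poly_simps(2) Phi_add opposite_ring_def)
    show "\<Phi> (rev_poly (p * q)) = \<Phi> (rev_poly p) \<otimes>\<^bsub>opposite_ring A\<^esub> \<Phi> (rev_poly q)"
      by (simp add: rev_poly_mult Phi_mult opposite_ring_def)
    have "rev_poly (1 :: letter list \<Rightarrow>\<^sub>0 'k) = 1" unfolding one_single rev_poly_simps(1) by simp
    then show "\<Phi> (rev_poly 1) = \<one>\<^bsub>opposite_ring A\<^esub>" by (simp add: Phi_one opposite_ring_def)
    have "range (\<lambda>p. \<Phi> (rev_poly p)) = range \<Phi>"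
    proof (intro equalityI subsetI)
      fix x assume "x \<in> range \<Phi>"
      then obtain p where "x = \<Phi> p" by blast
      then have "x = \<Phi> (rev_poly (rev_poly p))" by (simp add: rev_poly_simps(5))
      then show "x \<in> range (\<lambda>p. \<Phi> (rev_poly p))" by blast
    qed auto
    then show "range (\<lambda>p. \<Phi> (rev_poly p)) = carrier (opposite_ring A)"
      by (simp add: Phi_range opposite_ring_def)
    have "(rev ` keys p \<inter> N = {}) = (keys p \<inter> rev ` N = {})"
    proof -
      have "x \<in> rev ` N \<longleftrightarrow> rev x \<in> N" for x by (metis image_iff rev_rev_ident)
      then show ?thesis by (auto simp: disjoint_iff)
    qed
    then show "(\<Phi> (rev_poly p) = \<zero>\<^bsub>opposite_ring A\<^esub>) = (keys p \<inter> rev ` N = {})"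
      by (simp add: Phi_eq_zero_iff opposite_ring_def rev_poly_simps(4))
    show "[] \<in> rev ` N" using Nil_normal by (metis image_eqI rev.simps(1))
    show "v \<in> rev ` N \<and> w \<in> rev ` N" if vw: "v @ w \<in> rev ` N" for v w
    proof -
      obtain x where x: "v @ w = rev x" "x \<in> N" using vw by blast
      then have "x = rev w @ rev v" by (metis rev_append rev_rev_ident)
      then have "rev w \<in> N" "rev v \<in> N" using x(2) normal_factor by blast+
      then show ?thesis by (metis image_eqI rev_rev_ident)
    qed
  qed
qed


section \<open>Encodings into the universe of modules\<close>

text \<open>A self-delimiting code: in \<open>wl u\<close> every entry is announced by
  \<open>z\<close>, and \<open>e\<close> marks the end. So \<open>u\<close> can be read off the
  front, and \<open>v\<close> is what remains, whatever the entries are.\<close>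

lemma list_pairing_exists:
  fixes z e :: 'x assumes "z \<noteq> e"
  shows "\<exists>pr :: 'x list \<Rightarrow> 'x list \<Rightarrow> 'x list. inj (case_prod pr) \<and> (\<forall>u v. pr u v \<noteq> [])"
proof -
  define wl where "wl u = concat (map (\<lambda>t. [z, t]) u) @ [e]" for u :: "'x list"
  have wl: "wl [] = [e]" "wl (t # u) = z # t # wl u" for t u by (simp_all add: wl_def)
  have inj: "wl u @ v = wl u' @ v' \<Longrightarrow> u = u' \<and> v = v'" for u u' v v'
  proof (induction u arbitrary: u')
    case Nil
    then show ?case using assms by (cases u') (auto simp: wl)
  next
    case (Cons t u)
    then show ?case using assms by (cases u') (auto simp: wl)
  qed
  have "inj (case_prod (\<lambda>u v. wl u @ v))" using inj by (auto intro!: injI)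
  moreover have "wl u @ v \<noteq> []" for u v by (simp add: wl_def)
  ultimately show ?thesis by blast
qed

text \<open>A list of lists is folded by the pairing. Codes of pairs are nonempty, which separates
  them from the code of the empty list.\<close>

lemma list_list_inj:
  fixes z e :: 'x assumes "z \<noteq> e"
  shows "\<exists>f :: 'x list list \<Rightarrow> 'x list. inj f"
proof -
  obtain pr :: "'x list \<Rightarrow> 'x list \<Rightarrow> 'x list" where pr: "inj (case_prod pr)" "\<And>u v. pr u v \<noteq> []"
    using list_pairing_exists[OF assms] by blast
  define f where "f xs = foldr pr xs []" for xs
  have f: "f [] = []" "f (x # xs) = pr x (f xs)" for x xs by (simp_all add: f_def)
  have "f xs = f ys \<Longrightarrow> xs = ys" for xs ys
  proof (induction xs arbitrary: ys)
    case Nil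
    then show ?case using pr(2)[THEN not_sym] by (cases ys) (simp_all add: f)
  next
    case (Cons x xs)
    then obtain y ys' where ys: "ys = y # ys'" using pr(2) by (cases ys) (simp_all add: f)
    then have "case_prod pr (x, f xs) = case_prod pr (y, f ys')" using Cons.prems by (simp add: f)
    then have "(x, f xs) = (y, f ys')" by (rule injD[OF pr(1)])
    then show ?case using Cons.IH ys by simp
  qed
  then show ?thesis by (intro exI[of _ f] injI)
qed

text \<open>A finitely supported function is recovered from any listing of its support together with
  the values there.\<close>

lemma poly_mapping_inj:
  fixes z e :: 'x and f :: "'i \<Rightarrow> 'x list" and g :: "'q::zero \<Rightarrow> 'x list"
  assumes "z \<noteq> e" "inj f" "inj g"
  shows "\<exists>j :: ('i \<Rightarrow>\<^sub>0 'q) \<Rightarrow> 'x list. inj j"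
proof -
  obtain pr :: "'x list \<Rightarrow> 'x list \<Rightarrow> 'x list" where pr: "inj (case_prod pr)"
    using list_pairing_exists[OF assms(1)] by blast
  obtain h :: "'x list list \<Rightarrow> 'x list" where h: "inj h"
    using list_list_inj[OF assms(1)] by blast
  define ks where "ks p = (SOME xs. set xs = keys p)" for p :: "'i \<Rightarrow>\<^sub>0 'q"
  have ks: "set (ks p) = keys p" for p
    unfolding ks_def by (rule someI_ex) (simp add: finite_list)
  define j where "j p = h (map (\<lambda>t. pr (f t) (g (lookup p t))) (ks p))" for p
  have sub: "lookup q t = lookup p t" if pq: "j p = j q" and t: "t \<in> keys p" for p q t
  proof -
    have "map (\<lambda>t. pr (f t) (g (lookup p t))) (ks p) = map (\<lambda>t. pr (f t) (g (lookup q t))) (ks q)"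
      using pq unfolding j_def by (rule injD[OF h])
    then have "set (map (\<lambda>t. pr (f t) (g (lookup p t))) (ks p)) = set (map (\<lambda>t. pr (f t) (g (lookup q t))) (ks q))"
      by (rule arg_cong)
    then have "(\<lambda>t. pr (f t) (g (lookup p t))) ` keys p = (\<lambda>t. pr (f t) (g (lookup q t))) ` keys q"
      by (simp add: ks)
    then obtain s where "case_prod pr (f t, g (lookup p t)) = case_prod pr (f s, g (lookup q s))"
      using t by auto
    then have "(f t, g (lookup p t)) = (f s, g (lookup q s))" by (rule injD[OF pr])
    then show ?thesis using injD[OF assms(2), of t s] injD[OF assms(3), of "lookup p t" "lookup q s"] by auto
  qed
  have "inj j"
  proof (rule injI, rule poly_mapping_eqI)
    fix p q t assume e: "j p = j q"
    show "lookup p t = lookup q t"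
      using sub[OF e, of t] sub[OF e[symmetric], of t] unfolding in_keys_iff by metis
  qed
  then show ?thesis by blast
qed

lemma universe_encodings:
  obtains pr :: "((letter list \<Rightarrow>\<^sub>0 'k::field) set, 'u) universe \<Rightarrow> ((letter list \<Rightarrow>\<^sub>0 'k) set, 'u) universe \<Rightarrow> ((letter list \<Rightarrow>\<^sub>0 'k) set, 'u) universe" and fs sn
    and j :: "(letter list \<Rightarrow>\<^sub>0 (((letter list \<Rightarrow>\<^sub>0 'k) set, 'u) universe \<Rightarrow>\<^sub>0 'k)) \<Rightarrow> ((letter list \<Rightarrow>\<^sub>0 'k) set, 'u) universe"
  where "pairing pr fs sn" "inj j"
proof -
  \<comment> \<open>Two distinct elements that are present whatever the type \<open>'u\<close>
    is.\<close>
  let ?z = "Inl {} :: (letter list \<Rightarrow>\<^sub>0 'k) set + 'u" and ?e = "Inl UNIV :: (letter list \<Rightarrow>\<^sub>0 'k) set + 'u"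
  have ne: "?z \<noteq> ?e" by simp
  obtain pr :: "((letter list \<Rightarrow>\<^sub>0 'k) set, 'u) universe \<Rightarrow> ((letter list \<Rightarrow>\<^sub>0 'k) set, 'u) universe \<Rightarrow> ((letter list \<Rightarrow>\<^sub>0 'k) set, 'u) universe" where pr: "inj (case_prod pr)"
    using list_pairing_exists[OF ne] by blast
  let ?d = "inv_into UNIV (case_prod pr)"
  have "?d (pr x y) = (x, y)" for x y using inv_f_f[OF pr, of "(x, y)"] by simp
  then have P: "pairing pr (\<lambda>v. fst (?d v)) (\<lambda>v. snd (?d v))" by unfold_locales simp_all
  let ?f = "\<lambda>w. [Inl {Poly_Mapping.single w (1::'k)}] :: ((letter list \<Rightarrow>\<^sub>0 'k) set, 'u) universe"
  let ?g = "\<lambda>c. [Inl {Poly_Mapping.single [] c}] :: ((letter list \<Rightarrow>\<^sub>0 'k) set, 'u) universe"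
  have g: "inj ?g" by (rule injI) (auto dest: injD[OF inj_single])
  have f: "inj ?f"
  proof (rule injI)
    fix v w assume "?f v = ?f w"
    then have "Poly_Mapping.single v (1::'k) = Poly_Mapping.single w 1" by simp
    then have "keys (Poly_Mapping.single v (1::'k)) = keys (Poly_Mapping.single w (1::'k))" by (rule arg_cong)
    then show "v = w" by simp
  qed
  obtain j1 :: "(((letter list \<Rightarrow>\<^sub>0 'k) set, 'u) universe \<Rightarrow>\<^sub>0 'k) \<Rightarrow> ((letter list \<Rightarrow>\<^sub>0 'k) set, 'u) universe" where "inj j1"
    using poly_mapping_inj[OF ne inj_on_id2 g] by blast
  then obtain j :: "(letter list \<Rightarrow>\<^sub>0 (((letter list \<Rightarrow>\<^sub>0 'k) set, 'u) universe \<Rightarrow>\<^sub>0 'k)) \<Rightarrow> ((letter list \<Rightarrow>\<^sub>0 'k) set, 'u) universe" where "inj j"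
    using poly_mapping_inj[OF ne f] by blast
  then show thesis using that P by blast
qed


section \<open>Global dimension\<close>

text \<open>The filtration given by \<open>T\<close>, \<open>S\<close> and \<open>u\<close> serves
  the upper bound, the chain \<open>c\<close> the lower one; an algebra and its opposite are handled
  by different choices of these data.\<close>

lemma (in word_algebra) global_dimension_eq:
  fixes T S :: "nat \<Rightarrow> letter list set" and c u :: "nat \<Rightarrow> letter list"
    and pr :: "('a, 'u) universe \<Rightarrow> ('a, 'u) universe \<Rightarrow> ('a, 'u) universe"
    and j :: "(letter list \<Rightarrow>\<^sub>0 (('a, 'u) universe \<Rightarrow>\<^sub>0 'k)) \<Rightarrow> ('a, 'u) universe"
  assumes pr: "pairing pr fs sn" and j: "inj j" and n: "n \<ge> 2"
    and split: "\<And>k. k \<le> n \<Longrightarrow> word_split N (T k) (S k)"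
    and T0: "T 0 = N" and S0: "S 0 = {[]}" and Tn: "T n = {[]}" and Sn: "S n = N"
    and T: "\<And>k. k < n \<Longrightarrow> T k = {t @ concat (replicate i (u k)) | t i. t \<in> T (Suc k)}"
    and S: "\<And>k. k < n \<Longrightarrow> S k \<subseteq> S (Suc k)"
    and pw: "\<And>k i. k < n \<Longrightarrow> concat (replicate i (u k)) \<in> S (Suc k)"
    and u: "\<And>k. k < n \<Longrightarrow> u k \<noteq> []"
    and su: "\<And>k s. k < n \<Longrightarrow> s \<in> S k \<Longrightarrow> s \<noteq> [] \<Longrightarrow> s @ u k \<in> N \<Longrightarrow> s @ u k \<in> S k"
    and cN: "\<And>i. i < n \<Longrightarrow> c i \<in> N" and cc: "\<And>i. Suc i < n \<Longrightarrow> c i @ c (Suc i) \<notin> N"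
    and cs: "\<And>i p s. Suc i < n \<Longrightarrow> c i = p @ s \<Longrightarrow> p \<noteq> [] \<Longrightarrow> s @ c (Suc i) \<in> N"
    and cl: "c (n - 1) = [l]"
  shows "left_global_dimension TYPE('u) A = enat n"
proof (rule left_global_dimension_eqI)
  fix M :: "('a, ('a, 'u) universe) module" assume M: "left_module A M"
  show "pd_le A n M"
  proof (rule pd_le_filtration[where T = T and S = S and u = u, OF pr j M])
    show "s @ u k \<in> S k" if "k < n" "s \<in> S k" "s \<noteq> []" "s @ u k \<in> N" for k s using that by (rule su)
  qed (fact split T0 S0 Tn Sn T S pw u)+
next
  show "left_module A (trivial_mod j undefined)" by (rule left_module_trivial_mod[OF j pr])
next
  fix m assume m: "m < n"
  show "\<not> pd_le A m (trivial_mod j undefined)"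
  proof (rule not_pd_le_trivial_mod[where c = c, OF j pr n])
    show "s @ c (Suc i) \<in> N" if "Suc i < n" "c i = p @ s" "p \<noteq> []" for i p s using that by (rule cs)
  qed (fact cN cc cl m)+
qed


section \<open>Global dimension of monomial algebras with Lyndon relations\<close>

lemma rev_mem_iff: "w \<in> rev ` M \<longleftrightarrow> rev w \<in> M"
  by (metis image_iff rev_rev_ident)

lemma rev_power: "rev (concat (replicate i w)) = concat (replicate i (rev w))"
proof (induction i)
  case (Suc i)
  have "concat (replicate i v) @ v = v @ concat (replicate i v)" for v :: "'a list"
    by (induction i) simp_all
  from this[of "rev w"] show ?case using Suc by simp
qed simp

context lyndon_monomial
begin

lemma word_split_PR:
  assumes "k \<le> n" shows "word_split N (PR k n) (PR 0 k)"
  unfolding word_split_def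
proof (intro conjI ballI impI)
  show "t @ s \<in> N" if "t \<in> PR k n" "s \<in> PR 0 k" for t s
    using that assms by (rule PR_append)
  show "\<exists>t\<in>PR k n. \<exists>s\<in>PR 0 k. w = t @ s" if "w \<in> N" for w
    using PR_split[OF that assms] by blast
  show "t = t'" if "t \<in> PR k n" "t' \<in> PR k n" "s \<in> PR 0 k" "s' \<in> PR 0 k" "t @ s = t' @ s'" for t t' s s'
    using PR_split_unique(1)[OF that(1,3,2,4) assms that(5)] .
  show "[] \<in> PR 0 k" by (rule Nil_in_PR)
  show "s @ s' \<in> PR 0 k" if "s \<in> PR 0 k" "s' \<in> PR 0 k" "s @ s' \<in> N" for s s'
    using that assms by (rule PR_lo_append)
qed

text \<open>Reversal exchanges the two parts of a word, so for right modules the subalgebras are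
  spanned by products of large atoms, and the filtration runs downwards.\<close>

lemma word_split_rev_PR:
  assumes "k \<le> n" shows "word_split (rev ` N) (rev ` PR 0 k) (rev ` PR k n)"
  unfolding word_split_def rev_mem_iff
proof (intro conjI ballI impI)
  show "rev (t @ s) \<in> N" if "t \<in> rev ` PR 0 k" "s \<in> rev ` PR k n" for t s
    using that PR_append[OF _ _ assms, of "rev s" "rev t"] by (simp add: rev_mem_iff)
  show "\<exists>t\<in>rev ` PR 0 k. \<exists>s\<in>rev ` PR k n. w = t @ s" if w: "w \<in> rev ` N" for w
  proof -
    obtain t s where "t \<in> PR k n" "s \<in> PR 0 k" "rev w = t @ s"
      using PR_split[OF _ assms, of "rev w"] w unfolding rev_mem_iff by blast
    then have "w = rev s @ rev t" "rev s \<in> rev ` PR 0 k" "rev t \<in> rev ` PR k n"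
      by (metis rev_append rev_rev_ident, simp_all)
    then show ?thesis by blast
  qed
  show "t = t'" if "t \<in> rev ` PR 0 k" "t' \<in> rev ` PR 0 k" "s \<in> rev ` PR k n" "s' \<in> rev ` PR k n"
      "t @ s = t' @ s'" for t t' s s'
  proof -
    have "rev s @ rev t = rev s' @ rev t'" using that(5) by (metis rev_append)
    then have "rev t = rev t'"
      using PR_split_unique(2)[OF _ _ _ _ assms, of "rev s" "rev t" "rev s'" "rev t'"] that
      by (simp add: rev_mem_iff)
    then show ?thesis by simp
  qed
  show "rev [] \<in> PR k n" by (simp add: Nil_in_PR)
  show "rev (s @ s') \<in> PR k n" if "s \<in> rev ` PR k n" "s' \<in> rev ` PR k n" "rev (s @ s') \<in> N" for s s'
    using that PR_hi_append[OF _ _ _ assms, of "rev s'" "rev s"] by (simp add: rev_mem_iff)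
qed

text \<open>Supplies the nonvanishing products in the chain condition: a relation inside
  \<open>u\<close> would lie inside \<open>w\<close> and equal it, but \<open>u\<close> is too
  short.\<close>

lemma proper_factor_normal:
  assumes "\<And>v w. v \<in> W \<Longrightarrow> w \<in> W \<Longrightarrow> sublist v w \<Longrightarrow> v = w"
    and "w \<in> W" "sublist u w" "length u < length w"
  shows "u \<in> N"
proof -
  have "\<not> sublist v u" if "v \<in> W" for v
  proof
    assume v: "sublist v u"
    then have "v = w" using assms(1)[OF that assms(2)] assms(3) by (meson sublist_order.order.trans)
    then show False using v assms(4) by (meson sublist_length_le not_less)
  qed
  then show ?thesis by (simp add: normal_words_def)
qed

lemma normal_Nil: "[] \<in> N" using Nil_in_PR[of 0 n] PR_all by simp

context
  assumes n: "n \<ge> 2"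
    and antichain: "\<And>v w. v \<in> W \<Longrightarrow> w \<in> W \<Longrightarrow> sublist v w \<Longrightarrow> v = w"
    and relation: "\<And>i. Suc i < n \<Longrightarrow> a i @ a (Suc i) \<in> W"
begin

lemma relation_not_normal: "Suc i < n \<Longrightarrow> a i @ a (Suc i) \<notin> N"
  using relation unfolding normal_words_def by blast

lemma global_dimension_left:
  assumes "a (n - 1) = [l]"
  shows "left_global_dimension TYPE('u) (monomial_algebra W :: (letter list \<Rightarrow>\<^sub>0 'k::field) set ring) = enat n"
proof -
  interpret A: word_algebra "monomial_algebra W" "mono_coset W :: (letter list \<Rightarrow>\<^sub>0 'k) \<Rightarrow> _" N
    by (rule word_algebra_monomial[OF normal_Nil])
  obtain pr :: "((letter list \<Rightarrow>\<^sub>0 'k::field) set, 'u) universe \<Rightarrow> ((letter list \<Rightarrow>\<^sub>0 'k) set, 'u) universe \<Rightarrow> ((letter list \<Rightarrow>\<^sub>0 'k) set, 'u) universe" and fs sn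
    and j :: "(letter list \<Rightarrow>\<^sub>0 (((letter list \<Rightarrow>\<^sub>0 'k) set, 'u) universe \<Rightarrow>\<^sub>0 'k)) \<Rightarrow> ((letter list \<Rightarrow>\<^sub>0 'k) set, 'u) universe"
    where pr: "pairing pr fs sn" and j: "inj j" using universe_encodings by blast
  show ?thesis
  proof (rule A.global_dimension_eq[where T = "\<lambda>k. PR k n" and S = "PR 0" and u = a and c = a, OF pr j n])
    show "word_split N (PR k n) (PR 0 k)" if "k \<le> n" for k using that by (rule word_split_PR)
    show "PR 0 n = N" "PR 0 0 = {[]}" "PR n n = {[]}" "PR 0 n = N" by (simp_all add: PR_all PR_empty)
    show "PR k n = {t @ concat (replicate i (a k)) | t i. t \<in> PR (Suc k) n}" if k: "k < n" for k
    proof (intro equalityI subsetI)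
      fix w assume "w \<in> PR k n"
      then obtain t s where "t \<in> PR (Suc k) n" "s \<in> PR k (Suc k)" "w = t @ s"
        using PR_split_mid[of w k n "Suc k"] k by auto
      then show "w \<in> {t @ concat (replicate i (a k)) | t i. t \<in> PR (Suc k) n}"
        using PR_single[OF k] by blast
    next
      fix w assume "w \<in> {t @ concat (replicate i (a k)) | t i. t \<in> PR (Suc k) n}"
      then show "w \<in> PR k n" using PR_append_mid[OF _ power_in_PR[OF k]] k by auto
    qed
    show "PR 0 k \<subseteq> PR 0 (Suc k)" for k by (rule PR_mono) simp_all
    show "concat (replicate i (a k)) \<in> PR 0 (Suc k)" if "k < n" for k i
      using power_in_PR[OF that] PR_mono[of 0 k "Suc k" "Suc k"] by auto
    show "a k \<noteq> []" if "k < n" for k using a_atom[OF that] by (auto simp: lyndon_def)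
    show "s @ a k \<in> PR 0 k" if "k < n" "s \<in> PR 0 k" "s \<noteq> []" "s @ a k \<in> N" for k s
      using PR_lo_snoc[OF that(2-4,1)] .
    show "a i \<in> N" if "i < n" for i using a_atom[OF that] by blast
    show "a i @ a (Suc i) \<notin> N" if "Suc i < n" for i using that by (rule relation_not_normal)
    show "s @ a (Suc i) \<in> N" if "Suc i < n" "a i = p @ s" "p \<noteq> []" for i p s
    proof (rule proper_factor_normal[OF antichain relation[OF that(1)]])
      show "sublist (s @ a (Suc i)) (a i @ a (Suc i))" using that(2) by simp
      show "length (s @ a (Suc i)) < length (a i @ a (Suc i))" using that(2,3) by simp
    qed
    show "a (n - 1) = [l]" by fact
  qed
qed

lemma global_dimension_right:
  assumes "a 0 = [l]"
  shows "right_global_dimension TYPE('u) (monomial_algebra W :: (letter list \<Rightarrow>\<^sub>0 'k::field) set ring) = enat n"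
proof -
  interpret A: word_algebra "monomial_algebra W" "mono_coset W :: (letter list \<Rightarrow>\<^sub>0 'k) \<Rightarrow> _" N
    by (rule word_algebra_monomial[OF normal_Nil])
  interpret O: word_algebra "opposite_ring (monomial_algebra W)"
      "\<lambda>p :: letter list \<Rightarrow>\<^sub>0 'k. mono_coset W (rev_poly p)" "rev ` N"
    by (rule A.word_algebra_opposite)
  obtain pr :: "((letter list \<Rightarrow>\<^sub>0 'k::field) set, 'u) universe \<Rightarrow> ((letter list \<Rightarrow>\<^sub>0 'k) set, 'u) universe \<Rightarrow> ((letter list \<Rightarrow>\<^sub>0 'k) set, 'u) universe" and fs sn
    and j :: "(letter list \<Rightarrow>\<^sub>0 (((letter list \<Rightarrow>\<^sub>0 'k) set, 'u) universe \<Rightarrow>\<^sub>0 'k)) \<Rightarrow> ((letter list \<Rightarrow>\<^sub>0 'k) set, 'u) universe"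
    where pr: "pairing pr fs sn" and j: "inj j" using universe_encodings by blast
  \<comment> \<open>The atoms in decreasing order, so that the chain for the opposite algebra ends
    at the smallest atom.\<close>
  define b where "b k = a (n - 1 - k)" for k
  have b: "n - 1 - k < n" "n - k \<le> n" for k using n by auto
  have Suc_b: "Suc (n - 1 - k) = n - k" "n - Suc k = n - 1 - k" if "k < n" for k using that by auto
  show ?thesis unfolding right_global_dimension_def
  proof (rule O.global_dimension_eq[where T = "\<lambda>k. rev ` PR 0 (n - k)" and S = "\<lambda>k. rev ` PR (n - k) n"
        and u = "\<lambda>k. rev (b k)" and c = "\<lambda>k. rev (b k)", OF pr j n])
    show "word_split (rev ` N) (rev ` PR 0 (n - k)) (rev ` PR (n - k) n)" for k
      by (rule word_split_rev_PR) simp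
    show "rev ` PR 0 (n - 0) = rev ` N" "rev ` PR (n - 0) n = {[]}" "rev ` PR 0 (n - n) = {[]}"
      "rev ` PR (n - n) n = rev ` N" by (simp_all add: PR_all PR_empty)
    show "rev ` PR 0 (n - k) = {t @ concat (replicate i (rev (b k))) | t i. t \<in> rev ` PR 0 (n - Suc k)}"
      if k: "k < n" for k
    proof (intro equalityI subsetI)
      fix w assume "w \<in> rev ` PR 0 (n - k)"
      then obtain t s where ts: "t \<in> PR (n - 1 - k) (n - k)" "s \<in> PR 0 (n - 1 - k)" "rev w = t @ s"
        using PR_split_mid[of "rev w" 0 "n - k" "n - 1 - k"] b(2)[of k] Suc_b(1)[OF k, symmetric]
        unfolding rev_mem_iff by auto
      have "t \<in> PR (n - 1 - k) (Suc (n - 1 - k))" unfolding Suc_b(1)[OF k] by (rule ts(1))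
      then obtain i where "t = concat (replicate i (b k))"
        unfolding PR_single[OF b(1)] b_def by blast
      then have "w = rev s @ concat (replicate i (rev (b k)))"
        using ts(3) by (metis rev_append rev_rev_ident rev_power)
      then show "w \<in> {t @ concat (replicate i (rev (b k))) | t i. t \<in> rev ` PR 0 (n - Suc k)}"
        using ts(2) unfolding Suc_b(2)[OF k] by blast
    next
      fix w assume "w \<in> {t @ concat (replicate i (rev (b k))) | t i. t \<in> rev ` PR 0 (n - Suc k)}"
      then obtain t i where t: "w = rev t @ concat (replicate i (rev (b k)))" "t \<in> PR 0 (n - 1 - k)"
        unfolding Suc_b(2)[OF k] by blast
      have "concat (replicate i (b k)) @ t \<in> PR 0 (n - k)"
        using PR_append_mid[OF power_in_PR[OF b(1)[of k]] t(2), of i] b(2)[of k]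
        unfolding Suc_b(1)[OF k] b_def by simp
      then show "w \<in> rev ` PR 0 (n - k)" using t(1) by (simp add: rev_mem_iff rev_power)
    qed
    show "rev ` PR (n - k) n \<subseteq> rev ` PR (n - Suc k) n" for k by (intro image_mono PR_mono) auto
    show "concat (replicate i (rev (b k))) \<in> rev ` PR (n - Suc k) n" if k: "k < n" for k i
      using power_in_PR[OF b(1)[of k], of i] PR_mono[of "n - 1 - k" "n - 1 - k" "n - k" n] b(2)[of k]
      unfolding Suc_b(1)[OF k] Suc_b(2)[OF k] rev_mem_iff rev_power b_def by auto
    show "rev (b k) \<noteq> []" for k using a_atom[OF b(1)] by (auto simp: lyndon_def b_def)
    show "s @ rev (b k) \<in> rev ` PR (n - k) n" if "k < n" "s \<in> rev ` PR (n - k) n" "s \<noteq> []" "s @ rev (b k) \<in> rev ` N" for k s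
      using PR_hi_cons[OF _ _ _ b(1), of "rev s" k] that(2-)
      unfolding Suc_b(1)[OF that(1)] rev_mem_iff b_def by simp
    show "rev (b i) \<in> rev ` N" for i using a_atom[OF b(1)] by (simp add: b_def)
    have Suc_Suc: "a (n - 1 - Suc i) = b (Suc i)" "a (Suc (n - 1 - Suc i)) = b i" "Suc (n - 1 - Suc i) < n"
      if "Suc i < n" for i using that by (auto simp: b_def Suc_diff_Suc)
    show "rev (b i) @ rev (b (Suc i)) \<notin> rev ` N" if "Suc i < n" for i
      using relation_not_normal[OF Suc_Suc(3)[OF that]] Suc_Suc[OF that] by (simp add: rev_mem_iff)
    show "s @ rev (b (Suc i)) \<in> rev ` N" if i: "Suc i < n" "rev (b i) = p @ s" "p \<noteq> []" for i p s
    proof -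
      have bi: "b i = rev s @ rev p" using i(2) by (metis rev_append rev_rev_ident)
      have "b (Suc i) @ rev s \<in> N"
      proof (rule proper_factor_normal[OF antichain relation[OF Suc_Suc(3)[OF i(1)]]])
        show "sublist (b (Suc i) @ rev s) (a (n - 1 - Suc i) @ a (Suc (n - 1 - Suc i)))"
          unfolding Suc_Suc[OF i(1)] bi append.assoc[symmetric] by (rule prefix_imp_sublist[OF prefixI[OF refl]])
        show "length (b (Suc i) @ rev s) < length (a (n - 1 - Suc i) @ a (Suc (n - 1 - Suc i)))"
          unfolding Suc_Suc[OF i(1)] bi using i(3) by simp
      qed
      then show ?thesis by (simp add: rev_mem_iff)
    qed
    show "rev (b (n - 1)) = [l]" using assms by (simp add: b_def)
  qed
qed

end

end


section \<open>Hilbert series and growth\<close>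

lemma finite_words_le: "finite {w \<in> M. length (w :: letter list) \<le> m}"
proof -
  have "finite {LX, LY}" by simp
  moreover have "{LX, LY} = UNIV" by (auto intro: letter.exhaust)
  ultimately have "finite {w :: letter list. length w \<le> m}"
    using finite_lists_length_le[of "{LX, LY}" m] by simp
  then show ?thesis by simp
qed

lemma finite_words_eq: "finite {w \<in> M. length (w :: letter list) = m}"
  by (rule finite_subset[OF _ finite_words_le[of M m]]) auto

lemma sum_card_lengths: "(\<Sum>i\<le>m. card {w \<in> M. length (w :: letter list) = i}) = card {w \<in> M. length w \<le> m}"
proof -
  have "card (\<Union>i\<in>{..m}. {w \<in> M. length w = i}) = (\<Sum>i\<le>m. card {w \<in> M. length w = i})"
    by (rule card_UN_disjoint) (auto simp: finite_words_eq)
  moreover have "(\<Union>i\<in>{..m}. {w \<in> M. length w = i}) = {w \<in> M. length w \<le> m}" by auto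
  ultimately show ?thesis by simp
qed

context word_algebra
begin

text \<open>Each normal word extends the span by a line, because its class is no combination of the
  classes of other normal words.\<close>

lemma dimension_span:
  assumes "finite F" "F \<subseteq> N"
  shows "dimension (card F) (range (\<lambda>c. \<Phi> (Poly_Mapping.single [] c))) {\<Phi> p | p. keys p \<subseteq> F}"
  using assms
proof (induction F)
  case empty
  have "{\<Phi> p | p. keys p \<subseteq> {}} = {\<zero>}" using Phi_zero by auto
  then show ?case using zero_dim by simp
next
  case (insert v F)
  let ?K = "range (\<lambda>c. \<Phi> (Poly_Mapping.single [] c))" and ?v = "\<Phi> (Poly_Mapping.single v 1)"
    and ?E = "\<lambda>F. {\<Phi> p | p. keys p \<subseteq> F}"
  have "?v \<notin> ?E F"
  proof
    assume "?v \<in> ?E F"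
    then obtain p where p: "?v = \<Phi> p" "keys p \<subseteq> F" by blast
    have "v \<in> keys (Poly_Mapping.single v 1 - p)"
    proof -
      have "v \<notin> keys p" using p(2) insert.hyps(2) by blast
      then show ?thesis by (simp add: in_keys_iff lookup_minus)
    qed
    then show False using Phi_eqD[OF p(1)] insert.prems by blast
  qed
  moreover have "line_extension ?K ?v (?E F) = ?E (insert v F)"
  proof (intro equalityI subsetI)
    fix u assume "u \<in> line_extension ?K ?v (?E F)"
    then obtain c p where u: "u = \<Phi> (Poly_Mapping.single [] c) \<otimes> ?v \<oplus> \<Phi> p" and p: "keys p \<subseteq> F"
      unfolding line_extension_mem_iff by blast
    have "u = \<Phi> (Poly_Mapping.single v c + p)"
      unfolding u by (simp add: Phi_add mult_single plus_list_def flip: Phi_mult)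
    moreover have "keys (Poly_Mapping.single v c + p) \<subseteq> insert v F"
      using keys_add[of "Poly_Mapping.single v c" p] p by (auto split: if_splits)
    ultimately show "u \<in> ?E (insert v F)" by blast
  next
    fix u assume "u \<in> ?E (insert v F)"
    then obtain p where u: "u = \<Phi> p" and p: "keys p \<subseteq> insert v F" by blast
    let ?c = "lookup p v" let ?q = "p - Poly_Mapping.single v ?c"
    have "keys ?q \<subseteq> F"
    proof
      fix x assume "x \<in> keys ?q"
      then have "x \<noteq> v" "x \<in> keys p"
        by (auto simp: in_keys_iff lookup_minus lookup_single when_def split: if_splits)
      then show "x \<in> F" using p by blast
    qed
    moreover have "u = \<Phi> (Poly_Mapping.single [] ?c) \<otimes> ?v \<oplus> \<Phi> ?q"
      unfolding u by (simp add: mult_single plus_list_def flip: Phi_mult Phi_add)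
    ultimately show "u \<in> line_extension ?K ?v (?E F)" unfolding line_extension_mem_iff by blast
  qed
  moreover have "dimension (Suc (card F)) ?K (line_extension ?K ?v (?E F))"
    using insert calculation(1) Phi_closed by (intro Suc_dim) simp_all
  ultimately show ?case using insert.hyps by simp
qed

text \<open>Deleting the terms at words outside \<open>N\<close> does not change the class; a
  homogeneous element thus has a representative on normal words of the same length.\<close>

lemma Phi_normal_part: "\<exists>q. \<Phi> q = \<Phi> p \<and> keys q = keys p \<inter> N"
proof -
  define q where "q = Abs_poly_mapping (\<lambda>w. lookup p w when w \<in> N)"
  have "finite {w. (lookup p w when w \<in> N) \<noteq> 0}"
    by (rule finite_subset[OF _ finite_keys[of p]]) (auto simp: in_keys_iff when_def)
  then have q: "lookup q w = (lookup p w when w \<in> N)" for w unfolding q_def by simp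
  have "keys (q - p) \<inter> N = {}" by (auto simp: in_keys_iff lookup_minus q)
  then have "\<Phi> (q - p) = \<zero>" by (simp add: Phi_eq_zero_iff)
  moreover have "\<Phi> q = \<Phi> (q - p) \<oplus> \<Phi> p" by (simp flip: Phi_add)
  ultimately have "\<Phi> q = \<Phi> p" using Phi_closed by simp
  moreover have "keys q = keys p \<inter> N" by (auto simp: in_keys_iff q when_def split: if_splits)
  ultimately show ?thesis by blast
qed

lemma subfield_scalars: "subfield (range (\<lambda>c. \<Phi> (Poly_Mapping.single [] c))) A"
proof -
  let ?k = "ring_of_type_algebra :: 'k ring" and ?h = "\<lambda>c. \<Phi> (Poly_Mapping.single [] c)"
  interpret k: field ?k by (rule field_from_type_algebra)
  have "ring_hom_ring ?k A ?h"
  proof (rule ring_hom_ringI)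
    show "?h (x \<otimes>\<^bsub>?k\<^esub> y) = ?h x \<otimes> ?h y" for x y
      by (simp add: ring_of_type_algebra_def mult_single plus_list_def flip: Phi_mult)
    show "?h (x \<oplus>\<^bsub>?k\<^esub> y) = ?h x \<oplus> ?h y" for x y
      by (simp add: ring_of_type_algebra_def single_add flip: Phi_add)
    show "?h \<one>\<^bsub>?k\<^esub> = \<one>" by (simp add: ring_of_type_algebra_def flip: Phi_one one_single)
  qed (rule k.ring_axioms ring_axioms Phi_closed)+
  moreover have "\<one> \<noteq> \<zero>"
  proof -
    have "\<one> = \<Phi> (Poly_Mapping.single [] 1)" by (simp add: Phi_one flip: one_single)
    then show ?thesis using Nil_normal by (simp add: Phi_eq_zero_iff)
  qed
  ultimately have "subfield (?h ` carrier ?k) A"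
    by (rule ring_hom_ring.img_is_subfield(2)[OF _ k.carrier_is_subfield])
  then show ?thesis by (simp add: ring_of_type_algebra_def)
qed

lemma dim_component:
  "dim (range (\<lambda>c. \<Phi> (Poly_Mapping.single [] c))) {\<Phi> p | p. \<forall>w\<in>keys p. length w = i} =
     card {w \<in> N. length w = i}"
proof -
  let ?F = "{w \<in> N. length w = i}"
  have "finite ?F" by (rule finite_words_eq)
  then have "dimension (card ?F) (range (\<lambda>c. \<Phi> (Poly_Mapping.single [] c))) {\<Phi> p | p. keys p \<subseteq> ?F}"
    by (rule dimension_span) auto
  moreover have "{\<Phi> p | p. keys p \<subseteq> ?F} = {\<Phi> p | p. \<forall>w\<in>keys p. length w = i}"
  proof (intro equalityI subsetI)
    fix x assume "x \<in> {\<Phi> p | p. \<forall>w\<in>keys p. length w = i}"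
    then obtain p where p: "x = \<Phi> p" "\<forall>w\<in>keys p. length w = i" by blast
    obtain q where "\<Phi> q = \<Phi> p" "keys q = keys p \<inter> N" using Phi_normal_part by blast
    then have "x = \<Phi> q" "keys q \<subseteq> ?F" using p by auto
    then show "x \<in> {\<Phi> p | p. keys p \<subseteq> ?F}" by blast
  qed blast
  ultimately show ?thesis using dimI[OF subfield_scalars] by (simp add: over_def)
qed

end

text \<open>The upper bound makes \<open>n\<close> an admissible exponent. The lower bound along the
  multiples of \<open>M\<close> excludes every smaller \<open>e\<close>, as it would bound a
  positive power of \<open>q\<close>.\<close>

lemma Inf_growth_exponents:
  fixes f :: "nat \<Rightarrow> nat"
  assumes upper: "\<And>m. f m \<le> (m + 1) ^ n" and lower: "\<And>q. (q + 1) ^ n \<le> f (M * q)" and M: "M \<ge> 1"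
  shows "Inf (ereal ` {e. \<exists>C>0. \<forall>m\<ge>1. real (f m) \<le> C * real m powr e}) = ereal (real n)"
proof (rule Inf_eqI)
  fix x assume "x \<in> ereal ` {e. \<exists>C>0. \<forall>m\<ge>1. real (f m) \<le> C * real m powr e}"
  then obtain e C where x: "x = ereal e" and C: "C > 0" "\<And>m. m \<ge> 1 \<Longrightarrow> real (f m) \<le> C * real m powr e"
    by blast
  have "real n \<le> e"
  proof (rule ccontr)
    assume "\<not> real n \<le> e"
    then have d: "real n - e > 0" (is "?d > 0") by simp
    define D where "D = C * real M powr e"
    have D: "D > 0" using C(1) M by (simp add: D_def)
    \<comment> \<open>Chosen so that \<open>q\<close> to the power \<open>?d\<close> exceeds
      \<open>D\<close>, and so that \<open>M * q\<close> is positive.\<close>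
    obtain q :: nat where q: "real q > max 1 (D powr (1 / ?d))" using reals_Archimedean2 by blast
    then have q1: "q \<ge> 1" by simp
    have "real q powr real n \<le> real ((q + 1) ^ n)"
      using q1 by (simp add: powr_realpow power_mono)
    also have "\<dots> \<le> real (f (M * q))" using lower[of q] by (simp only: of_nat_le_iff)
    also have "\<dots> \<le> C * real (M * q) powr e" using C(2)[of "M * q"] M q1 by simp
    also have "\<dots> = D * real q powr e" by (simp add: D_def powr_mult)
    finally have "real q powr real n \<le> D * real q powr e" .
    then have "real q powr ?d \<le> D" using q1 by (simp add: powr_diff divide_le_eq)
    moreover have "(D powr (1 / ?d)) powr ?d < real q powr ?d"
      using q D d by (intro powr_less_mono2) auto
    moreover have "(D powr (1 / ?d)) powr ?d = D" using D d by (simp add: powr_powr)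
    ultimately show False by simp
  qed
  then show "ereal (real n) \<le> x" by (simp add: x)
next
  fix y assume y: "\<And>x. x \<in> ereal ` {e. \<exists>C>0. \<forall>m\<ge>1. real (f m) \<le> C * real m powr e} \<Longrightarrow> y \<le> x"
  \<comment> \<open>The constant comes from \<open>m + 1 \<le> 2 * m\<close>.\<close>
  have "real (f m) \<le> 2 ^ n * real m powr real n" if m: "m \<ge> 1" for m
  proof -
    have "real (f m) \<le> real ((m + 1) ^ n)" using upper[of m] by (simp only: of_nat_le_iff)
    also have "\<dots> \<le> (2 * real m) ^ n" using m unfolding of_nat_power by (intro power_mono) simp_all
    also have "\<dots> = 2 ^ n * real m powr real n" using m by (simp add: power_mult_distrib powr_realpow)
    finally show ?thesis .
  qed
  then have "\<exists>C>0. \<forall>m\<ge>1. real (f m) \<le> C * real m powr real n" by (intro exI[of _ "2 ^ n"]) simp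
  then show "y \<le> ereal (real n)" by (intro y imageI) simp
qed

section \<open>Counting products of atoms\<close>

context lyndon_monomial
begin

lemma PR_Suc: "k < n \<Longrightarrow> PR 0 (Suc k) = {concat (replicate i (a k)) @ s | i s. s \<in> PR 0 k}"
proof (intro equalityI subsetI)
  fix w assume k: "k < n" "w \<in> PR 0 (Suc k)"
  then obtain t s where "t \<in> PR k (Suc k)" "s \<in> PR 0 k" "w = t @ s"
    using PR_split_mid[of w 0 "Suc k" k] by auto
  then show "w \<in> {concat (replicate i (a k)) @ s | i s. s \<in> PR 0 k}"
    using PR_single[OF k(1)] by blast
next
  fix w assume k: "k < n" and "w \<in> {concat (replicate i (a k)) @ s | i s. s \<in> PR 0 k}"
  then show "w \<in> PR 0 (Suc k)" using PR_append_mid[OF power_in_PR[OF k]] by auto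
qed

lemma power_append_inj:
  assumes "k < n" "s \<in> PR 0 k" "s' \<in> PR 0 k"
    and e: "concat (replicate i (a k)) @ s = concat (replicate i' (a k)) @ s'"
  shows "i = i' \<and> s = s'"
proof -
  have P: "concat (replicate i (a k)) \<in> PR k n" for i
    using power_in_PR[OF assms(1)] PR_mono[of k k "Suc k" n] assms(1) by auto
  have "concat (replicate i (a k)) = concat (replicate i' (a k))" "s = s'"
    using PR_split_unique[OF P assms(2) P assms(3) less_imp_le[OF assms(1)] e] by blast+
  then show ?thesis using power_inj[OF assms(1)] by blast
qed

text \<open>As the largest atom allowed, \<open>a k\<close> occurs as a factor only at the front.
  Words without it give the first term, and from the others one copy is stripped. For generating
  functions this recursion is multiplication by the geometric series of \<open>a k\<close>.\<close>

lemma card_PR_Suc: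
  assumes k: "k < n"
  shows "card {w \<in> PR 0 (Suc k). length w = m} = card {w \<in> PR 0 k. length w = m} +
    (if m < length (a k) then 0 else card {w \<in> PR 0 (Suc k). length w = m - length (a k)})"
proof -
  let ?A = "{w \<in> PR 0 k. length w = m}"
  let ?B = "{w \<in> PR 0 (Suc k). length w + length (a k) = m}"
  have eq: "{w \<in> PR 0 (Suc k). length w = m} = ?A \<union> (\<lambda>w. a k @ w) ` ?B"
  proof (intro equalityI subsetI)
    fix w assume "w \<in> {w \<in> PR 0 (Suc k). length w = m}"
    then obtain i s where w: "w = concat (replicate i (a k)) @ s" "s \<in> PR 0 k" "length w = m"
      unfolding PR_Suc[OF k] by blast
    show "w \<in> ?A \<union> (\<lambda>w. a k @ w) ` ?B"
    proof (cases i)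
      case 0
      then show ?thesis using w by simp
    next
      case (Suc i')
      have "concat (replicate i' (a k)) @ s \<in> PR 0 (Suc k)" unfolding PR_Suc[OF k] using w(2) by blast
      then show ?thesis using w(1,3) Suc by (intro UnI2 image_eqI[of _ _ "concat (replicate i' (a k)) @ s"]) auto
    qed
  next
    fix w assume "w \<in> ?A \<union> (\<lambda>w. a k @ w) ` ?B"
    then show "w \<in> {w \<in> PR 0 (Suc k). length w = m}"
    proof
      assume "w \<in> ?A"
      then show ?thesis using PR_mono[of 0 0 k "Suc k"] by auto
    next
      assume "w \<in> (\<lambda>w. a k @ w) ` ?B"
      then obtain i s where w: "w = a k @ concat (replicate i (a k)) @ s" "s \<in> PR 0 k" "length w = m"
        unfolding PR_Suc[OF k] by auto
      have "w = concat (replicate (Suc i) (a k)) @ s" using w(1) by simp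
      then have "w \<in> PR 0 (Suc k)" unfolding PR_Suc[OF k] using w(2) by blast
      then show ?thesis using w(3) by simp
    qed
  qed
  have disjoint: "?A \<inter> (\<lambda>w. a k @ w) ` ?B = {}"
  proof -
    have False if A: "w \<in> PR 0 k" and B: "w' \<in> PR 0 (Suc k)" "w = a k @ w'" for w w'
    proof -
      obtain i s where s: "w' = concat (replicate i (a k)) @ s" "s \<in> PR 0 k"
        using B(1) unfolding PR_Suc[OF k] by blast
      have "concat (replicate 0 (a k)) @ w = concat (replicate (Suc i) (a k)) @ s" using s(1) B(2) by simp
      then show False using power_append_inj[OF k A s(2)] by blast
    qed
    then show ?thesis by blast
  qed
  have "finite ?B" by (rule finite_subset[OF _ finite_words_le[of "PR 0 (Suc k)" m]]) auto
  then have "card {w \<in> PR 0 (Suc k). length w = m} = card ?A + card ((\<lambda>w. a k @ w) ` ?B)"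
    unfolding eq using finite_words_eq disjoint by (intro card_Un_disjoint) auto
  also have "card ((\<lambda>w. a k @ w) ` ?B) = card ?B" by (intro card_image inj_onI) simp
  also have "card ?B = (if m < length (a k) then 0 else card {w \<in> PR 0 (Suc k). length w = m - length (a k)})"
  proof (cases "m < length (a k)")
    case True
    then have "?B = {}" by auto
    then show ?thesis using True by simp
  next
    case False
    then have "?B = {w \<in> PR 0 (Suc k). length w = m - length (a k)}" by auto
    then show ?thesis using False by simp
  qed
  finally show ?thesis .
qed

lemma generating_function_PR:
  "k \<le> n \<Longrightarrow> Abs_fps (\<lambda>m. of_nat (card {w \<in> PR 0 k. length w = m})) =
     (\<Prod>i<k. 1 / (1 - fps_X ^ length (a i)) :: 'b::field fps)"
proof (induction k)
  case 0
  have "{w \<in> PR 0 0. length w = m} = (if m = 0 then {[]} else {})" for m by (auto simp: PR_empty)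
  then show ?case by (intro fps_ext) (simp add: fps_one_nth)
next
  case (Suc k)
  let ?H = "\<lambda>k. Abs_fps (\<lambda>m. of_nat (card {w \<in> PR 0 k. length w = m})) :: 'b fps"
  let ?d = "1 - fps_X ^ length (a k) :: 'b fps"
  have "a k \<noteq> []" using a_atom[of k] Suc.prems by (auto simp: lyndon_def)
  then have d: "?d $ 0 \<noteq> 0" by simp
  have "?H (Suc k) * ?d = ?H k"
  proof (rule fps_ext)
    fix m
    show "(?H (Suc k) * ?d) $ m = ?H k $ m"
      using card_PR_Suc[of k m] Suc.prems by (simp add: right_diff_distrib fps_X_power_mult_right_nth)
  qed
  moreover have "?H (Suc k) = ?H (Suc k) * ?d * inverse ?d"
    using inverse_mult_eq_1'[OF d] by (simp add: mult.assoc)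
  moreover have "1 / ?d = inverse ?d" using fps_divide_unit[OF d, of 1] by simp
  ultimately show ?case using Suc by simp
qed

text \<open>Atoms are nonempty, so the exponent of each takes at most \<open>m + 1\<close>
  values.\<close>

lemma card_PR_le:
  "k \<le> n \<Longrightarrow> card {w \<in> PR 0 k. length w \<le> m} \<le> (m + 1) ^ k"
proof (induction k)
  case 0
  have "card {w \<in> PR 0 0. length w \<le> m} \<le> card {[] :: letter list}"
    by (rule card_mono) (auto simp: PR_empty)
  then show ?case by simp
next
  case (Suc k)
  then have k: "k < n" by simp
  let ?S = "{w \<in> PR 0 k. length w \<le> m}"
  have "a k \<noteq> []" using a_atom[OF k] by (auto simp: lyndon_def)
  then have l: "length (a k) \<ge> 1" by (simp add: Suc_le_eq)
  have len: "length (concat (replicate i (a k))) \<ge> i" for i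
    using l by (induction i) simp_all
  have "{w \<in> PR 0 (Suc k). length w \<le> m} \<subseteq> (\<lambda>(i, s). concat (replicate i (a k)) @ s) ` ({..m} \<times> ?S)"
  proof
    fix w assume "w \<in> {w \<in> PR 0 (Suc k). length w \<le> m}"
    then obtain i s where w: "w = concat (replicate i (a k)) @ s" "s \<in> PR 0 k" "length w \<le> m"
      unfolding PR_Suc[OF k] by blast
    then have "(i, s) \<in> {..m} \<times> ?S" using len[of i] by auto
    then show "w \<in> (\<lambda>(i, s). concat (replicate i (a k)) @ s) ` ({..m} \<times> ?S)"
      by (rule rev_image_eqI) (simp add: w(1))
  qed
  then have "card {w \<in> PR 0 (Suc k). length w \<le> m} \<le> card ({..m} \<times> ?S)"
    using finite_words_le[of "PR 0 k" m] by (intro surj_card_le) simp_all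
  also have "\<dots> = (m + 1) * card ?S" by (simp add: card_cartesian_product)
  also have "\<dots> \<le> (m + 1) ^ Suc k"
    unfolding power_Suc using Suc by (intro mult_le_mono order.refl) simp
  finally show ?case .
qed

text \<open>The exponents of the atoms can be chosen independently from 0 to \<open>q\<close>, and
  each atom then contributes at most \<open>L * q\<close> to the length.\<close>

lemma card_PR_ge:
  assumes L: "\<And>i. i < n \<Longrightarrow> length (a i) \<le> L"
  shows "k \<le> n \<Longrightarrow> (q + 1) ^ k \<le> card {w \<in> PR 0 k. length w \<le> k * L * q}"
proof (induction k)
  case 0
  have "card {[] :: letter list} \<le> card {w \<in> PR 0 0. length w \<le> 0 * L * q}"
    by (rule card_mono[OF finite_words_le]) (simp add: PR_empty)
  then show ?case by simp
next
  case (Suc k)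
  then have k: "k < n" by simp
  let ?S = "{w \<in> PR 0 k. length w \<le> k * L * q}" and ?f = "\<lambda>(i, s). concat (replicate i (a k)) @ s"
  have len: "length (concat (replicate i (a k))) \<le> L * q" if "i \<le> q" for i
  proof -
    have "length (concat (replicate i (a k))) = i * length (a k)" by (induction i) simp_all
    also have "\<dots> \<le> q * L" using that L[OF k] by (rule mult_le_mono)
    finally show ?thesis by (simp add: mult.commute)
  qed
  have "(q + 1) ^ Suc k \<le> (q + 1) * card ?S"
    unfolding power_Suc using Suc by (intro mult_le_mono order.refl) simp
  also have "\<dots> = card ({..q} \<times> ?S)" by (simp add: card_cartesian_product)
  also have "\<dots> = card (?f ` ({..q} \<times> ?S))"
    using power_append_inj[OF k] by (intro card_image[symmetric] inj_onI) auto
  also have "\<dots> \<le> card {w \<in> PR 0 (Suc k). length w \<le> Suc k * L * q}"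
  proof (rule card_mono[OF finite_words_le], rule image_subsetI)
    fix x assume "x \<in> {..q} \<times> ?S"
    then obtain i s where x: "x = (i, s)" "i \<le> q" "s \<in> PR 0 k" "length s \<le> k * L * q" by auto
    have "?f x \<in> PR 0 (Suc k)" unfolding PR_Suc[OF k] x(1) using x(3) by auto
    moreover have "length (?f x) \<le> Suc k * L * q"
      using len[OF x(2)] x(4) unfolding x(1) by (simp add: algebra_simps)
    ultimately show "?f x \<in> {w \<in> PR 0 (Suc k). length w \<le> Suc k * L * q}" by simp
  qed
  finally show ?case .
qed

lemma dim_monomial_component:
  "ring.dim (monomial_algebra W) (monomial_algebra_scalars W)
     (monomial_algebra_component W i :: (letter list \<Rightarrow>\<^sub>0 'k::field) set set) = card {w \<in> N. length w = i}"
proof -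
  interpret A: word_algebra "monomial_algebra W" "mono_coset W :: (letter list \<Rightarrow>\<^sub>0 'k) \<Rightarrow> _" N
    by (rule word_algebra_monomial[OF normal_Nil])
  have "monomial_algebra_scalars W = range (\<lambda>c :: 'k. mono_coset W (Poly_Mapping.single [] c))"
    by (auto simp: monomial_algebra_scalars_def mono_coset_def)
  then show ?thesis
    using A.dim_component[of i] by (simp add: monomial_algebra_component_def mono_coset_def)
qed

lemma hilbert_series_monomial:
  "hilbert_series (monomial_algebra W) (monomial_algebra_scalars W)
     (monomial_algebra_component W :: nat \<Rightarrow> (letter list \<Rightarrow>\<^sub>0 'k::field) set set) =
   (\<Prod>i<n. 1 / (1 - fps_X ^ length (a i)))"
  unfolding hilbert_series_def dim_monomial_component
  using generating_function_PR[of n] by (simp add: PR_all)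

lemma gk_dimension_monomial:
  "gk_dimension (monomial_algebra W) (monomial_algebra_scalars W)
     (monomial_algebra_component W :: nat \<Rightarrow> (letter list \<Rightarrow>\<^sub>0 'k::field) set set) = ereal (real n)"
  unfolding gk_dimension_def dim_monomial_component sum_card_lengths
proof (rule Inf_growth_exponents)
  \<comment> \<open>The sum of the lengths bounds each of them. Adding 1 to \<open>n * ?L\<close>
    below keeps the factor positive for every \<open>n\<close>.\<close>
  let ?L = "\<Sum>i<n. length (a i)"
  have L: "length (a i) \<le> ?L" if "i < n" for i using that by (intro member_le_sum) simp_all
  show "card {w \<in> N. length w \<le> m} \<le> (m + 1) ^ n" for m
    using card_PR_le[of n m] by (simp add: PR_all)
  show "(q + 1) ^ n \<le> card {w \<in> N. length w \<le> (n * ?L + 1) * q}" for q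
  proof -
    have "(q + 1) ^ n \<le> card {w \<in> N. length w \<le> n * ?L * q}"
      using card_PR_ge[of ?L n q, OF L] by (simp add: PR_all)
    also have "\<dots> \<le> card {w \<in> N. length w \<le> (n * ?L + 1) * q}"
      by (rule card_mono[OF finite_words_le]) auto
    finally show ?thesis .
  qed
  show "1 \<le> n * ?L + 1" by simp
qed

end


section \<open>Fibonacci algebras\<close>

lemma lyndon_monomial_fib:
  assumes "n \<ge> 2"
  shows "lyndon_monomial (fib_W n) (\<lambda>i. fib_lyndon (fib_index n i)) n"
proof
  show "lyndon w" if "w \<in> fib_W n" for w using assms that by (rule lyndon_fib_W)
  show "lyndon_atoms (fib_W n) = (\<lambda>i. fib_lyndon (fib_index n i)) ` {..<n}"
    using lyndon_atoms_fib_W[OF assms] fib_index_image[of n] by (simp flip: image_image)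
  show "word_less (fib_lyndon (fib_index n i)) (fib_lyndon (fib_index n j))" if "i < j" "j < n" for i j
    using that by (rule fib_index_word_less)
qed

theorem mainTheorem4:
  fixes n :: nat
    and F :: "(letter list \<Rightarrow>\<^sub>0 'k::field) set ring"
  assumes "n \<ge> 2"
    and "F = fib_algebra n"
  shows "finite (fib_W n) \<and>
    lyndon_atoms (fib_W n) = fib_lyndon ` {..<n} \<and>
    hilbert_series F (fib_scalars n) (fib_component n) =
      (\<Prod>i<n. 1 / (1 - fps_X ^ length (fib_lyndon i))) \<and>
    left_global_dimension TYPE('u) F = enat n \<and>
    right_global_dimension TYPE('u) F = enat n \<and>
    gk_dimension F (fib_scalars n) (fib_component n) = ereal (real n)"
proof -
  interpret lyndon_monomial "fib_W n" "\<lambda>i. fib_lyndon (fib_index n i)" n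
    by (rule lyndon_monomial_fib[OF assms(1)])
  have antichain: "\<And>v w. v \<in> fib_W n \<Longrightarrow> w \<in> fib_W n \<Longrightarrow> sublist v w \<Longrightarrow> v = w"
    unfolding fib_W_def by blast
  \<comment> \<open>The chain has to end in a letter, and the reversed chain too; the two extreme
    atoms are indeed the letters.\<close>
  have ends: "fib_lyndon (fib_index n (n - 1)) = [LY]" "fib_lyndon (fib_index n 0) = [LX]"
    using assms(1) by (simp_all add: fib_index_def)
  have "finite (fib_W n)" using fib_W_eq[OF assms(1)] by simp
  moreover have "lyndon_atoms (fib_W n) = fib_lyndon ` {..<n}"
    by (rule lyndon_atoms_fib_W[OF assms(1)])
  \<comment> \<open>The atoms are enumerated in lexicographic order, whereas the product runs over
    the Fibonacci index.\<close>
  moreover have "hilbert_series F (fib_scalars n) (fib_component n) =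
      (\<Prod>i<n. 1 / (1 - fps_X ^ length (fib_lyndon i)))"
    unfolding assms(2) hilbert_series_monomial by (rule prod.reindex_bij_betw[OF fib_index_bij])
  moreover have "left_global_dimension TYPE('u) F = enat n"
    unfolding assms(2) using assms(1) antichain fib_index_relation ends(1) by (rule global_dimension_left)
  moreover have "right_global_dimension TYPE('u) F = enat n"
    unfolding assms(2) using assms(1) antichain fib_index_relation ends(2) by (rule global_dimension_right)
  moreover have "gk_dimension F (fib_scalars n) (fib_component n) = ereal (real n)"
    unfolding assms(2) by (rule gk_dimension_monomial)
  ultimately show ?thesis by blast
qed

end
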